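(* Let $(W,S)$ be a Coxeter group of type $A_n$ with $n\le3$, with braid group $B$, let $q\in\mathbb{C}$, and let $H^c_q$ be the cubic Hecke algebra, i.e. the quotient of the group algebra $\mathbb{C}[B]$ by the relations $(s-q)(s^2-1)=0$, $s\in S$. Then every representation of $H^c_q$ is good (as a representation of $B$) provided that $q$ is not a root of unity.
   Context: Let $\tau:W\to B$ be the canonical section given by reduced decompositions ($\tau(s)=s$ for $s\in S$, $\tau(ww')=\tau(w)\tau(w')$ when $\ell(ww')=\ell(w)+\ell(w')$). For a representation $V$ of $B$ put $V_s=(s^2-1)V$ for $s\in S$, and $$K_W(V)=\{(x_w)_{w\in W}\in V^W:\ x_{sw}-s\,x_w\in V_s\ \text{for all } s\in S,\ w\in W\}$$ (in the index, $s$ denotes the element of $W$; in $s\,x_w$ it denotes the generator of $B$). For $y\in W$ there is an embedding $i_y:V\to K_W(V)$, $i_y(v)=(\tau(wy^{-1})v)_{w\in W}$. The representation $V$ is called good if $K_W(V)$ is generated (spanned) by the subspaces $i_y(V)$, $y\in W$. *)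

theory Defs
  imports
    Complex_Main
    "HOL-Algebra.Multiplicative_Group"
    "HOL-Algebra.QuotRing"
    "HOL-Library.Function_Algebras"
begin

section \<open>Groups given by generators and relations\<close>

text \<open>The letter \<open>(x, True)\<close> stands for the generator \<open>x\<close>, the letter \<open>(x, False)\<close> for its
  inverse. A pair \<open>(u, v)\<close> in the set of relations stands for the relation \<open>u = v\<close>.\<close>

type_synonym 'a word = "('a \<times> bool) list"

definition words :: "'a set \<Rightarrow> 'a word set"
  where "words X = lists (X \<times> UNIV)"

inductive pres_equiv :: "'a set \<Rightarrow> ('a word \<times> 'a word) set \<Rightarrow> 'a word \<Rightarrow> 'a word \<Rightarrow> bool"
  for X :: "'a set" and R :: "('a word \<times> 'a word) set"
where
  rel: "(u, v) \<in> R \<Longrightarrow> u \<in> words X \<Longrightarrow> v \<in> words X \<Longrightarrow> a \<in> words X \<Longrightarrow> b \<in> words X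
        \<Longrightarrow> pres_equiv X R (a @ u @ b) (a @ v @ b)"
| cancel: "x \<in> X \<Longrightarrow> a \<in> words X \<Longrightarrow> b \<in> words X
        \<Longrightarrow> pres_equiv X R (a @ [(x, e), (x, \<not> e)] @ b) (a @ b)"
| refl: "u \<in> words X \<Longrightarrow> pres_equiv X R u u"
| sym: "pres_equiv X R u v \<Longrightarrow> pres_equiv X R v u"
| trans: "pres_equiv X R u v \<Longrightarrow> pres_equiv X R v w \<Longrightarrow> pres_equiv X R u w"

definition pres_class :: "'a set \<Rightarrow> ('a word \<times> 'a word) set \<Rightarrow> 'a word \<Rightarrow> 'a word set"
  where "pres_class X R u = {v. pres_equiv X R u v}"

definition presented_group :: "'a set \<Rightarrow> ('a word \<times> 'a word) set \<Rightarrow> 'a word set monoid"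
  where "presented_group X R =
    \<lparr>carrier = pres_class X R ` words X,
     mult = (\<lambda>A B. \<Union>u\<in>A. \<Union>v\<in>B. pres_class X R (u @ v)),
     one = pres_class X R []\<rparr>"

definition pres_gen :: "'a set \<Rightarrow> ('a word \<times> 'a word) set \<Rightarrow> 'a \<Rightarrow> 'a word set"
  where "pres_gen X R x = pres_class X R [(x, True)]"


section \<open>Coxeter systems and braid groups\<close>

fun alternating :: "nat \<Rightarrow> 'a \<Rightarrow> 'a \<Rightarrow> 'a word"
  where
    "alternating 0 s t = []"
  | "alternating (Suc m) s t = (s, True) # alternating m t s"

text \<open>\<^const>\<open>group.ord\<close> is \<open>0\<close> on elements of infinite order; for such \<open>s \<otimes> t\<close> both sets of
  relations below contain only the empty relation \<open>[] = []\<close>.\<close>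

definition coxeter_rels :: "('w, 'm) monoid_scheme \<Rightarrow> 'w set \<Rightarrow> ('w word \<times> 'w word) set"
  where "coxeter_rels W S =
    {(alternating (2 * group.ord W (s \<otimes>\<^bsub>W\<^esub> t)) s t, []) | s t. s \<in> S \<and> t \<in> S}"

definition braid_rels :: "('w, 'm) monoid_scheme \<Rightarrow> 'w set \<Rightarrow> ('w word \<times> 'w word) set"
  where "braid_rels W S =
    {(alternating (group.ord W (s \<otimes>\<^bsub>W\<^esub> t)) s t, alternating (group.ord W (s \<otimes>\<^bsub>W\<^esub> t)) t s)
     | s t. s \<in> S \<and> t \<in> S}"

definition coxeter_system :: "('w, 'm) monoid_scheme \<Rightarrow> 'w set \<Rightarrow> bool"
  where "coxeter_system W S \<longleftrightarrow>
    group W \<and> S \<subseteq> carrier W \<and> (\<forall>s\<in>S. group.ord W s = 2) \<and>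
    (\<exists>h \<in> iso (presented_group S (coxeter_rels W S)) W.
       \<forall>s\<in>S. h (pres_gen S (coxeter_rels W S) s) = s)"

definition coxeter_type_A :: "nat \<Rightarrow> ('w, 'm) monoid_scheme \<Rightarrow> 'w set \<Rightarrow> bool"
  where "coxeter_type_A n W S \<longleftrightarrow> coxeter_system W S \<and>
    (\<exists>g. bij_betw g {1..n} S \<and>
      (\<forall>i\<in>{1..n}. \<forall>j\<in>{1..n}. i < j \<longrightarrow>
         group.ord W (g i \<otimes>\<^bsub>W\<^esub> g j) = (if j = i + 1 then 3 else 2)))"

definition braid_group :: "('w, 'm) monoid_scheme \<Rightarrow> 'w set \<Rightarrow> 'w word set monoid"
  where "braid_group W S = presented_group S (braid_rels W S)"

definition braid_gen :: "('w, 'm) monoid_scheme \<Rightarrow> 'w set \<Rightarrow> 'w \<Rightarrow> 'w word set"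
  where "braid_gen W S s = pres_gen S (braid_rels W S) s"

definition is_decomposition :: "('w, 'm) monoid_scheme \<Rightarrow> 'w set \<Rightarrow> 'w \<Rightarrow> 'w list \<Rightarrow> bool"
  where "is_decomposition W S w ss \<longleftrightarrow> set ss \<subseteq> S \<and> foldr (\<otimes>\<^bsub>W\<^esub>) ss \<one>\<^bsub>W\<^esub> = w"

definition cox_length :: "('w, 'm) monoid_scheme \<Rightarrow> 'w set \<Rightarrow> 'w \<Rightarrow> nat"
  where "cox_length W S w = (LEAST k. \<exists>ss. is_decomposition W S w ss \<and> length ss = k)"

definition is_reduced_decomposition :: "('w, 'm) monoid_scheme \<Rightarrow> 'w set \<Rightarrow> 'w \<Rightarrow> 'w list \<Rightarrow> bool"
  where "is_reduced_decomposition W S w ss \<longleftrightarrow>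
    is_decomposition W S w ss \<and> length ss = cox_length W S w"

text \<open>By Matsumoto's theorem the value does not depend on the reduced decomposition chosen.\<close>

definition canonical_section :: "('w, 'm) monoid_scheme \<Rightarrow> 'w set \<Rightarrow> 'w \<Rightarrow> 'w word set"
  where "canonical_section W S w =
    foldr (\<otimes>\<^bsub>braid_group W S\<^esub>)
      (map (braid_gen W S) (SOME ss. is_reduced_decomposition W S w ss)) \<one>\<^bsub>braid_group W S\<^esub>"


section \<open>Good representations of the braid group\<close>

text \<open>The representation space \<open>V\<close> is the whole type \<open>'v\<close> with scalar multiplication \<open>scale\<close>, and
  \<open>\<rho>\<close> is the action of the braid group. \<open>V\<^sup>W\<close> is the space of functions vanishing outside
  \<open>carrier W\<close>.\<close>

definition V_sub ::
    "('w, 'm) monoid_scheme \<Rightarrow> 'w set \<Rightarrow> ('w word set \<Rightarrow> 'v::ab_group_add \<Rightarrow> 'v) \<Rightarrow> 'w \<Rightarrow> 'v set"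
  where "V_sub W S \<rho> s =
    range (\<lambda>v. \<rho> (braid_gen W S s \<otimes>\<^bsub>braid_group W S\<^esub> braid_gen W S s) v - v)"

definition K_space ::
    "('w, 'm) monoid_scheme \<Rightarrow> 'w set \<Rightarrow> ('w word set \<Rightarrow> 'v::ab_group_add \<Rightarrow> 'v) \<Rightarrow> ('w \<Rightarrow> 'v) set"
  where "K_space W S \<rho> =
    {x. (\<forall>w. w \<notin> carrier W \<longrightarrow> x w = 0) \<and>
        (\<forall>s\<in>S. \<forall>w\<in>carrier W. x (s \<otimes>\<^bsub>W\<^esub> w) - \<rho> (braid_gen W S s) (x w) \<in> V_sub W S \<rho> s)}"

definition i_emb ::
    "('w, 'm) monoid_scheme \<Rightarrow> 'w set \<Rightarrow> ('w word set \<Rightarrow> 'v::ab_group_add \<Rightarrow> 'v) \<Rightarrow> 'w \<Rightarrow> 'v \<Rightarrow> 'w \<Rightarrow> 'v"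
  where "i_emb W S \<rho> y v =
    (\<lambda>w. if w \<in> carrier W then \<rho> (canonical_section W S (w \<otimes>\<^bsub>W\<^esub> inv\<^bsub>W\<^esub> y)) v else 0)"

definition good ::
    "('w, 'm) monoid_scheme \<Rightarrow> 'w set \<Rightarrow> (complex \<Rightarrow> 'v::ab_group_add \<Rightarrow> 'v)
      \<Rightarrow> ('w word set \<Rightarrow> 'v \<Rightarrow> 'v) \<Rightarrow> bool"
  where "good W S scale \<rho> \<longleftrightarrow>
    K_space W S \<rho> =
      Modules.module.span (\<lambda>c (x :: 'w \<Rightarrow> 'v) w. scale c (x w))
        (\<Union>y\<in>carrier W. range (i_emb W S \<rho> y))"


section \<open>The cubic Hecke algebra and its representations\<close>

definition group_algebra :: "('g, 'm) monoid_scheme \<Rightarrow> ('g \<Rightarrow> complex) ring"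
  where "group_algebra G =
    \<lparr>carrier = {f. finite {g. f g \<noteq> 0} \<and> {g. f g \<noteq> 0} \<subseteq> carrier G},
     mult = (\<lambda>f h g. \<Sum>a | f a \<noteq> 0. \<Sum>b | h b \<noteq> 0. if a \<otimes>\<^bsub>G\<^esub> b = g then f a * h b else 0),
     one = (\<lambda>g. if g = \<one>\<^bsub>G\<^esub> then 1 else 0),
     zero = (\<lambda>g. 0),
     add = (\<lambda>f h g. f g + h g)\<rparr>"

definition single :: "'g \<Rightarrow> complex \<Rightarrow> 'g \<Rightarrow> complex"
  where "single a c = (\<lambda>g. if g = a then c else 0)"

definition cubic_relator :: "('w, 'm) monoid_scheme \<Rightarrow> 'w set \<Rightarrow> complex \<Rightarrow> 'w \<Rightarrow> 'w word set \<Rightarrow> complex"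
  where "cubic_relator W S q s =
    (let A = group_algebra (braid_group W S);
         T = single (braid_gen W S s) 1;
         Q = single \<one>\<^bsub>braid_group W S\<^esub> q
     in (T \<ominus>\<^bsub>A\<^esub> Q) \<otimes>\<^bsub>A\<^esub> (T \<otimes>\<^bsub>A\<^esub> T \<ominus>\<^bsub>A\<^esub> \<one>\<^bsub>A\<^esub>))"

definition cubic_ideal :: "('w, 'm) monoid_scheme \<Rightarrow> 'w set \<Rightarrow> complex \<Rightarrow> ('w word set \<Rightarrow> complex) set"
  where "cubic_ideal W S q = Idl\<^bsub>group_algebra (braid_group W S)\<^esub> (cubic_relator W S q ` S)"

definition cubic_hecke :: "('w, 'm) monoid_scheme \<Rightarrow> 'w set \<Rightarrow> complex \<Rightarrow> ('w word set \<Rightarrow> complex) set ring"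
  where "cubic_hecke W S q = group_algebra (braid_group W S) Quot cubic_ideal W S q"

definition hecke_class ::
    "('w, 'm) monoid_scheme \<Rightarrow> 'w set \<Rightarrow> complex \<Rightarrow> ('w word set \<Rightarrow> complex) \<Rightarrow> ('w word set \<Rightarrow> complex) set"
  where "hecke_class W S q f = cubic_ideal W S q +>\<^bsub>group_algebra (braid_group W S)\<^esub> f"

definition End_ring :: "(complex \<Rightarrow> 'v::ab_group_add \<Rightarrow> 'v) \<Rightarrow> ('v \<Rightarrow> 'v) ring"
  where "End_ring scale =
    \<lparr>carrier = {f. Vector_Spaces.linear scale scale f},
     mult = (\<circ>), one = id, zero = (\<lambda>v. 0), add = (\<lambda>f g v. f v + g v)\<rparr>"

text \<open>A representation is a homomorphism of \<open>\<complex>\<close>-algebras to the endomorphisms of a complex vector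
  space; for a ring homomorphism, \<open>\<complex>\<close>-linearity amounts to the last condition.\<close>

definition cubic_hecke_rep ::
    "('w, 'm) monoid_scheme \<Rightarrow> 'w set \<Rightarrow> complex \<Rightarrow> (complex \<Rightarrow> 'v::ab_group_add \<Rightarrow> 'v)
      \<Rightarrow> (('w word set \<Rightarrow> complex) set \<Rightarrow> 'v \<Rightarrow> 'v) \<Rightarrow> bool"
  where "cubic_hecke_rep W S q scale \<phi> \<longleftrightarrow>
    vector_space scale \<and>
    \<phi> \<in> ring_hom (cubic_hecke W S q) (End_ring scale) \<and>
    (\<forall>c. \<phi> (hecke_class W S q (single \<one>\<^bsub>braid_group W S\<^esub> c)) = scale c)"

definition braid_action ::
    "('w, 'm) monoid_scheme \<Rightarrow> 'w set \<Rightarrow> complex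
      \<Rightarrow> (('w word set \<Rightarrow> complex) set \<Rightarrow> 'v \<Rightarrow> 'v) \<Rightarrow> 'w word set \<Rightarrow> 'v \<Rightarrow> 'v"
  where "braid_action W S q \<phi> b = \<phi> (hecke_class W S q (single b 1))"

end

theory Submission
  imports Defs "HOL-Library.Set_Algebras" "Jordan_Normal_Form.Char_Poly"
begin

text \<open>For \<open>I \<subseteq> S\<close> let \<open>K\<^sub>I\<close> be the space defined
  like \<open>K\<^sub>W(V)\<close> but with the conditions for \<open>s \<in> I\<close> only, let \<open>\<Theta>\<^sub>g\<close> be the operator
  \<open>(\<Theta>\<^sub>g x)\<^sub>w = \<tau>(g) x\<^sub>h\<close>, \<open>h = g\<^sup>-\<^sup>1w\<close>, on \<open>V\<^sup>W\<close>, and let \<open>S\<^sub>I\<close> be the sum of the \<open>\<Theta>\<^sub>g\<close> over the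
  parabolic subgroup \<open>W\<^sub>I\<close>. The embeddings \<open>i\<^sub>y\<close> together span the image of \<open>S\<^sub>S\<close>, so goodness is
  the case \<open>I = S\<close> of the equation \<open>K\<^sub>I = im S\<^sub>I\<close>, which is proved by induction on \<open>I\<close>
  (\<open>K_par_eq_range_symmetrizer\<close>).

  The full twist \<open>z = \<tau>(w\<^sub>I)\<^sup>2\<close>, where \<open>w\<^sub>I\<close> is the longest element of \<open>W\<^sub>I\<close>, acts trivially on
  \<open>K\<^sub>I / im S\<^sub>I\<close>. Indeed, by Solomon's identity the alternating sum over \<open>J \<subseteq> I\<close> of the sums of
  \<open>\<Theta>\<^sub>g\<close> over the minimal representatives \<open>g\<close> of the cosets of \<open>W\<^sub>J\<close> in \<open>W\<^sub>I\<close> is the operator of \<open>w\<^sub>I\<close>.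
  If \<open>x \<in> K\<^sub>I\<close> and \<open>J\<close> is a proper subset, then \<open>x = S\<^sub>J y\<close> by induction, so that the \<open>J\<close>-th sum
  sends \<open>x\<close> to \<open>S\<^sub>I y\<close>. Hence the operator of \<open>w\<^sub>I\<close> is \<open>\<plusminus>1\<close> modulo \<open>im S\<^sub>I\<close>
  (\<open>longest_step\<close>, \<open>full_twist_step\<close>).

  On the other hand, \<open>z\<close> has no eigenvalue \<open>1\<close> on anything generated by the spaces \<open>V\<^sub>s\<close>. Suppose
  that \<open>f z = f \<noteq> 0\<close> and \<open>f s = q f\<close> in the image \<open>H\<close> of the group algebra. On the space of all
  \<open>h \<in> H\<close> with \<open>h z = h\<close> each generator acts with determinant a power of \<open>q\<close> up to sign, the
  exponent for \<open>s\<close> being positive, while the product of these determinants along a word for \<open>z\<close> is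
  \<open>1\<close>; so \<open>q\<close> would be a root of unity. Therefore some polynomial \<open>p\<close> with \<open>p(1) \<noteq> 0\<close> satisfies
  \<open>p(z) (s\<^sup>2 - 1) = 0\<close> for all \<open>s \<in> I\<close> (\<open>invertible_modulo_minus_one\<close>). For \<open>x \<in> K\<^sub>I\<close> the family
  \<open>y = p(z) x\<close> is flat, that is \<open>y\<^sub>s\<^sub>w = s y\<^sub>w\<close>, and a flat family is its own symmetrization up to
  the factor \<open>|W\<^sub>I|\<close>. Since \<open>p(z) x\<close> agrees with \<open>p(1) x\<close> modulo \<open>(z - 1) K\<^sub>I \<subseteq> im S\<^sub>I\<close>, this puts
  \<open>x\<close> into \<open>im S\<^sub>I\<close>.

  The determinants require \<open>H\<close> to be finite-dimensional. This is where \<open>n \<le> 3\<close> enters: a word in the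
  generators \<open>a, b, c\<close> of the braid group on four strands reduces, by the braid relations and the
  cubic equations, to a combination of words with at most two letters \<open>c\<^sup>\<plusminus>\<^sup>1\<close>
  (\<open>braid4.finite_span\<close>). The facts on Coxeter groups (exchange condition, Matsumoto's theorem,
  parabolic cosets, longest element) are derived from the presentation.\<close>

section \<open>Spans in a ring with scalars\<close>

text \<open>The scalars \<open>k c\<close> are elements of the ring and need not be central: scalar multiplication commutes
  with linear endomorphisms of \<open>V\<close>, but not with all additive ones. The set \<open>lin\<close> below collects the
  elements that commute with all scalars; left multiplication respects spans only for these.\<close>

locale scalar_ring =
  fixes k :: "'f::field \<Rightarrow> 'r::{ring,monoid_mult}"
  assumes k_add: "k (x + y) = k x + k y"
    and k_mult: "k (x * y) = k x * k y"
    and k_one: "k 1 = 1"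
begin

sublocale vs: vector_space "\<lambda>c x. k c * x"
  by standard (simp_all add: distrib_left distrib_right k_add k_mult k_one mult.assoc)

definition lin :: "'r set"
  where "lin = {x. \<forall>c. x * k c = k c * x}"

lemma linD: "x \<in> lin \<Longrightarrow> x * k c = k c * x"
  by (simp add: lin_def)

lemma lin_one [simp]: "1 \<in> lin" and lin_zero [simp]: "0 \<in> lin"
  by (simp_all add: lin_def)

lemma lin_mult [intro]: "x \<in> lin \<Longrightarrow> y \<in> lin \<Longrightarrow> x * y \<in> lin"
  unfolding lin_def mem_Collect_eq by (metis mult.assoc)

lemma lin_add [intro]: "x \<in> lin \<Longrightarrow> y \<in> lin \<Longrightarrow> x + y \<in> lin"
  by (simp add: lin_def algebra_simps)

lemma lin_k [simp]: "k c \<in> lin"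
  by (simp add: lin_def k_mult[symmetric] mult.commute)

lemma k_zero [simp]: "k 0 = 0"
  using k_add[of 0 0] by simp

lemma k_uminus: "k (- c) = - k c"
  using k_add[of c "- c"] by (simp add: eq_neg_iff_add_eq_0 add.commute)

lemma k_diff: "k (c - d) = k c - k d"
  using k_add[of c "- d"] by (simp add: k_uminus)

lemma subspace_lin: "vs.subspace lin"
  by (auto simp: vs.subspace_def)

lemma span_subset_lin: "X \<subseteq> lin \<Longrightarrow> vs.span X \<subseteq> lin"
  by (rule vs.span_minimal[OF _ subspace_lin])

lemma subspace_sandwich:
  assumes "l \<in> lin" "vs.subspace T"
  shows "vs.subspace {x. l * x * r \<in> T}"
proof -
  have "l * (k c * x) * r = k c * (l * x * r)" for c x
    using linD[OF assms(1), of c] by (metis mult.assoc)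
  thus ?thesis
    using vs.subspace_0[OF assms(2)] vs.subspace_add[OF assms(2)] vs.subspace_scale[OF assms(2)]
    by (simp add: vs.subspace_def distrib_left distrib_right)
qed

text \<open>Memberships that depend linearly on one factor are checked on generators of that factor.\<close>

lemma span_sandwich:
  assumes "x \<in> vs.span X" "vs.subspace T" "l \<in> lin" "\<And>y. y \<in> X \<Longrightarrow> l * y * r \<in> T"
  shows "l * x * r \<in> T"
  using vs.span_minimal[of X "{x. l * x * r \<in> T}"] subspace_sandwich[OF assms(3,2), of r] assms
  by auto

lemma span_left:
  assumes "x \<in> vs.span X" "vs.subspace T" "\<And>y. y \<in> X \<Longrightarrow> y * r \<in> T"
  shows "x * r \<in> T"
  using span_sandwich[of x X T 1 r] assms by simp

lemma span_right:
  assumes "x \<in> vs.span X" "vs.subspace T" "l \<in> lin" "\<And>y. y \<in> X \<Longrightarrow> l * y \<in> T"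
  shows "l * x \<in> T"
  using span_sandwich[of x X T l 1] assms by simp

lemma span_times:
  assumes "X \<subseteq> lin" "x \<in> vs.span X" "y \<in> vs.span Y"
  shows "x * y \<in> vs.span (X * Y)"
proof (rule span_left[OF assms(2)])
  fix z assume z: "z \<in> X"
  show "z * y \<in> vs.span (X * Y)"
    using assms z by (intro span_right[OF assms(3)]) (auto intro!: vs.span_base)
qed simp

end

section \<open>The cubic quotient of the braid group on three strands\<close>

text \<open>The primed letters are the inverses. The cubic equation is used in the form that a square is a
  combination of \<open>1\<close>, the letter and its inverse; the last coefficient must not vanish, so that also
  the square of the inverse is such a combination.\<close>

locale braid3 = scalar_ring k for k :: "'f::field \<Rightarrow> 'r::{ring,monoid_mult}" +
  fixes a b a' b' :: 'r and \<alpha> \<beta> \<gamma> :: 'f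
  assumes a_lin [simp]: "a \<in> lin" "a' \<in> lin" and b_lin [simp]: "b \<in> lin" "b' \<in> lin"
    and a_inv [simp]: "a * a' = 1" "a' * a = 1" and b_inv [simp]: "b * b' = 1" "b' * b = 1"
    and braid: "a * b * a = b * a * b"
    and a_quad: "a * a = k \<alpha> * a + k \<beta> + k \<gamma> * a'"
    and b_quad: "b * b = k \<alpha> * b + k \<beta> + k \<gamma> * b'"
    and \<gamma>: "\<gamma> \<noteq> 0"
begin

lemma invs [simp]: "a * (a' * x) = x" "a' * (a * x) = x" "b * (b' * x) = x" "b' * (b * x) = x"
  by (simp_all flip: mult.assoc)

lemma swap: "braid3 k b a b' a' \<alpha> \<beta> \<gamma>"
  by unfold_locales (simp_all add: braid a_quad b_quad \<gamma>)

text \<open>With the braid relations, the four conjugation rules sort every word \<open>b\<^sup>\<plusminus>\<^sup>1 a\<^sup>\<plusminus>\<^sup>1 b\<^sup>\<plusminus>\<^sup>1\<close> except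
  \<open>b a' b\<close> and \<open>b' a b'\<close> into the form \<open>a\<^sup>\<plusminus>\<^sup>1 b\<^sup>\<plusminus>\<^sup>1 a\<^sup>\<plusminus>\<^sup>1\<close>.\<close>

lemma conj1: "a * b * a' = b' * a * b"
proof -
  have "b' * (a * b * a) * a' = b' * (b * a * b) * a'" by (simp only: braid)
  thus ?thesis by (simp add: mult.assoc)
qed

lemma conj2: "a' * b * a = b * a * b'"
proof -
  have "a' * (a * b * a) * b' = a' * (b * a * b) * b'" by (simp only: braid)
  thus ?thesis by (simp add: mult.assoc)
qed

lemma conj3: "a * b' * a' = b' * a' * b"
proof -
  have "b' * (a' * b * a) * a' = b' * (b * a * b') * a'" by (simp only: conj2)
  thus ?thesis by (simp add: mult.assoc)
qed

lemma conj4: "a' * b' * a = b * a' * b'"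
proof -
  show ?thesis using braid3.conj3[OF swap] by simp
qed

lemma braid_inv: "a' * b' * a' = b' * a' * b'"
proof -
  have "a' * b' * a' * (b * a * b) * b' * a' * b' = a' * b' * a' * (a * b * a) * b' * a' * b'"
    by (simp only: braid)
  thus ?thesis by (simp add: mult.assoc)
qed

text \<open>Besides the sorted words, which span \<open>D\<close>, the algebra generated by \<open>a\<close> and \<open>b\<close> only needs the
  words \<open>x b a' b\<close> with \<open>x \<in> ua\<close>: the span \<open>M\<close> turns out to be closed under multiplication.\<close>

definition ua :: "'r set" where "ua = vs.span {1, a, a'}"
definition ub :: "'r set" where "ub = vs.span {1, b, b'}"
definition D :: "'r set" where "D = vs.span {x * y * z | x y z. x \<in> ua \<and> y \<in> ub \<and> z \<in> ua}"
definition M :: "'r set"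
  where "M = vs.span ({x * y * z | x y z. x \<in> ua \<and> y \<in> ub \<and> z \<in> ua} \<union> {x * (b * a' * b) | x. x \<in> ua})"

lemma sub_u: "vs.subspace ua" "vs.subspace ub" and sub_M: "vs.subspace M" and sub_D: "vs.subspace D"
  by (simp_all add: ua_def ub_def M_def D_def)

lemma u_gens [simp]: "1 \<in> ua" "a \<in> ua" "a' \<in> ua" "1 \<in> ub" "b \<in> ub" "b' \<in> ub"
  by (auto simp: ua_def ub_def intro: vs.span_base)

lemma u_lin: "x \<in> ua \<Longrightarrow> x \<in> lin" "x \<in> ub \<Longrightarrow> x \<in> lin"
  using span_subset_lin[of "{1, a, a'}"] span_subset_lin[of "{1, b, b'}"] by (auto simp: ua_def ub_def)

lemma a'_quad: "\<exists>p r s. a' * a' = k p * a - k r - k s * a'"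
proof -
  define g where "g = inverse \<gamma>"
  have "k g * (a * a - k \<alpha> * a - k \<beta>) = k (g * \<gamma>) * a'"
    by (simp only: a_quad k_mult mult.assoc) simp
  hence inv: "k g * (a * a - k \<alpha> * a - k \<beta>) = a'"
    by (simp only: g_def left_inverse[OF \<gamma>] k_one mult_1_left)
  have "a' * a' = k g * ((a * a - k \<alpha> * a - k \<beta>) * a')"
    by (simp only: mult.assoc[symmetric] inv)
  also have "(a * a - k \<alpha> * a - k \<beta>) * a' = a - k \<alpha> - k \<beta> * a'"
    by (simp add: left_diff_distrib mult.assoc)
  also have "k g * (a - k \<alpha> - k \<beta> * a') = k g * a - k (g * \<alpha>) - k (g * \<beta>) * a'"
    by (simp only: right_diff_distrib k_mult mult.assoc)
  finally show ?thesis by blast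
qed

lemma ua_mult: assumes "x \<in> ua" "y \<in> ua" shows "x * y \<in> ua"
proof -
  note s = sub_u(1)
  note [simp] = vs.subspace_add[OF s] vs.subspace_diff[OF s] vs.subspace_scale[OF s]
  have k_in: "k c \<in> ua" for c using vs.subspace_scale[OF s u_gens(1)] by (simp only: mult_1_right)
  have aa: "a * a \<in> ua" using k_in by (simp add: a_quad)
  have a'a': "a' * a' \<in> ua" using a'_quad k_in by (elim exE) (simp only:, simp)
  have "x * y \<in> ua" if "x \<in> {1, a, a'}" for x
    using assms(2) aa a'a' that by (intro span_right[OF assms(2)[unfolded ua_def] s]) auto
  thus ?thesis by (intro span_left[OF assms(1)[unfolded ua_def] s]) auto
qed

lemma ub_mult: "x \<in> ub \<Longrightarrow> y \<in> ub \<Longrightarrow> x * y \<in> ub"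
  using braid3.ua_mult[OF swap] unfolding ub_def braid3.ua_def[OF swap] .

lemma D_intro: "x \<in> ua \<Longrightarrow> y \<in> ub \<Longrightarrow> z \<in> ua \<Longrightarrow> x * y * z \<in> D"
  unfolding D_def by (rule vs.span_base) blast

lemma D_sub_M: "x \<in> D \<Longrightarrow> x \<in> M"
  unfolding D_def M_def using vs.span_mono by blast

lemma M_intro: "x \<in> ua \<Longrightarrow> x * (b * a' * b) \<in> M"
  unfolding M_def by (rule vs.span_base) blast

lemma D_ua: assumes "x \<in> D" "y \<in> ua" shows "x * y \<in> D" "y * x \<in> D"
proof -
  show "x * y \<in> D"
    using assms(1)[unfolded D_def] sub_D
  proof (rule span_left)
    fix w assume "w \<in> {x * y * z | x y z. x \<in> ua \<and> y \<in> ub \<and> z \<in> ua}"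
    then obtain p q r where w: "w = p * q * r" "p \<in> ua" "q \<in> ub" "r \<in> ua" by blast
    have "p * q * (r * y) \<in> D" using w assms(2) by (intro D_intro ua_mult)
    thus "w * y \<in> D" by (simp add: w mult.assoc)
  qed
  show "y * x \<in> D"
    using assms(1)[unfolded D_def] sub_D u_lin(1)[OF assms(2)]
  proof (rule span_right)
    fix w assume "w \<in> {x * y * z | x y z. x \<in> ua \<and> y \<in> ub \<and> z \<in> ua}"
    then obtain p q r where w: "w = p * q * r" "p \<in> ua" "q \<in> ub" "r \<in> ua" by blast
    have "(y * p) * q * r \<in> D" using w assms(2) by (intro D_intro ua_mult)
    thus "y * w \<in> D" by (simp add: w mult.assoc)
  qed
qed


lemma ua_D: "x \<in> ua \<Longrightarrow> x \<in> D" and ub_D: "y \<in> ub \<Longrightarrow> y \<in> D"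
  using D_intro[of x 1 1] D_intro[of 1 y 1] by simp_all

lemma M_decomp:
  assumes "m \<in> M" obtains d x where "d \<in> D" "x \<in> ua" "m = d + x * (b * a' * b)"
proof -
  let ?P = "b * a' * b"
  have "vs.subspace {d + x * ?P | d x. d \<in> D \<and> x \<in> ua}"
    unfolding vs.subspace_def
  proof (intro conjI ballI allI)
    show "0 \<in> {d + x * ?P | d x. d \<in> D \<and> x \<in> ua}"
      using vs.subspace_0[OF sub_D] vs.subspace_0[OF sub_u(1)] by force
  next
    fix u v assume "u \<in> {d + x * ?P | d x. d \<in> D \<and> x \<in> ua}" "v \<in> {d + x * ?P | d x. d \<in> D \<and> x \<in> ua}"
    then obtain d x d' x' where *: "u = d + x * ?P" "v = d' + x' * ?P" "d \<in> D" "d' \<in> D" "x \<in> ua" "x' \<in> ua"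
      by blast
    have "u + v = (d + d') + (x + x') * ?P" by (simp add: * distrib_right)
    thus "u + v \<in> {d + x * ?P | d x. d \<in> D \<and> x \<in> ua}"
      using vs.subspace_add[OF sub_D] vs.subspace_add[OF sub_u(1)] * by blast
  next
    fix c u assume "u \<in> {d + x * ?P | d x. d \<in> D \<and> x \<in> ua}"
    then obtain d x where *: "u = d + x * ?P" "d \<in> D" "x \<in> ua" by blast
    have "k c * u = k c * d + (k c * x) * ?P" by (simp add: * distrib_left mult.assoc)
    thus "k c * u \<in> {d + x * ?P | d x. d \<in> D \<and> x \<in> ua}"
      using vs.subspace_scale[OF sub_D] vs.subspace_scale[OF sub_u(1)] * by blast
  qed
  moreover have "{x * y * z | x y z. x \<in> ua \<and> y \<in> ub \<and> z \<in> ua} \<union> {x * ?P | x. x \<in> ua}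
      \<subseteq> {d + x * ?P | d x. d \<in> D \<and> x \<in> ua}"
  proof (intro Un_least subsetI)
    fix w assume "w \<in> {x * y * z | x y z. x \<in> ua \<and> y \<in> ub \<and> z \<in> ua}"
    hence "w \<in> D" by (auto intro: D_intro)
    thus "w \<in> {d + x * ?P | d x. d \<in> D \<and> x \<in> ua}" using vs.subspace_0[OF sub_u(1)] by force
  next
    fix w assume "w \<in> {x * ?P | x. x \<in> ua}"
    thus "w \<in> {d + x * ?P | d x. d \<in> D \<and> x \<in> ua}" using vs.subspace_0[OF sub_D] by force
  qed
  ultimately have "M \<subseteq> {d + x * ?P | d x. d \<in> D \<and> x \<in> ua}"
    unfolding M_def by (intro vs.span_minimal)
  thus ?thesis using assms that by blast
qed

text \<open>Conjugating \<open>b a' b\<close> through \<open>a\<close> leaves a square of \<open>b\<close>, which the quadratic relation resolves.\<close>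

lemma a_P: "a * (b * a' * b) = k \<alpha> * (a * b * a') + k \<beta> * (b' * a) + k \<gamma> * (b' * a * b')"
proof -
  have "a * (b * a' * b) = (a * b * a') * b" by (simp add: mult.assoc)
  also have "\<dots> = (b' * a * b) * b" by (simp only: conj1)
  also have "\<dots> = b' * a * (b * b)" by (simp only: mult.assoc)
  also have "\<dots> = k \<alpha> * (b' * a * b) + k \<beta> * (b' * a) + k \<gamma> * (b' * a * b')"
  proof -
    have "(b' * a) * k c = k c * (b' * a)" for c by (rule linD) auto
    thus ?thesis by (simp add: b_quad distrib_left) (simp only: mult.assoc[symmetric])
  qed
  finally show ?thesis by (simp only: conj1)
qed

lemma P_a: "(b * a' * b) * a = k \<alpha> * (a' * b * a) + k \<beta> * (a * b') + k \<gamma> * (b' * a * b')"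
proof -
  have "(b * a' * b) * a = b * (a' * b * a)" by (simp add: mult.assoc)
  also have "\<dots> = b * (b * a * b')" by (simp only: conj2)
  also have "\<dots> = (b * b) * (a * b')" by (simp only: mult.assoc)
  also have "\<dots> = k \<alpha> * (b * a * b') + k \<beta> * (a * b') + k \<gamma> * (b' * a * b')"
    by (simp add: b_quad distrib_right mult.assoc)
  finally show ?thesis by (simp only: conj2)
qed

lemma D_mem: "a * b * a' \<in> D" "a' * b * a \<in> D" "b' * a \<in> D" "a * b' \<in> D"
  using D_intro[of a b a'] D_intro[of a' b a] D_intro[of 1 b' a] D_intro[of a b' 1] by simp_all

text \<open>Modulo sorted words, the two exceptional words may be exchanged for each other.\<close>

lemma P_Q: "\<exists>x\<in>ua. (b * a' * b) - x * (b' * a * b') \<in> D"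
proof (rule bexI)
  have *: "a' * k \<gamma> = k \<gamma> * a'" by (rule linD) simp
  have "a' * (k \<alpha> * (a * b * a') + k \<beta> * (b' * a)) \<in> D"
    by (intro D_ua vs.subspace_add[OF sub_D] vs.subspace_scale[OF sub_D] D_mem u_gens)
  also have "a' * (k \<alpha> * (a * b * a') + k \<beta> * (b' * a)) = a' * (a * (b * a' * b) - k \<gamma> * (b' * a * b'))"
    by (simp only: a_P add_diff_cancel_right')
  also have "\<dots> = (b * a' * b) - k \<gamma> * a' * (b' * a * b')"
    by (simp add: right_diff_distrib mult.assoc[of a' "k \<gamma>", symmetric] *)
  finally show "(b * a' * b) - k \<gamma> * a' * (b' * a * b') \<in> D" .
qed (intro vs.subspace_scale[OF sub_u(1)] u_gens)

lemma Q_M: "b' * a * b' \<in> M"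
proof -
  have "k \<gamma> * (b' * a * b') = a * (b * a' * b) - (k \<alpha> * (a * b * a') + k \<beta> * (b' * a))"
    by (simp only: a_P add_diff_cancel_left')
  also have "\<dots> \<in> M"
    by (intro vs.subspace_add[OF sub_M] vs.subspace_diff[OF sub_M] vs.subspace_scale[OF sub_M]
        D_sub_M[OF D_mem(1)] D_sub_M[OF D_mem(3)] M_intro u_gens)
  finally have "k (inverse \<gamma>) * (k \<gamma> * (b' * a * b')) \<in> M" by (rule vs.subspace_scale[OF sub_M])
  thus ?thesis by (simp add: \<gamma>)
qed

lemma P_commute: assumes "x \<in> ua" shows "(b * a' * b) * x - x * (b * a' * b) \<in> D"
proof -
  let ?P = "b * a' * b"
  have P_lin: "?P \<in> lin" by (intro lin_mult) simp_all
  have a: "?P * a - a * ?P \<in> D"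
  proof -
    have "?P * a - a * ?P = k \<alpha> * (a' * b * a) + k \<beta> * (a * b') - (k \<alpha> * (a * b * a') + k \<beta> * (b' * a))"
      by (simp only: a_P P_a) (simp add: algebra_simps)
    thus ?thesis
      by (simp only:) (intro vs.subspace_add[OF sub_D] vs.subspace_diff[OF sub_D] vs.subspace_scale[OF sub_D] D_mem)
  qed
  have "a' * (?P * a - a * ?P) * a' \<in> D" by (intro D_ua a u_gens)
  hence "- (?P * a' - a' * ?P) \<in> D"
    by (simp add: left_diff_distrib right_diff_distrib mult.assoc)
  hence a': "?P * a' - a' * ?P \<in> D" using vs.subspace_neg[OF sub_D] by fastforce
  have "vs.subspace {x. ?P * x - x * ?P \<in> D}"
    unfolding vs.subspace_def
  proof (intro conjI ballI allI)
    show "0 \<in> {x. ?P * x - x * ?P \<in> D}" using vs.subspace_0[OF sub_D] by simp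
  next
    fix x y assume "x \<in> {x. ?P * x - x * ?P \<in> D}" "y \<in> {x. ?P * x - x * ?P \<in> D}"
    moreover have "?P * (x + y) - (x + y) * ?P = (?P * x - x * ?P) + (?P * y - y * ?P)"
      by (simp add: distrib_left distrib_right)
    ultimately show "x + y \<in> {x. ?P * x - x * ?P \<in> D}" using vs.subspace_add[OF sub_D] by simp
  next
    fix c x assume x: "x \<in> {x. ?P * x - x * ?P \<in> D}"
    have "?P * (k c * x) = k c * (?P * x)" using linD[OF P_lin, of c] by (metis mult.assoc)
    hence "?P * (k c * x) - (k c * x) * ?P = k c * (?P * x - x * ?P)"
      by (simp only: right_diff_distrib mult.assoc)
    thus "k c * x \<in> {x. ?P * x - x * ?P \<in> D}" using vs.subspace_scale[OF sub_D] x by simp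
  qed
  moreover have "{1, a, a'} \<subseteq> {x. ?P * x - x * ?P \<in> D}"
    using a a' vs.subspace_0[OF sub_D] by simp
  ultimately show ?thesis using assms vs.span_minimal unfolding ua_def by blast
qed

lemma P_ua: assumes "x \<in> ua" shows "(b * a' * b) * x \<in> M"
proof -
  have "((b * a' * b) * x - x * (b * a' * b)) + x * (b * a' * b) \<in> M"
    by (intro vs.subspace_add[OF sub_M] D_sub_M P_commute M_intro assms)
  thus ?thesis by simp
qed

lemma M_decomp':
  assumes "m \<in> M" obtains d x where "d \<in> D" "x \<in> ua" "m = d + (b * a' * b) * x"
proof -
  from assms obtain d x where *: "d \<in> D" "x \<in> ua" "m = d + x * (b * a' * b)" by (rule M_decomp)
  have "m = (d - ((b * a' * b) * x - x * (b * a' * b))) + (b * a' * b) * x" by (simp add: *)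
  moreover have "d - ((b * a' * b) * x - x * (b * a' * b)) \<in> D"
    by (intro vs.subspace_diff[OF sub_D] P_commute *)
  ultimately show ?thesis using that * by blast
qed

text \<open>The key to the closedness of \<open>M\<close>: of the eight words in question six are sorted by conjugation
  and the other two are the exceptional ones.\<close>

lemma ub_ua_ub: assumes "y \<in> ub" "x \<in> ua" "z \<in> ub" shows "y * x * z \<in> M"
proof -
  have base: "y * x * z \<in> M" if yxz: "y \<in> {1, b, b'}" "x \<in> {1, a, a'}" "z \<in> {1, b, b'}" for x y z
  proof -
    have "y * x * z \<in> D \<or> y * x * z = b * a' * b \<or> y * x * z = b' * a * b'"
    proof (cases "y = 1 \<or> x = 1 \<or> z = 1")
      case True
      have u: "y \<in> ub" "x \<in> ua" "z \<in> ub" using yxz by auto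
      from True consider "y = 1" | "x = 1" | "z = 1" by blast
      thus ?thesis
      proof cases
        case 1 thus ?thesis using D_intro[of x z 1] u by simp
      next
        case 2 thus ?thesis using ub_D[OF ub_mult[of y z]] u by simp
      next
        case 3 thus ?thesis using D_intro[of 1 y x] u by simp
      qed
    next
      case False
      have "b * a * b \<in> D" using D_intro[of a b a] by (simp add: braid)
      moreover have "b' * a' * b' \<in> D" using D_intro[of a' b' a'] by (simp add: braid_inv)
      moreover have "b' * a * b \<in> D" using D_intro[of a b a'] by (simp add: conj1)
      moreover have "b * a * b' \<in> D" using D_intro[of a' b a] by (simp add: conj2)
      moreover have "b' * a' * b \<in> D" using D_intro[of a b' a'] by (simp add: conj3)
      moreover have "b * a' * b' \<in> D" using D_intro[of a' b' a] by (simp add: conj4)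
      ultimately show ?thesis using False yxz by auto
    qed
    thus ?thesis using D_sub_M M_intro[of 1] Q_M by auto
  qed
  have "y * x * z \<in> M" if "y \<in> {1, b, b'}" "x \<in> {1, a, a'}" for x y
    using that u_lin by (intro span_right[OF assms(3)[unfolded ub_def] sub_M]) (auto intro!: base lin_mult)
  hence "y * x * z \<in> M" if "y \<in> {1, b, b'}" for y
    using that u_lin by (intro span_sandwich[OF assms(2)[unfolded ua_def] sub_M]) auto
  hence "y * (x * z) \<in> M"
    by (intro span_left[OF assms(1)[unfolded ub_def] sub_M]) (auto simp: mult.assoc[symmetric])
  thus ?thesis by (simp add: mult.assoc)
qed

lemma ua_M: assumes "x \<in> ua" "m \<in> M" shows "x * m \<in> M"
proof -
  from assms(2) obtain d y where *: "d \<in> D" "y \<in> ua" "m = d + y * (b * a' * b)" by (rule M_decomp)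
  have "x * d + (x * y) * (b * a' * b) \<in> M"
    by (intro vs.subspace_add[OF sub_M] D_sub_M D_ua M_intro ua_mult assms *)
  thus ?thesis by (simp add: * distrib_left mult.assoc)
qed

lemma D_ub: assumes "d \<in> D" "z \<in> ub" shows "d * z \<in> M"
  using assms(1)[unfolded D_def] sub_M
proof (rule span_left)
  fix w assume "w \<in> {x * y * z | x y z. x \<in> ua \<and> y \<in> ub \<and> z \<in> ua}"
  then obtain p q r where w: "w = p * q * r" "p \<in> ua" "q \<in> ub" "r \<in> ua" by blast
  have "p * (q * r * z) \<in> M" using w assms(2) by (intro ua_M ub_ua_ub)
  thus "w * z \<in> M" by (simp add: w mult.assoc)
qed

lemma M_ua: assumes "m \<in> M" "x \<in> ua" shows "m * x \<in> M"
proof -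
  from assms(1) obtain d y where *: "d \<in> D" "y \<in> ua" "m = d + y * (b * a' * b)" by (rule M_decomp)
  have "d * x + y * ((b * a' * b) * x) \<in> M"
    by (intro vs.subspace_add[OF sub_M] D_sub_M D_ua ua_M P_ua assms *)
  thus ?thesis by (simp add: * distrib_right mult.assoc)
qed

lemma M_ub: assumes "m \<in> M" "z \<in> ub" shows "m * z \<in> M"
proof -
  from assms(1) obtain d y where *: "d \<in> D" "y \<in> ua" "m = d + y * (b * a' * b)" by (rule M_decomp)
  have "d * z + y * (b * a' * (b * z)) \<in> M"
    by (intro vs.subspace_add[OF sub_M] D_ub ua_M ub_ua_ub ub_mult u_gens assms *)
  thus ?thesis by (simp add: * distrib_right mult.assoc)
qed

lemma one_M: "1 \<in> M"
  using D_sub_M[OF ua_D] by simp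

lemma M_lin: "m \<in> M \<Longrightarrow> m \<in> lin"
proof -
  have "M \<subseteq> lin" unfolding M_def
    by (rule span_subset_lin) (auto intro!: lin_mult dest: u_lin)
  thus "m \<in> M \<Longrightarrow> m \<in> lin" by blast
qed

lemma M_mult: assumes "m \<in> M" "m' \<in> M" shows "m * m' \<in> M"
  using assms(2)[unfolded M_def] sub_M M_lin[OF assms(1)]
proof (rule span_right)
  fix w assume "w \<in> {x * y * z | x y z. x \<in> ua \<and> y \<in> ub \<and> z \<in> ua} \<union> {x * (b * a' * b) | x. x \<in> ua}"
  thus "m * w \<in> M"
  proof
    assume "w \<in> {x * y * z | x y z. x \<in> ua \<and> y \<in> ub \<and> z \<in> ua}"
    then obtain p q r where w: "w = p * q * r" "p \<in> ua" "q \<in> ub" "r \<in> ua" by blast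
    have "m * p * q * r \<in> M" using w assms by (intro M_ua M_ub)
    thus ?thesis by (simp add: w mult.assoc)
  next
    assume "w \<in> {x * (b * a' * b) | x. x \<in> ua}"
    then obtain x where w: "w = x * (b * a' * b)" "x \<in> ua" by blast
    have "m * x * b * a' * b \<in> M" using w assms by (intro M_ua M_ub u_gens)
    thus ?thesis by (simp add: w mult.assoc)
  qed
qed

lemma M_finite: "\<exists>F. finite F \<and> F \<subseteq> lin \<and> M = vs.span F"
proof (intro exI conjI)
  let ?F = "{1, a, a'} * {1, b, b'} * {1, a, a'} \<union> {1, a, a'} * {b * a' * b}"
  show "finite ?F" by (intro finite_UnI finite_set_times) auto
  have l: "{1, a, a'} \<subseteq> lin" "{1, b, b'} \<subseteq> lin" by auto
  have ll: "{1, a, a'} * {1, b, b'} \<subseteq> lin" using l by (blast elim!: set_times_elim intro: lin_mult)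
  show "?F \<subseteq> lin" using l ll by (blast elim!: set_times_elim intro: lin_mult a_lin b_lin)
  show "M = vs.span ?F"
  proof
    have "x * y * z \<in> vs.span ?F" if "x \<in> ua" "y \<in> ub" "z \<in> ua" for x y z
      using span_times[OF ll span_times[OF l(1) that(1)[unfolded ua_def] that(2)[unfolded ub_def]]
          that(3)[unfolded ua_def]] vs.span_mono[of _ ?F] by blast
    moreover have "x * (b * a' * b) \<in> vs.span ?F" if "x \<in> ua" for x
      using span_times[OF l(1) that[unfolded ua_def] vs.span_base[of _ "{b * a' * b}"]]
        vs.span_mono[of _ ?F] by blast
    ultimately show "M \<subseteq> vs.span ?F"
      unfolding M_def by (intro vs.span_minimal) auto
    have "?F \<subseteq> M"
      using u_gens by (fastforce elim!: set_times_elim intro: D_sub_M[OF D_intro] M_intro)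
    thus "vs.span ?F \<subseteq> M" by (rule vs.span_minimal[OF _ sub_M])
  qed
qed

end

context scalar_ring begin

lemma subspace_commutant: "r \<in> lin \<Longrightarrow> vs.subspace {x. x * r = r * x}"
  unfolding vs.subspace_def by (auto simp: distrib_left distrib_right) (metis linD mult.assoc)

lemma span_commute:
  assumes "x \<in> vs.span X" "r \<in> lin" "\<And>y. y \<in> X \<Longrightarrow> y * r = r * y" shows "x * r = r * x"
  using vs.span_minimal[OF _ subspace_commutant[OF assms(2)], of X] assms by blast

end

section \<open>The cubic quotient of the braid group on four strands\<close>

locale braid4 = ab: braid3 k a b a' b' \<alpha> \<beta> \<gamma> + bc: braid3 k b c b' c' \<alpha> \<beta> \<gamma>
  for k :: "'f::field \<Rightarrow> 'r::{ring,monoid_mult}" and a b c a' b' c' \<alpha> \<beta> \<gamma> +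
  assumes ac: "a * c = c * a"
begin

text \<open>Write \<open>A\<close> for the algebra generated by \<open>a, b\<close>. The elements \<open>s, X, Y\<close> generate the double cosets
  of \<open>A\<close> that two letters \<open>c\<^sup>\<plusminus>\<^sup>1\<close> can produce.\<close>

abbreviation A where "A \<equiv> ab.M"
abbreviation ua where "ua \<equiv> ab.ua"
abbreviation ub where "ub \<equiv> ab.ub"
abbreviation uc where "uc \<equiv> bc.ub"
abbreviation P where "P \<equiv> b * a' * b"
abbreviation Q where "Q \<equiv> b' * a * b'"
abbreviation s where "s \<equiv> c * b' * c"
abbreviation X where "X \<equiv> c * P * c"
abbreviation Y where "Y \<equiv> c' * Q * c'"

lemma bc_ua: "bc.ua = ub"
  by (simp add: ab.ub_def bc.ua_def)

lemma ua_uc_commute: assumes "x \<in> ua" "e \<in> uc" shows "x * e = e * x"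
proof -
  have ac': "a * c' = c' * a"
  proof -
    have "c' * (a * c) * c' = c' * (c * a) * c'" by (simp only: ac)
    thus ?thesis by (simp add: mult.assoc)
  qed
  have conj: "a' * e = e * a'" if "a * e = e * a" for e
  proof -
    have "a' * (a * e) * a' = a' * (e * a) * a'" by (simp only: that)
    thus ?thesis by (simp add: mult.assoc)
  qed
  have "e * y = y * e" if "y \<in> {1, a, a'}" for y
    using that ac ac' conj by (intro ab.span_commute[OF assms(2)[unfolded bc.ub_def]]) auto
  hence "x * e = e * x"
    using bc.u_lin(2)[OF assms(2)] by (intro ab.span_commute[OF assms(1)[unfolded ab.ua_def]]) auto
  thus ?thesis .
qed

lemma in_A: "x \<in> ua \<Longrightarrow> x \<in> A" "y \<in> ub \<Longrightarrow> y \<in> A" "1 \<in> A" "a \<in> A" "a' \<in> A" "b \<in> A" "b' \<in> A"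
  by (simp_all add: ab.one_M ab.D_sub_M ab.ua_D ab.ub_D)

text \<open>Words with at most two letters \<open>c\<^sup>\<plusminus>\<^sup>1\<close>. It will be shown that a third one can be absorbed.\<close>

definition L :: "'r set"
  where "L = ab.vs.span {m1 * e * m2 * f * m3 | m1 m2 m3 e f.
                           m1 \<in> A \<and> m2 \<in> A \<and> m3 \<in> A \<and> e \<in> uc \<and> f \<in> uc}"

lemma sub_L: "ab.vs.subspace L" and sub_A: "ab.vs.subspace A"
  by (simp_all add: L_def ab.M_def)

lemma L_intro: "m1 \<in> A \<Longrightarrow> e \<in> uc \<Longrightarrow> m2 \<in> A \<Longrightarrow> f \<in> uc \<Longrightarrow> m3 \<in> A \<Longrightarrow> m1 * e * m2 * f * m3 \<in> L"
  unfolding L_def by (rule ab.vs.span_base) blast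

lemma L_cases:
  assumes "x \<in> L" "ab.vs.subspace T" "l \<in> ab.lin"
    and "\<And>m1 m2 m3 e f. m1 \<in> A \<Longrightarrow> e \<in> uc \<Longrightarrow> m2 \<in> A \<Longrightarrow> f \<in> uc \<Longrightarrow> m3 \<in> A \<Longrightarrow> l * (m1 * e * m2 * f * m3) * r \<in> T"
  shows "l * x * r \<in> T"
  using assms(1)[unfolded L_def] assms(2,3) by (rule ab.span_sandwich) (use assms(4) in blast)

lemma A_L_A: assumes "x \<in> L" "m \<in> A" "m' \<in> A" shows "m * x * m' \<in> L"
  using assms(1) sub_L ab.M_lin[OF assms(2)]
proof (rule L_cases)
  fix m1 m2 m3 e f assume *: "m1 \<in> A" "e \<in> uc" "m2 \<in> A" "f \<in> uc" "m3 \<in> A"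
  have "(m * m1) * e * m2 * f * (m3 * m') \<in> L" by (intro L_intro ab.M_mult assms *)
  thus "m * (m1 * e * m2 * f * m3) * m' \<in> L" by (simp only: mult.assoc)
qed

lemma A_L: "x \<in> L \<Longrightarrow> m \<in> A \<Longrightarrow> m * x \<in> L" and L_A: "x \<in> L \<Longrightarrow> m \<in> A \<Longrightarrow> x * m \<in> L"
  using A_L_A[of x m 1] A_L_A[of x 1 m] in_A by simp_all

text \<open>This space contains \<open>uc A uc\<close>, and a further letter \<open>c\<^sup>\<plusminus>\<^sup>1\<close> need only be absorbed into its
  few types of generators.\<close>

definition T :: "'r set"
  where "T = ab.vs.span ({m1 * e * m2 | m1 e m2. m1 \<in> A \<and> m2 \<in> A \<and> e \<in> uc}
    \<union> {m1 * s * m2 | m1 m2. m1 \<in> A \<and> m2 \<in> A} \<union> {m * X | m. m \<in> A} \<union> {m * Y | m. m \<in> A})"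

lemma sub_T: "ab.vs.subspace T"
  by (simp add: T_def)

lemma T_intro:
  "m1 \<in> A \<Longrightarrow> e \<in> uc \<Longrightarrow> m2 \<in> A \<Longrightarrow> m1 * e * m2 \<in> T"
  "m1 \<in> A \<Longrightarrow> m2 \<in> A \<Longrightarrow> m1 * s * m2 \<in> T"
  "m1 \<in> A \<Longrightarrow> m1 * X \<in> T"
  "m1 \<in> A \<Longrightarrow> m1 * Y \<in> T"
  unfolding T_def by (blast intro: ab.vs.span_base)+

lemma T_cases:
  assumes "x \<in> T" "ab.vs.subspace S" "l \<in> ab.lin"
    and "\<And>m1 m2 e. m1 \<in> A \<Longrightarrow> e \<in> uc \<Longrightarrow> m2 \<in> A \<Longrightarrow> l * (m1 * e * m2) * r \<in> S"
    and "\<And>m1 m2. m1 \<in> A \<Longrightarrow> m2 \<in> A \<Longrightarrow> l * (m1 * s * m2) * r \<in> S"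
    and "\<And>m1. m1 \<in> A \<Longrightarrow> l * (m1 * X) * r \<in> S"
    and "\<And>m1. m1 \<in> A \<Longrightarrow> l * (m1 * Y) * r \<in> S"
  shows "l * x * r \<in> S"
  using assms(1)[unfolded T_def] assms(2,3) by (rule ab.span_sandwich) (use assms(4-7) in blast)

lemma A_T: assumes "x \<in> T" "m \<in> A" shows "m * x \<in> T"
proof -
  have "m * x * 1 \<in> T"
    using assms(1) sub_T ab.M_lin[OF assms(2)]
  proof (rule T_cases)
    fix m1 m2 e assume *: "m1 \<in> A" "e \<in> uc" "m2 \<in> A"
    show "m * (m1 * e * m2) * 1 \<in> T"
      using T_intro(1)[OF ab.M_mult[OF assms(2) *(1)] *(2,3)] by (simp add: mult.assoc)
  next
    fix m1 m2 assume *: "m1 \<in> A" "m2 \<in> A"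
    show "m * (m1 * s * m2) * 1 \<in> T"
      using T_intro(2)[OF ab.M_mult[OF assms(2) *(1)] *(2)] by (simp add: mult.assoc)
  next
    fix m1 assume *: "m1 \<in> A"
    show "m * (m1 * X) * 1 \<in> T" "m * (m1 * Y) * 1 \<in> T"
      using T_intro(3,4)[OF ab.M_mult[OF assms(2) *]] by (simp_all add: mult.assoc)
  qed
  thus ?thesis by simp
qed


lemma uc_ub_uc: assumes "e \<in> uc" "y \<in> ub" "g \<in> uc" shows "e * y * g \<in> T" "m \<in> A \<Longrightarrow> e * y * g * m \<in> T"
proof -
  have "e * y * g \<in> bc.M" using assms by (intro bc.ub_ua_ub) (simp_all add: bc_ua)
  then obtain d z where *: "d \<in> bc.D" "z \<in> ub" "e * y * g = d + s * z"
    by (rule bc.M_decomp') (simp add: bc_ua)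
  have T: "e * y * g * m \<in> T" if m: "m \<in> A" for m
  proof -
    have "d * m \<in> T"
      using *(1)[unfolded bc.D_def] sub_T
    proof (rule ab.span_left)
      fix w assume "w \<in> {x * y * z | x y z. x \<in> bc.ua \<and> y \<in> uc \<and> z \<in> bc.ua}"
      then obtain p q r where w: "w = p * q * r" "p \<in> ub" "q \<in> uc" "r \<in> ub" unfolding bc_ua by blast
      have "p * q * (r * m) \<in> T" using w by (intro T_intro ab.M_mult in_A m)
      thus "w * m \<in> T" by (simp only: w mult.assoc)
    qed
    moreover have "1 * s * (z * m) \<in> T" using * by (intro T_intro ab.M_mult in_A m)
    ultimately have "d * m + 1 * s * (z * m) \<in> T" by (rule ab.vs.subspace_add[OF sub_T])
    also have "d * m + 1 * s * (z * m) = e * y * g * m"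
      unfolding *(3) by (simp only: distrib_right mult.assoc mult_1_left)
    finally show ?thesis .
  qed
  show "m \<in> A \<Longrightarrow> e * y * g * m \<in> T" by (rule T)
  show "e * y * g \<in> T" using T[OF in_A(3)] by simp
qed

lemma uc_D_uc: assumes "e \<in> uc" "d \<in> ab.D" "g \<in> uc" shows "e * d * g \<in> T"
  using assms(2)[unfolded ab.D_def] sub_T bc.u_lin(2)[OF assms(1)]
proof (rule ab.span_sandwich)
  fix w assume "w \<in> {x * y * z | x y z. x \<in> ua \<and> y \<in> ub \<and> z \<in> ua}"
  then obtain p q r where w: "w = p * q * r" "p \<in> ua" "q \<in> ub" "r \<in> ua" by blast
  have "p * (e * q * g * r) \<in> T" using w assms by (intro A_T uc_ub_uc in_A)
  also have "p * (e * q * g * r) = (p * e) * q * (g * r)" by (simp only: mult.assoc)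
  also have "\<dots> = (e * p) * q * (r * g)"
    using ua_uc_commute[OF w(2) assms(1)] ua_uc_commute[OF w(4) assms(3)] by simp
  finally show "e * w * g \<in> T" by (simp only: w mult.assoc)
qed

lemma c_commute: "a * c = c * a" "a' * c = c * a'" "a * c' = c' * a" "a' * c' = c' * a'"
  using ua_uc_commute[of a c] ua_uc_commute[of a' c] ua_uc_commute[of a c'] ua_uc_commute[of a' c'] by simp_all

lemma c_assoc: "a * (c * x) = c * (a * x)" "a' * (c * x) = c * (a' * x)"
    "a * (c' * x) = c' * (a * x)" "a' * (c' * x) = c' * (a' * x)"
  by (simp_all flip: mult.assoc add: c_commute)

text \<open>For opposite exponents the conjugation by \<open>c\<close> is carried out on both letters \<open>b\<close> of \<open>P\<close>.\<close>

lemma c_P_c': "c * P * c' = (b' * a') * s * (a * b)"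
proof -
  have "c * P * c' = (c * b * c') * a' * (c * b * c')" by (simp add: mult.assoc c_assoc)
  also have "\<dots> = (b' * c * b) * a' * (b' * c * b)" by (simp only: bc.conj2)
  also have "\<dots> = b' * c * (b * a' * b') * c * b" by (simp only: mult.assoc)
  also have "\<dots> = b' * c * (a' * b' * a) * c * b" by (simp only: ab.conj4)
  also have "\<dots> = (b' * a') * s * (a * b)" by (simp add: mult.assoc c_assoc)
  finally show ?thesis .
qed


lemma c'_P_c: "c' * P * c = (b * a) * s * (a' * b')"
proof -
  have "c' * P * c = (c' * b * c) * a' * (c' * b * c)" by (simp add: mult.assoc c_assoc)
  also have "\<dots> = (b * c * b') * a' * (b * c * b')" by (simp only: bc.conj1)
  also have "\<dots> = b * c * (b' * a' * b) * c * b'" by (simp only: mult.assoc)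
  also have "\<dots> = b * c * (a * b' * a') * c * b'" by (simp only: ab.conj3)
  also have "\<dots> = (b * a) * s * (a' * b')" by (simp add: mult.assoc c_assoc)
  finally show ?thesis .
qed

lemma c'_P_c': "c' * P * c' \<in> T"
proof -
  obtain x where x: "x \<in> ua" "P - x * Q \<in> ab.D" using ab.P_Q by blast
  have "c' * (P - x * Q) * c' + x * Y \<in> T"
    using x by (intro ab.vs.subspace_add[OF sub_T] uc_D_uc T_intro in_A bc.u_gens)
  also have "c' * (P - x * Q) * c' + x * Y = c' * P * c' + (x * c' - c' * x) * Q * c'"
    by (simp add: left_diff_distrib right_diff_distrib mult.assoc)
  also have "x * c' - c' * x = 0" using ua_uc_commute[OF x(1), of c'] by simp
  finally show ?thesis by simp
qed

lemma uc_A_uc: assumes "e \<in> uc" "m \<in> A" "g \<in> uc" shows "e * m * g \<in> T"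
proof -
  have P: "e * P * g \<in> T"
  proof -
    have base: "e * P * g \<in> T" if "e \<in> {1, c, c'}" "g \<in> {1, c, c'}" for e g
    proof -
      have PA: "P \<in> A" by (intro ab.M_mult in_A)
      have 1: "1 * P * g \<in> T" if "g \<in> uc" for g
        using T_intro(1)[OF PA that in_A(3)] by simp
      have 2: "e * P * 1 \<in> T" if "e \<in> uc" for e
        using T_intro(1)[OF in_A(3) that PA] by simp
      have 3: "c * P * c \<in> T" using T_intro(3)[OF in_A(3)] by simp
      have 4: "c * P * c' \<in> T" "c' * P * c \<in> T"
        unfolding c_P_c' c'_P_c by (intro T_intro ab.M_mult in_A)+
      have 5: "P \<in> T" using 1[of 1] by simp
      from that 1 2 3 4 5 c'_P_c' show ?thesis by auto
    qed
    have "e * P * g \<in> T" if "e \<in> {1, c, c'}" for e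
      using that bc.u_lin(2) by (intro ab.span_right[OF assms(3)[unfolded bc.ub_def] sub_T] base)
        (auto intro!: ab.lin_mult)
    hence "e * (P * g) \<in> T"
      by (intro ab.span_left[OF assms(1)[unfolded bc.ub_def] sub_T]) (simp add: mult.assoc)
    thus ?thesis by (simp add: mult.assoc)
  qed
  obtain d x where m: "d \<in> ab.D" "x \<in> ua" "m = d + x * P" using assms(2) by (rule ab.M_decomp)
  have "e * d * g + x * (e * P * g) \<in> T"
    by (intro ab.vs.subspace_add[OF sub_T] uc_D_uc[OF assms(1) m(1) assms(3)] A_T[OF P] in_A(1) m)
  also have "e * d * g + x * (e * P * g) = e * d * g + (x * e) * P * g" by (simp only: mult.assoc)
  also have "\<dots> = e * m * g"
    by (simp only: ua_uc_commute[OF m(2) assms(1)] m(3)) (simp add: distrib_left distrib_right mult.assoc)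
  finally show ?thesis .
qed

text \<open>The braid relation lets \<open>b\<close> travel through \<open>c b a' b c\<close>, and \<open>b'\<close> through \<open>c' b' a b' c'\<close>.\<close>

lemma X_ub: assumes "y \<in> ub" shows "X * y = y * X" "Y * y = y * Y"
proof -
  have conj: "b' * z = z * b'" if "z * b = b * z" for z
  proof -
    have "b' * (z * b) * b' = b' * (b * z) * b'" by (simp only: that)
    thus ?thesis by (simp add: mult.assoc)
  qed
  have conj': "b * z = z * b" if "z * b' = b' * z" for z
  proof -
    have "b * (z * b') * b = b * (b' * z) * b" by (simp only: that)
    thus ?thesis by (simp add: mult.assoc)
  qed
  have Xb: "X * b = b * X"
  proof -
    have "X * b = c * b * a' * (b * c * b)" by (simp only: mult.assoc)
    also have "\<dots> = c * b * a' * (c * b * c)" by (simp only: bc.braid)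
    also have "\<dots> = (c * b * c) * a' * b * c" by (simp add: mult.assoc c_assoc)
    also have "\<dots> = (b * c * b) * a' * b * c" by (simp only: bc.braid)
    finally show ?thesis by (simp only: mult.assoc)
  qed
  have Yb: "Y * b' = b' * Y"
  proof -
    have "Y * b' = c' * b' * a * (b' * c' * b')" by (simp only: mult.assoc)
    also have "\<dots> = c' * b' * a * (c' * b' * c')" by (simp only: bc.braid_inv)
    also have "\<dots> = (c' * b' * c') * a * b' * c'" by (simp add: mult.assoc c_assoc)
    also have "\<dots> = (b' * c' * b') * a * b' * c'" by (simp only: bc.braid_inv)
    finally show ?thesis by (simp only: mult.assoc)
  qed
  have "X \<in> ab.lin" "Y \<in> ab.lin" by (intro ab.lin_mult; simp)+
  thus "X * y = y * X" "Y * y = y * Y"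
    using Xb Yb conj[OF Xb] conj'[OF Yb]
    by (intro ab.span_commute[OF assms[unfolded ab.ub_def], symmetric]; auto)+
qed

lemma T_ub: assumes "x \<in> T" "y \<in> ub" shows "x * y \<in> T"
proof -
  have y: "y \<in> A" using assms in_A by blast
  have "1 * x * y \<in> T"
    using assms(1) sub_T ab.lin_one
  proof (rule T_cases)
    fix m1 m2 e assume *: "m1 \<in> A" "e \<in> uc" "m2 \<in> A"
    show "1 * (m1 * e * m2) * y \<in> T"
      using T_intro(1)[OF *(1,2) ab.M_mult[OF *(3) y]] by (simp add: mult.assoc)
  next
    fix m1 m2 assume *: "m1 \<in> A" "m2 \<in> A"
    show "1 * (m1 * s * m2) * y \<in> T"
      using T_intro(2)[OF *(1) ab.M_mult[OF *(2) y]] by (simp add: mult.assoc)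
  next
    fix m1 assume *: "m1 \<in> A"
    have "1 * (m1 * X) * y = m1 * y * X" "1 * (m1 * Y) * y = m1 * y * Y"
      using X_ub[OF assms(2)] by (simp_all only: mult.assoc mult_1_left)
    thus "1 * (m1 * X) * y \<in> T" "1 * (m1 * Y) * y \<in> T"
      using T_intro(3,4)[OF ab.M_mult[OF * y]] by simp_all
  qed
  thus ?thesis by simp
qed

text \<open>Here \<open>y\<close> commutes with the outer letters of \<open>X = c P c\<close> and is absorbed by \<open>P\<close>, which lies in the
  algebra \<open>A\<close>; the result is again in \<open>uc A uc\<close>.\<close>

lemma T_ua: assumes "x \<in> T" "y \<in> ua" shows "x * y \<in> T"
proof -
  have y: "y \<in> A" using assms in_A by blast
  have "1 * x * y \<in> T"
    using assms(1) sub_T ab.lin_one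
  proof (rule T_cases)
    fix m1 m2 e assume *: "m1 \<in> A" "e \<in> uc" "m2 \<in> A"
    show "1 * (m1 * e * m2) * y \<in> T"
      using T_intro(1)[OF *(1,2) ab.M_mult[OF *(3) y]] by (simp add: mult.assoc)
  next
    fix m1 m2 assume *: "m1 \<in> A" "m2 \<in> A"
    show "1 * (m1 * s * m2) * y \<in> T"
      using T_intro(2)[OF *(1) ab.M_mult[OF *(2) y]] by (simp add: mult.assoc)
  next
    fix m1 assume *: "m1 \<in> A"
    have "1 * (m1 * (e * m * e)) * y = m1 * (e * (m * y) * e)" if "e \<in> uc" for e m
      using ua_uc_commute[OF assms(2) that] by (simp add: mult.assoc)
    moreover have "P * y \<in> A" "Q * y \<in> A" by (intro ab.M_mult in_A y)+
    ultimately show "1 * (m1 * X) * y \<in> T" "1 * (m1 * Y) * y \<in> T"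
      using A_T[OF uc_A_uc *] bc.u_gens by simp_all
  qed
  thus ?thesis by simp
qed

lemma T_A: assumes "x \<in> T" "m \<in> A" shows "x * m \<in> T"
proof -
  have "x \<in> ab.lin"
  proof -
    have "T \<subseteq> ab.lin" unfolding T_def
      by (rule ab.span_subset_lin) (auto intro!: ab.lin_mult dest: ab.M_lin bc.u_lin)
    thus ?thesis using assms by blast
  qed
  with assms(2)[unfolded ab.M_def] sub_T show ?thesis
  proof (rule ab.span_right)
    fix w assume "w \<in> {x * y * z | x y z. x \<in> ua \<and> y \<in> ub \<and> z \<in> ua} \<union> {x * P | x. x \<in> ua}"
    thus "x * w \<in> T"
    proof
      assume "w \<in> {x * y * z | x y z. x \<in> ua \<and> y \<in> ub \<and> z \<in> ua}"
      then obtain p q r where w: "w = p * q * r" "p \<in> ua" "q \<in> ub" "r \<in> ua" by blast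
      have "x * p * q * r \<in> T" using w assms by (intro T_ua T_ub)
      thus ?thesis by (simp add: w mult.assoc)
    next
      assume "w \<in> {x * P | x. x \<in> ua}"
      then obtain p where w: "w = p * P" "p \<in> ua" by blast
      have "x * p * b * a' * b \<in> T" using w assms by (intro T_ua T_ub ab.u_gens)
      thus ?thesis by (simp add: w mult.assoc)
    qed
  qed
qed

text \<open>The critical reduction from three letters \<open>c\<^sup>\<plusminus>\<^sup>1\<close> to two. Since \<open>x\<close> commutes with \<open>c\<close>, the word
  begins with \<open>e y c\<close>, and all choices of \<open>e, y\<close> but one are shortened by a conjugation rule. In the
  remaining word \<open>c b' c x b' c\<close> the first three letters are exchanged for \<open>c' b c'\<close>, which turns the
  last three into \<open>c' b' c = b c' b'\<close>.\<close>

lemma uc_ub_ua_s: assumes "e \<in> uc" "y \<in> ub" "x \<in> ua" shows "e * y * x * s \<in> L"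
proof -
  have xA: "x \<in> A" by (intro in_A assms)
  have s: "s * x * b' * c \<in> L"
  proof -
    obtain y where y: "y \<in> ub" "s - y * (c' * b * c') \<in> bc.D" using bc.P_Q by (auto simp: bc_ua)
    have "(s - y * (c' * b * c')) * (x * b' * c) \<in> L"
      using y(2)[unfolded bc.D_def] sub_L
    proof (rule ab.span_left)
      fix w assume "w \<in> {x * y * z | x y z. x \<in> bc.ua \<and> y \<in> uc \<and> z \<in> bc.ua}"
      then obtain p q r where w: "w = p * q * r" "p \<in> ub" "q \<in> uc" "r \<in> ub" unfolding bc_ua by blast
      have "p * q * (r * x * b') * c * 1 \<in> L"
        using w xA by (intro L_intro ab.M_mult) (simp_all add: in_A)
      thus "w * (x * b' * c) \<in> L" by (simp add: w mult.assoc)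
    qed
    moreover have "y * (c' * b * c') * (x * b' * c) \<in> L"
    proof -
      have "y * (c' * b * c') * (x * b' * c) = y * c' * b * (c' * x) * b' * c" by (simp only: mult.assoc)
      also have "\<dots> = y * c' * b * (x * c') * b' * c" using ua_uc_commute[OF assms(3), of c'] by simp
      also have "\<dots> = y * c' * b * x * (c' * b' * c)" by (simp only: mult.assoc)
      also have "\<dots> = y * c' * b * x * (b * c' * b')" by (simp only: bc.conj3)
      also have "\<dots> = y * c' * (b * x * b) * c' * b'" by (simp only: mult.assoc)
      also have "\<dots> \<in> L" using y xA by (intro L_intro ab.M_mult) (simp_all add: in_A)
      finally show ?thesis .
    qed
    ultimately have "(s - y * (c' * b * c')) * (x * b' * c) + y * (c' * b * c') * (x * b' * c) \<in> L"
      by (rule ab.vs.subspace_add[OF sub_L])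
    thus ?thesis by (simp only: left_diff_distrib diff_add_cancel mult.assoc)
  qed
  have xc: "x * c = c * x" by (rule ua_uc_commute[OF assms(3)]) simp
  have base: "e * y * x * s \<in> L" if ey: "e \<in> {1, c, c'}" "y \<in> {1, b, b'}" for e y
  proof -
    have 1: "1 * y * x * s \<in> L" if "y \<in> ub" for y
    proof -
      have "(y * x) * c * b' * c * 1 \<in> L" using that xA by (intro L_intro ab.M_mult) (simp_all add: in_A)
      thus ?thesis by (simp add: mult.assoc)
    qed
    have 2: "e * 1 * x * s \<in> L" if "e \<in> uc" for e
    proof -
      have "x * (e * c) * b' * c * 1 \<in> L" using that xA by (intro L_intro bc.ub_mult) (simp_all add: in_A)
      also have "x * (e * c) * b' * c * 1 = (x * e) * c * b' * c" by (simp add: mult.assoc)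
      also have "\<dots> = e * 1 * x * s"
        by (simp only: ua_uc_commute[OF assms(3) that]) (simp add: mult.assoc)
      finally show ?thesis .
    qed
    have move: "e * y * x * s = (e * y * c) * x * b' * c" for e y
    proof -
      have "e * y * x * s = e * y * (x * c) * b' * c" by (simp only: mult.assoc)
      thus ?thesis by (simp only: xc mult.assoc)
    qed
    have bxb: "y1 * f1 * (y2 * x * b') * c * 1 \<in> L" if "y1 \<in> ub" "y2 \<in> ub" "f1 \<in> uc" for y1 y2 f1
      using that xA by (intro L_intro ab.M_mult) (simp_all add: in_A)
    have 3: "c * b * x * s \<in> L"
      using bxb[of b b c] by (simp only: move bc.braid[symmetric]) (simp add: mult.assoc)
    have 4: "c' * b * x * s \<in> L"
      using bxb[of b b' c] by (simp only: move bc.conj1[symmetric]) (simp add: mult.assoc)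
    have 5: "c' * b' * x * s \<in> L"
      using bxb[of b b' c'] by (simp only: move bc.conj3[symmetric]) (simp add: mult.assoc)
    have 6: "c * b' * x * s \<in> L"
      using s by (simp only: move)
    have 7: "x * s \<in> L" using 1[of 1] by simp
    show ?thesis using ey 1 2 3 4 5 6 7 by auto
  qed
  have x_s: "x * s \<in> ab.lin" using ab.u_lin(1)[OF assms(3)] by (intro ab.lin_mult; simp)
  have "e * y * x * s \<in> L" if "e \<in> {1, c, c'}" for e
  proof -
    have "e * y * (x * s) \<in> L"
      using assms(2)[unfolded ab.ub_def] sub_L
      by (rule ab.span_sandwich) (use that base in \<open>auto simp: mult.assoc\<close>)
    thus ?thesis by (simp only: mult.assoc)
  qed
  hence "e * (y * x * s) \<in> L"
    by (intro ab.span_left[OF assms(1)[unfolded bc.ub_def] sub_L]) (simp only: mult.assoc)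
  thus ?thesis by (simp only: mult.assoc)
qed

text \<open>The last three factors are sorted in the algebra generated by \<open>b, c\<close>; only the exceptional word
  \<open>s\<close> survives, for which the previous lemma applies.\<close>

lemma uc_ub_ua_uc_ub_uc:
  assumes "e \<in> uc" "y \<in> ub" "x \<in> ua" "f \<in> uc" "z \<in> ub" "g \<in> uc"
  shows "e * y * x * f * z * g \<in> L"
proof -
  have "f * z * g \<in> bc.M" using assms by (intro bc.ub_ua_ub) (simp_all add: bc_ua)
  then obtain d y' where *: "d \<in> bc.D" "y' \<in> ub" "f * z * g = d + s * y'"
    by (rule bc.M_decomp') (simp add: bc_ua)
  have l: "e * y * x \<in> ab.lin" using assms ab.u_lin bc.u_lin by (intro ab.lin_mult) auto
  have "e * y * x * d \<in> L"
    using *(1)[unfolded bc.D_def] sub_L l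
  proof (rule ab.span_right)
    fix w assume "w \<in> {x * y * z | x y z. x \<in> bc.ua \<and> y \<in> uc \<and> z \<in> bc.ua}"
    then obtain p q r where w: "w = p * q * r" "p \<in> ub" "q \<in> uc" "r \<in> ub" unfolding bc_ua by blast
    have "1 * e * (y * x * p) * q * r \<in> L"
      using w assms by (intro L_intro ab.M_mult) (simp_all add: in_A)
    thus "e * y * x * w \<in> L" by (simp add: w mult.assoc)
  qed
  moreover have "e * y * x * s * y' \<in> L" using assms * by (intro L_A uc_ub_ua_s in_A)
  ultimately have "e * y * x * d + e * y * x * s * y' \<in> L" by (rule ab.vs.subspace_add[OF sub_L])
  also have "e * y * x * d + e * y * x * s * y' = e * y * x * (f * z * g)"
    unfolding *(3) by (simp only: distrib_left mult.assoc)
  finally show ?thesis by (simp only: mult.assoc)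
qed

lemma s_A_uc: assumes "m \<in> A" "g \<in> uc" shows "s * m * g \<in> L"
proof -
  have s_lin: "s \<in> ab.lin" by (intro ab.lin_mult; simp)
  have PA: "P \<in> A" by (intro ab.M_mult in_A)
  obtain d x where m: "d \<in> ab.D" "x \<in> ua" "m = d + P * x" using assms(1) by (rule ab.M_decomp')
  have "s * d * g \<in> L"
    using m(1)[unfolded ab.D_def] sub_L s_lin
  proof (rule ab.span_sandwich)
    fix w assume "w \<in> {x * y * z | x y z. x \<in> ua \<and> y \<in> ub \<and> z \<in> ua}"
    then obtain p q r where w: "w = p * q * r" "p \<in> ua" "q \<in> ub" "r \<in> ua" by blast
    have "c * b' * p * c * q * g * r \<in> L"
      using w assms by (intro L_A uc_ub_ua_uc_ub_uc in_A) simp_all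
    also have "c * b' * p * c * q * g * r = c * b' * (p * c) * q * (g * r)" by (simp only: mult.assoc)
    also have "\<dots> = c * b' * (c * p) * q * (r * g)"
      using ua_uc_commute[OF w(4) assms(2)] ua_uc_commute[OF w(2), of c] by simp
    finally show "s * w * g \<in> L" by (simp only: w mult.assoc)
  qed
  moreover have "s * P * x * g \<in> L"
  proof -
    have base: "s * P * g \<in> L" if "g \<in> {1, c, c'}" for g
    proof -
      have 1: "s * P * 1 \<in> L" using L_intro[of 1 c b' c P] in_A PA by simp
      have 2: "s * P * c \<in> L"
      proof -
        have "s * P * c = c * (b' * c * b) * a' * b * c" by (simp only: mult.assoc)
        also have "\<dots> = c * (c * b * c') * a' * b * c" by (simp only: bc.conj2)
        also have "\<dots> = c * c * b * a' * (c' * b * c)" by (simp add: mult.assoc c_assoc)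
        also have "\<dots> = c * c * b * a' * (b * c * b')" by (simp only: bc.conj1)
        also have "\<dots> = 1 * (c * c) * P * c * b'" by (simp add: mult.assoc)
        also have "\<dots> \<in> L" using PA by (intro L_intro bc.ub_mult) (simp_all add: in_A)
        finally show ?thesis .
      qed
      have 3: "s * P * c' \<in> L"
      proof -
        have "s * P * c' = c * b' * (c * P * c')" by (simp only: mult.assoc)
        also have "\<dots> = c * (b' * b') * a' * s * (a * b)" unfolding c_P_c' by (simp only: mult.assoc)
        also have "\<dots> \<in> L" by (intro L_A uc_ub_ua_s ab.ub_mult ab.M_mult) (simp_all add: in_A)
        finally show ?thesis .
      qed
      from that 1 2 3 show ?thesis by auto
    qed
    have "s * P \<in> ab.lin" by (intro ab.lin_mult; simp)
    hence "s * P * g \<in> L"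
      by (intro ab.span_right[OF assms(2)[unfolded bc.ub_def] sub_L] base)
    hence "s * P * g * x \<in> L" by (rule L_A) (intro in_A m)
    also have "s * P * g * x = s * P * (g * x)" by (simp only: mult.assoc)
    also have "\<dots> = s * P * (x * g)" using ua_uc_commute[OF m(2) assms(2)] by simp
    finally show ?thesis by (simp only: mult.assoc)
  qed
  ultimately have "s * d * g + s * P * x * g \<in> L" by (rule ab.vs.subspace_add[OF sub_L])
  thus ?thesis by (simp only: m distrib_left distrib_right mult.assoc)
qed

lemma T_uc: assumes "x \<in> T" "g \<in> uc" shows "x * g \<in> L"
proof -
  have PA: "P \<in> A" "Q \<in> A" by (intro ab.M_mult in_A)+
  have "1 * x * g \<in> L"
    using assms(1) sub_L ab.lin_one
  proof (rule T_cases)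
    fix m1 m2 e assume *: "m1 \<in> A" "e \<in> uc" "m2 \<in> A"
    show "1 * (m1 * e * m2) * g \<in> L"
      using L_intro[OF * assms(2) in_A(3)] by (simp add: mult.assoc)
  next
    fix m1 m2 assume *: "m1 \<in> A" "m2 \<in> A"
    show "1 * (m1 * s * m2) * g \<in> L"
      using A_L[OF s_A_uc[OF *(2) assms(2)] *(1)] by (simp add: mult.assoc)
  next
    fix m1 assume *: "m1 \<in> A"
    have "m1 * e * m * (e * g) * 1 \<in> L" if "e \<in> uc" "m \<in> A" for e m
      by (intro L_intro bc.ub_mult that * assms in_A)
    from this[of c P] this[of c' Q] PA
    show "1 * (m1 * X) * g \<in> L" "1 * (m1 * Y) * g \<in> L"
      by (simp_all add: mult.assoc)
  qed
  thus ?thesis by simp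
qed

lemma L_uc: assumes "x \<in> L" "g \<in> uc" shows "x * g \<in> L"
proof -
  have "1 * x * g \<in> L"
    using assms(1) sub_L ab.lin_one
  proof (rule L_cases)
    fix m1 m2 m3 e f assume *: "m1 \<in> A" "e \<in> uc" "m2 \<in> A" "f \<in> uc" "m3 \<in> A"
    have "m1 * (e * m2 * f * m3 * g) \<in> L"
      by (intro A_L T_uc T_A uc_A_uc assms *)
    thus "1 * (m1 * e * m2 * f * m3) * g \<in> L" by (simp add: mult.assoc)
  qed
  thus ?thesis by simp
qed

text \<open>All words in \<open>a, b, c\<close> lie in \<open>L\<close>, because \<open>L\<close> contains \<open>1\<close> and admits right multiplication by them.\<close>

theorem finite_span:
  "\<exists>F H. finite F \<and> ab.vs.subspace H \<and> H \<subseteq> ab.vs.span F \<and> H \<subseteq> ab.lin \<and> 1 \<in> H \<and> (\<forall>x\<in>H. \<forall>g\<in>{a, b, c}. x * g \<in> H)"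
proof -
  obtain F where F: "finite F" "F \<subseteq> ab.lin" "A = ab.vs.span F" using ab.M_finite by blast
  have L_lin: "L \<subseteq> ab.lin" unfolding L_def
    by (rule ab.span_subset_lin) (auto intro!: ab.lin_mult dest: ab.M_lin bc.u_lin)
  let ?U = "{1, c, c'}"
  have U: "?U \<subseteq> ab.lin" by auto
  have l: "S * S' \<subseteq> ab.lin" if "S \<subseteq> ab.lin" "S' \<subseteq> ab.lin" for S S'
    using that by (blast elim!: set_times_elim intro: ab.lin_mult)
  have "L \<subseteq> ab.vs.span (F * ?U * F * ?U * F)"
    unfolding L_def
  proof (rule ab.vs.span_minimal, safe)
    fix m1 m2 m3 e f assume "m1 \<in> A" "m2 \<in> A" "m3 \<in> A" "e \<in> uc" "f \<in> uc"
    thus "m1 * e * m2 * f * m3 \<in> ab.vs.span (F * ?U * F * ?U * F)"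
      unfolding F(3) bc.ub_def by (intro ab.span_times l U F)
  qed
  moreover have "finite (F * ?U * F * ?U * F)"
    by (intro finite_set_times F) auto
  moreover have "1 \<in> L" using L_intro[of 1 1 1 1 1] by (simp add: in_A)
  moreover have "x * g \<in> L" if "x \<in> L" "g \<in> {a, b, c}" for x g
    using that L_A[of x] L_uc[of x c] in_A by auto
  ultimately show ?thesis using sub_L L_lin by blast
qed

end

section \<open>Matrices of linear maps in a basis\<close>

text \<open>The matrix, in a basis listed by \<open>bs\<close>, of a linear map that preserves the span.\<close>

definition (in vector_space) basis_mat :: "'b list \<Rightarrow> ('b \<Rightarrow> 'b) \<Rightarrow> 'a mat"
  where "basis_mat bs f = mat (length bs) (length bs) (\<lambda>(i, j). representation (set bs) (f (bs ! j)) (bs ! i))"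

context vector_space begin

context
  fixes bs assumes bs: "distinct bs" "independent (set bs)"
begin

lemma span_list: assumes "v \<in> span (set bs)"
  shows "(\<Sum>i<length bs. representation (set bs) v (bs ! i) *s (bs ! i)) = v"
proof -
  have "(\<Sum>b\<in>set bs. representation (set bs) v b *s b) = v"
    using assms bs by (intro sum_representation_eq) auto
  also have "(\<Sum>b\<in>set bs. representation (set bs) v b *s b)
      = (\<Sum>i<length bs. representation (set bs) v (bs ! i) *s (bs ! i))"
    using bs(1) by (intro sum.reindex_bij_betw[symmetric] bij_betw_nth) auto
  finally show ?thesis .
qed

lemma representation_list_sum:
  assumes "i < length bs"
  shows "representation (set bs) (\<Sum>j<length bs. c j *s (bs ! j)) (bs ! i) = c i"
proof -
  have "representation (set bs) (\<Sum>j<length bs. c j *s (bs ! j)) (bs ! i)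
      = (\<Sum>j<length bs. c j * representation (set bs) (bs ! j) (bs ! i))"
    using bs(2) by (subst representation_sum)
      (auto simp: representation_scale span_base span_scale)
  also have "\<dots> = (\<Sum>j<length bs. if j = i then c j else 0)"
    using bs assms by (intro sum.cong) (auto simp: representation_basis nth_eq_iff_index_eq)
  finally show ?thesis using assms by simp
qed

context
  fixes f assumes f: "Vector_Spaces.linear (*s) (*s) f" "\<And>v. v \<in> span (set bs) \<Longrightarrow> f v \<in> span (set bs)"
begin

lemma basis_mat_apply:
  assumes "v \<in> span (set bs)" "i < length bs"
  shows "representation (set bs) (f v) (bs ! i)
    = (\<Sum>j<length bs. basis_mat bs f $$ (i, j) * representation (set bs) v (bs ! j))"
proof -
  interpret f: Vector_Spaces.linear "(*s)" "(*s)" f by (rule f(1))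
  let ?r = "representation (set bs)"
  have fb: "f (bs ! j) \<in> span (set bs)" if "j < length bs" for j
    using f(2) that by (simp add: span_base)
  have "f v = f (\<Sum>j<length bs. ?r v (bs ! j) *s (bs ! j))" using span_list[OF assms(1)] by simp
  also have "\<dots> = (\<Sum>j<length bs. ?r v (bs ! j) *s f (bs ! j))" by (simp add: f.sum f.scale)
  also have "?r \<dots> (bs ! i) = (\<Sum>j<length bs. ?r v (bs ! j) * ?r (f (bs ! j)) (bs ! i))"
    using bs(2) fb by (subst representation_sum) (auto simp: representation_scale span_scale)
  finally show ?thesis using assms(2) by (simp add: basis_mat_def mult.commute)
qed

lemma basis_mat_eigenvalue:
  "eigenvalue (basis_mat bs f) \<mu> \<longleftrightarrow> (\<exists>v\<in>span (set bs). v \<noteq> 0 \<and> f v = \<mu> *s v)"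
proof
  let ?n = "length bs"
  let ?r = "representation (set bs)"
  have car: "basis_mat bs f \<in> carrier_mat ?n ?n" by (simp add: basis_mat_def)
  show "\<exists>v\<in>span (set bs). v \<noteq> 0 \<and> f v = \<mu> *s v" if "eigenvalue (basis_mat bs f) \<mu>"
  proof -
    from that obtain x where x: "x \<in> carrier_vec ?n" "x \<noteq> 0\<^sub>v ?n" "basis_mat bs f *\<^sub>v x = \<mu> \<cdot>\<^sub>v x"
      using car by (auto simp: eigenvalue_def eigenvector_def)
    define v where "v = (\<Sum>j<?n. x $ j *s (bs ! j))"
    have v: "v \<in> span (set bs)" unfolding v_def by (intro span_sum span_scale span_base) auto
    have r: "?r v (bs ! i) = x $ i" if "i < ?n" for i
      unfolding v_def using representation_list_sum[OF that] .
    have "?r (f v) (bs ! i) = \<mu> * x $ i" if "i < ?n" for i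
    proof -
      have "?r (f v) (bs ! i) = (basis_mat bs f *\<^sub>v x) $ i"
        using car x(1) that r by (simp add: basis_mat_apply[OF v] scalar_prod_def lessThan_atLeast0)
      thus ?thesis using x that by simp
    qed
    hence "f v = (\<Sum>j<?n. (\<mu> * x $ j) *s (bs ! j))" using span_list[OF f(2)[OF v]] by simp
    also have "\<dots> = \<mu> *s v" by (simp add: v_def scale_sum_right)
    finally have "f v = \<mu> *s v" .
    moreover have "v \<noteq> 0"
    proof
      assume "v = 0"
      hence "x $ i = 0" if "i < ?n" for i using r[OF that] by (simp add: representation_zero)
      hence "x = 0\<^sub>v ?n" using x(1) by (intro eq_vecI) auto
      thus False using x(2) by simp
    qed
    ultimately show ?thesis using v by blast
  qed
  show "eigenvalue (basis_mat bs f) \<mu>" if "\<exists>v\<in>span (set bs). v \<noteq> 0 \<and> f v = \<mu> *s v"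
  proof -
    from that obtain v where v: "v \<in> span (set bs)" "v \<noteq> 0" "f v = \<mu> *s v" by blast
    define x where "x = vec ?n (\<lambda>i. ?r v (bs ! i))"
    have "basis_mat bs f *\<^sub>v x = \<mu> \<cdot>\<^sub>v x"
    proof (rule eq_vecI)
      fix i assume "i < dim_vec (\<mu> \<cdot>\<^sub>v x)"
      hence i: "i < ?n" by (simp add: x_def)
      have "(basis_mat bs f *\<^sub>v x) $ i = ?r (f v) (bs ! i)"
        using car i by (simp add: basis_mat_apply[OF v(1)] scalar_prod_def lessThan_atLeast0 x_def)
      thus "(basis_mat bs f *\<^sub>v x) $ i = (\<mu> \<cdot>\<^sub>v x) $ i"
        using v bs i by (simp add: x_def representation_scale)
    qed (use car in \<open>simp add: x_def\<close>)
    moreover have "x \<noteq> 0\<^sub>v ?n"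
    proof
      assume x0: "x = 0\<^sub>v ?n"
      have "?r v (bs ! i) = 0" if "i < ?n" for i
        using arg_cong[OF x0, of "\<lambda>y. y $ i"] that by (simp add: x_def)
      hence "v = 0" using span_list[OF v(1)] by simp
      thus False using v(2) by simp
    qed
    moreover have "x \<in> carrier_vec ?n" by (simp add: x_def)
    ultimately show ?thesis using car unfolding eigenvalue_def eigenvector_def by auto
  qed
qed

end

lemma basis_mat_comp:
  assumes "Vector_Spaces.linear (*s) (*s) f" "\<And>v. v \<in> span (set bs) \<Longrightarrow> f v \<in> span (set bs)"
    and "\<And>v. v \<in> span (set bs) \<Longrightarrow> g v \<in> span (set bs)"
  shows "basis_mat bs (f \<circ> g) = basis_mat bs f * basis_mat bs g"
proof (rule eq_matI)
  fix i j assume "i < dim_row (basis_mat bs f * basis_mat bs g)" "j < dim_col (basis_mat bs f * basis_mat bs g)"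
  hence ij: "i < length bs" "j < length bs" by (simp_all add: basis_mat_def)
  have "g (bs ! j) \<in> span (set bs)" using assms(3) ij by (simp add: span_base)
  from basis_mat_apply[OF assms(1,2) this ij(1)]
  show "basis_mat bs (f \<circ> g) $$ (i, j) = (basis_mat bs f * basis_mat bs g) $$ (i, j)"
    using ij by (simp add: basis_mat_def scalar_prod_def lessThan_atLeast0)
qed (simp_all add: basis_mat_def)

end

end

text \<open>The determinant is the product of the eigenvalues, each of which is \<open>\<plusminus>1\<close> or \<open>q\<close>.\<close>

lemma det_eq_power_of_eigenvalues:
  fixes A :: "complex mat"
  assumes A: "A \<in> carrier_mat n n" and ev: "\<And>\<mu>. eigenvalue A \<mu> \<Longrightarrow> \<mu>\<^sup>2 = 1 \<or> \<mu> = q"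
  shows "\<exists>m. (det A)\<^sup>2 = q ^ (2 * m) \<and> (eigenvalue A q \<longrightarrow> m > 0)"
proof -
  obtain as where as: "char_poly A = (\<Prod>a\<leftarrow>as. [:- a, 1:])" "length as = n"
    using char_poly_factorized[OF A] by blast
  have root: "eigenvalue A a \<longleftrightarrow> a \<in> set as" for a
    unfolding eigenvalue_root_char_poly[OF A] as(1)
    by (induction as) auto
  have "poly (char_poly A) 0 = (- 1) ^ n * prod_list as"
    unfolding as(1) as(2)[symmetric] by (induction as) auto
  moreover have "poly (char_poly A) 0 = (- 1) ^ n * det A"
  proof -
    have "- char_matrix A 0 = (- 1) \<cdot>\<^sub>m A" using A by (auto simp: char_matrix_def)
    thus ?thesis using A by (simp add: char_poly_matrix[OF A])
  qed
  ultimately have det: "det A = prod_list as" by simp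
  have "\<exists>m. (prod_list as)\<^sup>2 = q ^ (2 * m) \<and> (q \<in> set as \<longrightarrow> m > 0)"
    if "\<forall>a\<in>set as. a\<^sup>2 = 1 \<or> a = q" for as :: "complex list"
    using that
  proof (induction as)
    case (Cons a as)
    then obtain m where m: "(prod_list as)\<^sup>2 = q ^ (2 * m)" "q \<in> set as \<longrightarrow> m > 0" by auto
    show ?case
    proof (cases "a = q")
      case True
      thus ?thesis using m by (intro exI[of _ "Suc m"]) (simp add: power_mult_distrib power2_eq_square)
    next
      case False
      thus ?thesis using m Cons.prems by (intro exI[of _ m]) (auto simp: power_mult_distrib)
    qed
  qed (intro exI[of _ 0], simp)
  thus ?thesis using ev root det by metis
qed

section \<open>Absence of the eigenvalue one\<close>

locale complex_ring = scalar_ring k for k :: "complex \<Rightarrow> 'r::{ring,monoid_mult}"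
begin

lemma finite_basis_list:
  assumes "vs.subspace Z" "Z \<subseteq> vs.span F" "finite F"
  obtains bs where "distinct bs" "vs.independent (set bs)" "vs.span (set bs) = Z"
proof -
  obtain B where B: "B \<subseteq> Z" "vs.independent B" "Z \<subseteq> vs.span B" by (rule vs.basis_exists[of Z])
  have "B \<subseteq> vs.span F" using B(1) assms(2) by (rule subset_trans)
  hence "finite B" using vs.independent_span_bound[OF assms(3) B(2)] by simp
  then obtain bs where bs: "set bs = B" "distinct bs" using finite_distinct_list by blast
  have "vs.span B = Z" using B(3) vs.span_minimal[OF B(1) assms(1)] by (rule antisym[rotated])
  show ?thesis by (rule that[of bs]) (use bs B(2) \<open>vs.span B = Z\<close> in simp_all)
qed

lemma linear_right_mult: "Vector_Spaces.linear (\<lambda>c x. k c * x) (\<lambda>c x. k c * x) (\<lambda>h. h * x)"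
  unfolding Vector_Spaces.linear_iff
  by (intro conjI allI vs.vector_space_axioms) (simp_all only: distrib_right mult.assoc)

lemma cubic_eigenvalue:
  assumes "v \<noteq> 0" "v * x = k \<mu> * v" "v * x * x * x = k q * (v * x * x) + v * x - k q * v"
  shows "\<mu>\<^sup>2 = 1 \<or> \<mu> = q"
proof -
  have 2: "v * x * x = k (\<mu> * \<mu>) * v"
  proof -
    have "v * x * x = k \<mu> * v * x" by (simp only: assms(2))
    also have "\<dots> = k \<mu> * (v * x)" by (rule mult.assoc)
    also have "\<dots> = k (\<mu> * \<mu>) * v" unfolding assms(2) k_mult mult.assoc ..
    finally show ?thesis .
  qed
  have 3: "v * x * x * x = k (\<mu> * \<mu> * \<mu>) * v"
  proof -
    have "v * x * x * x = k (\<mu> * \<mu>) * (v * x)" unfolding 2 by (rule mult.assoc)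
    also have "\<dots> = k (\<mu> * \<mu>) * k \<mu> * v" unfolding assms(2) by (rule mult.assoc[symmetric])
    also have "\<dots> = k (\<mu> * \<mu> * \<mu>) * v" by (simp only: k_mult)
    finally show ?thesis .
  qed
  have "k (\<mu> * \<mu> * \<mu>) * v = k (q * (\<mu> * \<mu>)) * v + k \<mu> * v - k q * v"
  proof -
    have "k q * (v * x * x) = k q * k (\<mu> * \<mu>) * v" unfolding 2 by (rule mult.assoc[symmetric])
    hence "k q * (v * x * x) = k (q * (\<mu> * \<mu>)) * v" by (simp only: k_mult)
    with assms(2,3) 3 show ?thesis by simp
  qed
  hence "k (\<mu> * \<mu> * \<mu> - (q * (\<mu> * \<mu>) + \<mu> - q)) * v = 0"
    by (simp only: k_add k_diff left_diff_distrib distrib_right diff_self)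
  hence "\<mu> * \<mu> * \<mu> - (q * (\<mu> * \<mu>) + \<mu> - q) = 0" using assms(1) vs.scale_eq_0_iff by blast
  moreover have "\<mu> * \<mu> * \<mu> - (q * (\<mu> * \<mu>) + \<mu> - q) = (\<mu> - q) * (\<mu>\<^sup>2 - 1)"
    by (simp add: algebra_simps power2_eq_square)
  ultimately show ?thesis by auto
qed

text \<open>If a product of elements acts as the identity, so does its determinant; but each factor
  contributes a power of \<open>q\<close> up to sign, the exponent being the multiplicity of the eigenvalue
  \<open>q\<close>.\<close>

lemma product_identity_imp_root_of_unity:
  assumes Z: "vs.subspace Z" "Z \<subseteq> vs.span F" "finite F"
    and closed: "\<And>h x. h \<in> Z \<Longrightarrow> x \<in> set xs \<Longrightarrow> h * x \<in> Z"
    and cubic: "\<And>h x. h \<in> Z \<Longrightarrow> x \<in> set xs \<Longrightarrow> h * x * x * x = k q * (h * x * x) + h * x - k q * h"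
    and id: "\<And>h. h \<in> Z \<Longrightarrow> h * prod_list xs = h"
    and f: "f \<in> Z" "f \<noteq> 0" "x \<in> set xs" "f * x = k q * f"
  shows "\<exists>m>0. q ^ m = 1"
proof -
  obtain bs where bs: "distinct bs" "vs.independent (set bs)" "vs.span (set bs) = Z"
    by (rule finite_basis_list[OF Z])
  define M where "M = (\<lambda>x. vs.basis_mat bs (\<lambda>h. h * x))"
  let ?n = "length bs"
  have car: "M x \<in> carrier_mat ?n ?n" for x by (simp add: M_def vs.basis_mat_def)
  have bsZ: "bs ! j \<in> Z" if "j < ?n" for j
    using that bs(3) vs.span_base[of "bs ! j" "set bs"] by auto
  have mult: "det (M (x * y)) = det (M x) * det (M y)"
    if "\<And>h. h \<in> Z \<Longrightarrow> h * x \<in> Z" "\<And>h. h \<in> Z \<Longrightarrow> h * y \<in> Z" for x y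
  proof -
    have "M (x * y) = vs.basis_mat bs ((\<lambda>h. h * y) \<circ> (\<lambda>h. h * x))" by (simp add: M_def comp_def mult.assoc)
    also have "\<dots> = M y * M x"
      unfolding M_def
      by (rule vs.basis_mat_comp[OF bs(1,2) linear_right_mult]) (use that bs(3) in blast)+
    finally show ?thesis using det_mult[OF car car] by (simp add: mult.commute)
  qed
  have one: "M x = 1\<^sub>m ?n" if "\<And>h. h \<in> Z \<Longrightarrow> h * x = h" for x
  proof (rule eq_matI)
    fix i j assume "i < dim_row (1\<^sub>m ?n :: complex mat)" "j < dim_col (1\<^sub>m ?n :: complex mat)"
    thus "M x $$ (i, j) = 1\<^sub>m ?n $$ (i, j)"
      using bs that[OF bsZ, of j]
      by (simp add: M_def vs.basis_mat_def vs.representation_basis nth_eq_iff_index_eq)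
  qed (simp_all add: M_def vs.basis_mat_def)
  have det_pow: "\<exists>m. (det (M x))\<^sup>2 = q ^ (2 * m) \<and> ((\<exists>f\<in>Z. f \<noteq> 0 \<and> f * x = k q * f) \<longrightarrow> m > 0)"
    if x: "x \<in> set xs" for x
  proof -
    have eig: "eigenvalue (M x) \<mu> \<longleftrightarrow> (\<exists>v\<in>Z. v \<noteq> 0 \<and> v * x = k \<mu> * v)" for \<mu>
    proof -
      have "v * x \<in> vs.span (set bs)" if "v \<in> vs.span (set bs)" for v
        using closed[OF _ x] that unfolding bs(3) .
      from vs.basis_mat_eigenvalue[OF bs(1,2) linear_right_mult this]
      show ?thesis unfolding bs(3) M_def .
    qed
    have "\<mu>\<^sup>2 = 1 \<or> \<mu> = q" if \<mu>: "eigenvalue (M x) \<mu>" for \<mu>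
    proof -
      obtain v where v: "v \<in> Z" "v \<noteq> 0" "v * x = k \<mu> * v"
        using eig[THEN iffD1, OF \<mu>] by (elim bexE conjE)
      from cubic_eigenvalue[OF v(2,3) cubic[OF v(1) x]] show ?thesis .
    qed
    from det_eq_power_of_eigenvalues[of "M x", OF car this] show ?thesis unfolding eig .
  qed
  have "\<exists>m. (det (M (prod_list ys)))\<^sup>2 = q ^ (2 * m) \<and> (x \<in> set ys \<longrightarrow> m > 0) \<and> (\<forall>h\<in>Z. h * prod_list ys \<in> Z)"
    if "set ys \<subseteq> set xs" for ys
    using that
  proof (induction ys)
    case Nil
    have "det (M 1) = 1" using one[of 1] by simp
    thus ?case by (intro exI[of _ 0]) simp
  next
    case (Cons y ys)
    then obtain m where m: "(det (M (prod_list ys)))\<^sup>2 = q ^ (2 * m)" "x \<in> set ys \<longrightarrow> m > 0"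
      "\<forall>h\<in>Z. h * prod_list ys \<in> Z" unfolding set_simps by blast
    obtain m' where m': "(det (M y))\<^sup>2 = q ^ (2 * m')"
      "(\<exists>f\<in>Z. f \<noteq> 0 \<and> f * y = k q * f) \<longrightarrow> m' > 0"
      using det_pow[of y] Cons.prems unfolding set_simps by blast
    have y: "\<And>h. h \<in> Z \<Longrightarrow> h * y \<in> Z" using closed Cons.prems unfolding set_simps by blast
    have "m' > 0" if "y = x" using m'(2) f(1,2,4) unfolding that by blast
    hence "x \<in> set (y # ys) \<longrightarrow> m' + m > 0" using m(2) by auto
    moreover have "(det (M (prod_list (y # ys))))\<^sup>2 = q ^ (2 * (m' + m))"
    proof -
      have "det (M (prod_list (y # ys))) = det (M y) * det (M (prod_list ys))"
        unfolding prod_list.Cons by (rule mult) (use y m(3) in blast)+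
      thus ?thesis using m(1) m'(1) by (simp only: power_mult_distrib power_add distrib_left)
    qed
    moreover have "\<forall>h\<in>Z. h * prod_list (y # ys) \<in> Z"
      using y m(3) by (simp only: prod_list.Cons mult.assoc[symmetric]) blast
    ultimately show ?case by blast
  qed
  from this[of xs] obtain m where m: "(det (M (prod_list xs)))\<^sup>2 = q ^ (2 * m)" "m > 0"
    using f(3) by auto
  have "q ^ (2 * m) = 1" using m(1) one[OF id] by simp
  thus ?thesis using m(2) by (intro exI[of _ "2 * m"]) simp
qed

text \<open>The value of a polynomial at an element of a noncommutative ring, by Horner's scheme.\<close>

definition pev :: "'r \<Rightarrow> complex poly \<Rightarrow> 'r"
  where "pev z p = fold_coeffs (\<lambda>a x. k a + z * x) p 0"

lemma pev_0 [simp]: "pev z 0 = 0"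
  by (simp add: pev_def)

lemma pev_pCons [simp]: "pev z (pCons a p) = k a + z * pev z p"
  by (cases "p = 0 \<and> a = 0") (auto simp: pev_def)

lemma pev_diff: "pev z (p - r) = pev z p - pev z r"
  by (induction p r rule: poly_induct2) (simp_all add: k_diff right_diff_distrib)

lemma pev_linear_factor: "pev z ([:- 1, 1:] * r) = (z - 1) * pev z r"
proof -
  have "[:- 1, 1:] * r = pCons 0 r - r" by simp
  thus ?thesis by (simp only: pev_diff pev_pCons) (simp add: left_diff_distrib)
qed

lemma pev_lin: "z \<in> lin \<Longrightarrow> pev z p \<in> lin"
  by (induction p) auto

lemma pev_commute:
  assumes "x \<in> lin" "x * z = z * x" shows "x * pev z p = pev z p * x"
proof (induction p)
  case (pCons a p)
  have "x * (z * pev z p) = z * (x * pev z p)" using assms(2) by (simp flip: mult.assoc)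
  thus ?case using pCons assms(1) by (simp add: distrib_left distrib_right linD mult.assoc)
qed simp

lemma pev_monom: "z \<in> lin \<Longrightarrow> pev z (monom c n) = k c * z ^ n"
proof (induction n)
  case (Suc n)
  have "z * (k c * z ^ n) = k c * (z * z ^ n)" using linD[OF Suc.prems, of c] by (simp flip: mult.assoc)
  thus ?case using Suc by (simp add: monom_Suc)
qed (simp add: monom_0)

lemma pev_sum: "pev z (sum f A) = (\<Sum>i\<in>A. pev z (f i))"
proof (induction A rule: infinite_finite_induct)
  case (insert i A)
  have "pev z (p + r) = pev z p + pev z r" for p r
    using pev_diff[of z "p + r" r] by simp
  thus ?case using insert by simp
qed simp_all

lemma annihilating_polynomial:
  assumes "finite F" "z \<in> lin" "\<And>i. z ^ i \<in> vs.span F"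
  obtains p where "p \<noteq> 0" "pev z p = 0"
proof (cases "inj_on (\<lambda>i. z ^ i) {..card F}")
  case True
  let ?P = "(\<lambda>i. z ^ i) ` {..card F}"
  have "vs.dependent ?P"
    using vs.independent_span_bound[OF assms(1), of ?P] assms(3) card_image[OF True] by auto
  then obtain u where u: "(\<Sum>v\<in>?P. k (u v) * v) = 0" "\<exists>v\<in>?P. u v \<noteq> 0"
    unfolding vs.dependent_finite[OF finite_imageI[OF finite_atMost]] by blast
  define p where "p = (\<Sum>i\<le>card F. monom (u (z ^ i)) i)"
  have "pev z p = (\<Sum>i\<le>card F. k (u (z ^ i)) * z ^ i)"
    using assms(2) by (simp add: p_def pev_sum pev_monom)
  also have "\<dots> = 0" using u(1) by (simp add: sum.reindex[OF True])
  finally have "pev z p = 0" .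
  moreover obtain i where i: "i \<le> card F" "u (z ^ i) \<noteq> 0" using u(2) by auto
  have "coeff p i = (\<Sum>j\<le>card F. if j = i then u (z ^ j) else 0)"
    unfolding p_def coeff_sum by (intro sum.cong) auto
  hence "coeff p i = u (z ^ i)" using i(1) by simp
  hence "p \<noteq> 0" using i(2) by auto
  ultimately show ?thesis using that by blast
next
  case False
  then obtain i j where ij: "i \<noteq> j" "z ^ i = z ^ j" by (auto simp: inj_on_def)
  have "pev z (monom 1 i - monom 1 j) = 0" using ij assms(2) by (simp add: pev_diff pev_monom)
  moreover have "coeff (monom 1 i - monom 1 j) i = (1 :: complex)" using ij(1) by simp
  hence "monom 1 i - monom 1 j \<noteq> (0 :: complex poly)" by (metis coeff_0 zero_neq_one)
  ultimately show ?thesis using that by blast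
qed

text \<open>On the ideal generated by the elements \<open>x\<^sup>2 - 1\<close> the central element \<open>z\<close> has no eigenvalue \<open>1\<close>:
  on an eigenspace for \<open>1\<close> some factor of \<open>z\<close> would have the eigenvalue \<open>q\<close>. So the minimal
  polynomial of \<open>z\<close> there does not vanish at \<open>1\<close>.\<close>

lemma invertible_modulo_minus_one:
  assumes q: "\<And>m. m > 0 \<Longrightarrow> q ^ m \<noteq> 1"
    and H: "vs.subspace H" "H \<subseteq> vs.span F" "finite F" "H \<subseteq> lin" "1 \<in> H"
    and lin: "set xs \<subseteq> lin"
    and closed: "\<And>h x. h \<in> H \<Longrightarrow> x \<in> set xs \<Longrightarrow> h * x \<in> H"
    and cubic: "\<And>x. x \<in> set xs \<Longrightarrow> x * x * x = k q * (x * x) + x - k q"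
    and z: "z = prod_list xs" "\<And>x. x \<in> set xs \<Longrightarrow> z * x = x * z"
  shows "\<exists>c h. c \<noteq> 0 \<and> h \<in> lin \<and>
    (\<forall>x\<in>set xs. x * h = h * x \<and> (k c + (z - 1) * h) * (x * x - 1) = 0)"
proof -
  have prod: "h * prod_list ys \<in> H \<and> prod_list ys \<in> lin" if "h \<in> H" "set ys \<subseteq> set xs" for h ys
    using that
  proof (induction ys arbitrary: h)
    case (Cons y ys)
    have "h * y * prod_list ys \<in> H" "prod_list ys \<in> lin" using Cons closed by auto
    thus ?case using Cons.prems lin by (auto simp: mult.assoc)
  qed simp
  have z_lin: "z \<in> lin" and Hz: "h * z \<in> H" if "h \<in> H" for h
    using prod[OF that, of xs] H(5) by (simp_all add: z(1))
  hence z_lin: "z \<in> lin" using H(5) by blast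
  have x_lin: "x \<in> lin" if "x \<in> set xs" for x using lin that by blast
  have pow: "z ^ i \<in> H" for i
    by (induction i) (use H(5) Hz in \<open>simp_all add: power_Suc2 del: power_Suc\<close>)
  have pev_H: "pev z p \<in> H" for p
  proof (induction p)
    case (pCons a p)
    have "k a * 1 + pev z p * z \<in> H"
      by (intro vs.subspace_add[OF H(1)] vs.subspace_scale[OF H(1)] H(5) Hz pCons.IH)
    thus ?case using pev_commute[OF z_lin, of z p] by simp
  qed (use vs.subspace_0[OF H(1)] in simp)
  have x_pev: "x * pev z p = pev z p * x" if "x \<in> set xs" for x p
    using pev_commute[OF x_lin[OF that]] z(2)[OF that] by simp
  let ?ann = "\<lambda>p. p \<noteq> 0 \<and> (\<forall>x\<in>set xs. pev z p * (x * x - 1) = 0)"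
  obtain p0 where "p0 \<noteq> 0" "pev z p0 = 0"
    using annihilating_polynomial[OF H(3) z_lin] pow H(2) by blast
  hence "?ann p0" by simp
  then obtain p where p: "?ann p" "\<And>r. ?ann r \<Longrightarrow> degree p \<le> degree r"
    using ex_has_least_nat[of ?ann p0 degree] by blast
  have p1: "poly p 1 \<noteq> 0"
  proof
    assume "poly p 1 = 0"
    then obtain r where r: "p = [:- 1, 1:] * r" unfolding poly_eq_0_iff_dvd by (auto elim: dvdE)
    with p(1) have r0: "r \<noteq> 0" by auto
    have "degree p = Suc (degree r)" unfolding r using r0 by (subst degree_mult_eq) auto
    hence "\<not> ?ann r" using p(2)[of r] by auto
    then obtain x where x: "x \<in> set xs" "pev z r * (x * x - 1) \<noteq> 0" using r0 by blast
    define f where "f = pev z r * (x * x - 1)"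
    have fH: "f \<in> H"
    proof -
      have "pev z r * x * x - pev z r \<in> H"
        by (intro vs.subspace_diff[OF H(1)] closed pev_H x)
      thus ?thesis by (simp add: f_def right_diff_distrib mult.assoc)
    qed
    have zx: "(x * x - 1) * z = z * (x * x - 1)"
    proof -
      have "x * x * z = x * (z * x)" by (simp only: z(2)[OF x(1)] mult.assoc)
      also have "\<dots> = z * (x * x)" by (simp only: z(2)[OF x(1), symmetric] mult.assoc[symmetric])
      finally show ?thesis by (simp add: left_diff_distrib right_diff_distrib)
    qed
    have "pev z p * (x * x - 1) = 0" using p(1) x(1) by blast
    hence "(z - 1) * f = 0" unfolding r pev_linear_factor f_def mult.assoc .
    hence "z * f = f" by (simp add: left_diff_distrib)
    moreover have "f * z = z * f"
    proof -
      have "f * z = pev z r * z * (x * x - 1)" by (simp only: f_def zx mult.assoc)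
      also have "pev z r * z = z * pev z r" using pev_commute[OF z_lin, of z r] by simp
      finally show ?thesis by (simp only: f_def mult.assoc)
    qed
    ultimately have fz: "f * z = f" by simp
    have "f * x = pev z r * (x * x * x - x)" by (simp add: f_def algebra_simps)
    also have "x * x * x - x = k q * (x * x - 1)" using cubic[OF x(1)] by (simp add: right_diff_distrib)
    also have "pev z r * (k q * (x * x - 1)) = k q * f"
      unfolding f_def mult.assoc[symmetric] linD[OF pev_lin[OF z_lin]] ..
    finally have fx: "f * x = k q * f" .
    let ?Z = "{h \<in> H. h * z = h}"
    have "\<exists>m>0. q ^ m = 1"
    proof (rule product_identity_imp_root_of_unity[of ?Z F xs q f x])
      show "vs.subspace ?Z"
        using H(1) by (auto simp: vs.subspace_def distrib_right mult.assoc)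
      show "?Z \<subseteq> vs.span F" "finite F" using H by auto
      show "h * y \<in> ?Z" if "h \<in> ?Z" "y \<in> set xs" for h y
      proof -
        have "h * y * z = h * (z * y)" by (simp only: z(2)[OF that(2)] mult.assoc)
        also have "\<dots> = h * y" using that(1) by (simp flip: mult.assoc)
        finally show ?thesis using that closed by simp
      qed
      show "h * y * y * y = k q * (h * y * y) + h * y - k q * h" if "h \<in> ?Z" "y \<in> set xs" for h y
      proof -
        have h: "h * k q = k q * h" using that H(4) by (auto intro: linD)
        have "h * y * y * y = h * (y * y * y)" by (simp add: mult.assoc)
        also have "\<dots> = h * (k q * (y * y) + y - k q)" by (simp only: cubic[OF that(2)])
        also have "\<dots> = h * k q * (y * y) + h * y - h * k q"
          by (simp only: distrib_left right_diff_distrib mult.assoc)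
        finally show ?thesis by (simp add: h mult.assoc)
      qed
      show "h * prod_list xs = h" if "h \<in> ?Z" for h using that z(1) by simp
    qed (use fH fz fx x f_def in auto)
    thus False using q by blast
  qed
  obtain r where r: "p - [:poly p 1:] = [:- 1, 1:] * r"
  proof -
    have "poly (p - [:poly p 1:]) 1 = 0" by simp
    thus ?thesis using that unfolding poly_eq_0_iff_dvd by (auto elim: dvdE)
  qed
  have pev_p: "pev z p = k (poly p 1) + (z - 1) * pev z r"
  proof -
    have "pev z (p - [:poly p 1:]) = (z - 1) * pev z r" unfolding r by (rule pev_linear_factor)
    thus ?thesis by (simp add: pev_diff algebra_simps)
  qed
  show ?thesis
  proof (intro exI conjI ballI)
    show "poly p 1 \<noteq> 0" by (rule p1)
    show "pev z r \<in> lin" by (rule pev_lin[OF z_lin])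
    fix x assume x: "x \<in> set xs"
    show "x * pev z r = pev z r * x" by (rule x_pev[OF x])
    show "(k (poly p 1) + (z - 1) * pev z r) * (x * x - 1) = 0" using p(1) x unfolding pev_p by blast
  qed
qed

end

section \<open>Presented groups\<close>

lemma words_append [simp]: "u @ v \<in> words X \<longleftrightarrow> u \<in> words X \<and> v \<in> words X"
  by (auto simp: words_def)

lemma words_Nil [simp]: "[] \<in> words X"
  by (simp add: words_def)

lemma words_Cons [simp]: "(x, e) # u \<in> words X \<longleftrightarrow> x \<in> X \<and> u \<in> words X"
  by (auto simp: words_def)

lemma pres_equiv_words: "pres_equiv X R u v \<Longrightarrow> u \<in> words X \<and> v \<in> words X"
  by (induction rule: pres_equiv.induct) auto

lemma pres_equiv_context:
  assumes "pres_equiv X R u v" "l \<in> words X" "r \<in> words X"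
  shows "pres_equiv X R (l @ u @ r) (l @ v @ r)"
  using assms
proof (induction rule: pres_equiv.induct)
  case (rel u v a b)
  then show ?case using pres_equiv.rel[of u v R X "l @ a" "b @ r"] by simp
next
  case (cancel x a b e)
  then show ?case using pres_equiv.cancel[of x X "l @ a" "b @ r" R e] by simp
qed (auto intro: pres_equiv.refl pres_equiv.sym pres_equiv.trans)

lemma pres_equiv_append:
  assumes "pres_equiv X R u u'" "pres_equiv X R v v'" shows "pres_equiv X R (u @ v) (u' @ v')"
  using pres_equiv_context[OF assms(1), of "[]" v] pres_equiv_context[OF assms(2), of u' "[]"]
    pres_equiv_words[OF assms(1)] pres_equiv_words[OF assms(2)] by (auto intro: pres_equiv.trans)

lemma pres_class_eq:
  assumes "u \<in> words X" shows "pres_class X R u = pres_class X R v \<longleftrightarrow> pres_equiv X R u v"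
proof
  assume "pres_class X R u = pres_class X R v"
  moreover have "u \<in> pres_class X R u" using assms by (simp add: pres_class_def pres_equiv.refl)
  ultimately show "pres_equiv X R u v" by (auto simp: pres_class_def intro: pres_equiv.sym)
next
  assume "pres_equiv X R u v"
  thus "pres_class X R u = pres_class X R v"
    by (auto simp: pres_class_def intro: pres_equiv.sym pres_equiv.trans)
qed

lemma pres_mult:
  assumes "u \<in> words X" "v \<in> words X"
  shows "pres_class X R u \<otimes>\<^bsub>presented_group X R\<^esub> pres_class X R v = pres_class X R (u @ v)"
proof -
  have "pres_class X R (u' @ v') = pres_class X R (u @ v)"
    if "u' \<in> pres_class X R u" "v' \<in> pres_class X R v" for u' v'
  proof -
    have "pres_equiv X R (u @ v) (u' @ v')"
      using that by (auto simp: pres_class_def intro: pres_equiv_append)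
    thus ?thesis using assms by (metis pres_class_eq words_append)
  qed
  moreover have "u \<in> pres_class X R u" "v \<in> pres_class X R v"
    using assms by (simp_all add: pres_class_def pres_equiv.refl)
  ultimately have "(\<Union>u'\<in>pres_class X R u. \<Union>v'\<in>pres_class X R v. pres_class X R (u' @ v')) = pres_class X R (u @ v)"
    by blast
  thus ?thesis by (simp add: presented_group_def)
qed

lemma pres_carrier: "carrier (presented_group X R) = pres_class X R ` words X"
  and pres_one: "\<one>\<^bsub>presented_group X R\<^esub> = pres_class X R []"
  by (simp_all add: presented_group_def)

lemma monoid_presented_group: "Group.monoid (presented_group X R)"
proof (rule monoidI)
  fix x y assume "x \<in> carrier (presented_group X R)" "y \<in> carrier (presented_group X R)"
  thus "x \<otimes>\<^bsub>presented_group X R\<^esub> y \<in> carrier (presented_group X R)"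
    by (auto simp: pres_carrier pres_mult)
next
  fix x y z assume "x \<in> carrier (presented_group X R)" "y \<in> carrier (presented_group X R)"
    "z \<in> carrier (presented_group X R)"
  thus "x \<otimes>\<^bsub>presented_group X R\<^esub> y \<otimes>\<^bsub>presented_group X R\<^esub> z
      = x \<otimes>\<^bsub>presented_group X R\<^esub> (y \<otimes>\<^bsub>presented_group X R\<^esub> z)"
    by (auto simp: pres_carrier pres_mult)
qed (auto simp: pres_carrier pres_one pres_mult)

section \<open>Words in a Coxeter system\<close>

fun alt_list :: "nat \<Rightarrow> 'a \<Rightarrow> 'a \<Rightarrow> 'a list"
  where
    "alt_list 0 s t = []"
  | "alt_list (Suc m) s t = s # alt_list m t s"

lemma map_fst_alternating: "map fst (alternating m s t) = alt_list m s t"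
  by (induction m s t rule: alternating.induct) auto

lemma length_alt_list [simp]: "length (alt_list m s t) = m"
  by (induction m s t rule: alt_list.induct) auto

lemma set_alt_list: "set (alt_list m s t) \<subseteq> {s, t}"
  by (induction m s t rule: alt_list.induct) auto

locale coxeter = group W for W (structure) +
  fixes S
  assumes coxeter: "coxeter_system W S"
begin

lemma S_carrier: "S \<subseteq> carrier W"
  using coxeter by (simp add: coxeter_system_def)

lemma S_closed [simp, intro]: "s \<in> S \<Longrightarrow> s \<in> carrier W"
  using S_carrier by blast

lemma ord_S: "s \<in> S \<Longrightarrow> ord s = 2"
  using coxeter by (simp add: coxeter_system_def)

lemma S_square [simp]: "s \<in> S \<Longrightarrow> s \<otimes> s = \<one>"
  using pow_ord_eq_1[of s] ord_S[of s] by (simp add: numeral_2_eq_2)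

lemma S_inv [simp]: "s \<in> S \<Longrightarrow> inv s = s"
  by (simp add: inv_equality)

lemma S_cancel [simp]: "s \<in> S \<Longrightarrow> w \<in> carrier W \<Longrightarrow> s \<otimes> (s \<otimes> w) = w"
  by (simp flip: m_assoc)

lemma S_not_one: "s \<in> S \<Longrightarrow> s \<noteq> \<one>"
  using ord_S ord_eq_1 by fastforce

definition ev :: "'a list \<Rightarrow> 'a" where "ev ss = foldr (\<otimes>) ss \<one>"

lemma ev_simps [simp]: "ev [] = \<one>" "ev (s # ss) = s \<otimes> ev ss"
  by (simp_all add: ev_def)

lemma ev_closed [simp]: "set ss \<subseteq> S \<Longrightarrow> ev ss \<in> carrier W"
  by (induction ss) auto

lemma ev_append: "set us \<subseteq> S \<Longrightarrow> set vs \<subseteq> S \<Longrightarrow> ev (us @ vs) = ev us \<otimes> ev vs"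
  by (induction us) (auto simp: m_assoc)

lemma ev_rev: "set ss \<subseteq> S \<Longrightarrow> ev (rev ss) = inv (ev ss)"
  by (induction ss) (auto simp: ev_append inv_mult_group)

text \<open>The parity with which \<open>t\<close> occurs among the reflections
  \<open>s\<^sub>1 \<cdots> s\<^sub>i s\<^sub>i\<^sub>+\<^sub>1 s\<^sub>i \<cdots> s\<^sub>1\<close> met along the word.\<close>

fun crosses :: "'a list \<Rightarrow> 'a \<Rightarrow> bool"
  where
    "crosses [] t = False"
  | "crosses (s # ss) t = ((t = s) \<noteq> crosses ss (s \<otimes> t \<otimes> s))"

lemma crosses_append:
  assumes "set us \<subseteq> S" "set vs \<subseteq> S" "t \<in> carrier W"
  shows "crosses (us @ vs) t \<longleftrightarrow> (crosses us t \<noteq> crosses vs (inv (ev us) \<otimes> t \<otimes> ev us))"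
  using assms
proof (induction us arbitrary: t)
  case (Cons s us)
  hence "inv (s \<otimes> ev us) \<otimes> t \<otimes> (s \<otimes> ev us) = inv (ev us) \<otimes> (s \<otimes> t \<otimes> s) \<otimes> ev us"
    by (simp add: inv_mult_group m_assoc)
  moreover have "crosses (us @ vs) (s \<otimes> t \<otimes> s)
      \<longleftrightarrow> (crosses us (s \<otimes> t \<otimes> s) \<noteq> crosses vs (inv (ev us) \<otimes> (s \<otimes> t \<otimes> s) \<otimes> ev us))"
    using Cons by (intro Cons.IH) auto
  ultimately show ?case by auto
qed simp

lemma inv_cancel [simp]:
  "p \<in> carrier W \<Longrightarrow> x \<in> carrier W \<Longrightarrow> p \<otimes> (inv p \<otimes> x) = x"
  "p \<in> carrier W \<Longrightarrow> x \<in> carrier W \<Longrightarrow> inv p \<otimes> (p \<otimes> x) = x"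
  by (simp_all flip: m_assoc)

lemma conj_eq_iff:
  assumes "p \<in> carrier W" "x \<in> carrier W" "z \<in> carrier W"
  shows "inv p \<otimes> x \<otimes> p = z \<longleftrightarrow> x = p \<otimes> z \<otimes> inv p"
proof
  assume "inv p \<otimes> x \<otimes> p = z"
  hence "p \<otimes> z \<otimes> inv p = p \<otimes> (inv p \<otimes> x \<otimes> p) \<otimes> inv p" by simp
  also have "\<dots> = x" using assms by (simp add: m_assoc)
  finally show "x = p \<otimes> z \<otimes> inv p" by simp
next
  assume "x = p \<otimes> z \<otimes> inv p"
  thus "inv p \<otimes> x \<otimes> p = z" using assms by (simp add: m_assoc)
qed

text \<open>The reflection met at the letter with index \<open>j\<close> of an alternating word is \<open>(st)\<^sup>j s\<close>.\<close>

lemma crosses_alternating: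
  assumes "s \<in> S" "t \<in> S" "x \<in> carrier W"
  shows "crosses (alt_list (2 * n) s t) x \<longleftrightarrow> odd (\<Sum>j<2 * n. of_bool (x = (s \<otimes> t) [^] j \<otimes> s) :: nat)"
  using assms
proof (induction n arbitrary: x)
  case (Suc n)
  let ?p = "s \<otimes> t"
  let ?y = "t \<otimes> (s \<otimes> x \<otimes> s) \<otimes> t"
  note [simp] = Suc.prems(1,2)
  have y: "?y = inv ?p \<otimes> x \<otimes> ?p" using Suc.prems by (simp add: inv_mult_group m_assoc)
  have shift: "?y = ?p [^] j \<otimes> s \<longleftrightarrow> x = ?p [^] (Suc (Suc j)) \<otimes> s" for j
  proof -
    have sp: "s \<otimes> inv ?p = ?p \<otimes> s" by (simp add: inv_mult_group m_assoc)
    have "?y = ?p [^] j \<otimes> s \<longleftrightarrow> x = ?p \<otimes> (?p [^] j \<otimes> s) \<otimes> inv ?p"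
      unfolding y using Suc.prems by (intro conj_eq_iff) auto
    also have "?p \<otimes> (?p [^] j \<otimes> s) \<otimes> inv ?p = ?p \<otimes> ?p [^] j \<otimes> (s \<otimes> inv ?p)"
      by (simp add: m_assoc)
    also have "\<dots> = ?p \<otimes> ?p [^] j \<otimes> ?p \<otimes> s" unfolding sp by (simp add: m_assoc)
    also have "?p \<otimes> ?p [^] j \<otimes> ?p = ?p [^] (Suc (Suc j))"
      using nat_pow_comm[of ?p 1 j] by (simp add: m_assoc)
    finally show ?thesis .
  qed
  have "crosses (alt_list (2 * Suc n) s t) x \<longleftrightarrow> ((x = s) \<noteq> ((s \<otimes> x \<otimes> s = t) \<noteq> crosses (alt_list (2 * n) s t) ?y))"
    by simp
  also have "crosses (alt_list (2 * n) s t) ?y \<longleftrightarrow> odd (\<Sum>j<2 * n. of_bool (x = ?p [^] (Suc (Suc j)) \<otimes> s) :: nat)"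
    using Suc.prems by (subst Suc.IH) (simp_all only: shift, auto)
  also have "s \<otimes> x \<otimes> s = t \<longleftrightarrow> x = ?p [^] (1::nat) \<otimes> s"
  proof -
    have "s \<otimes> (s \<otimes> x \<otimes> s) \<otimes> s = x" using Suc.prems by (simp add: m_assoc)
    moreover have "s \<otimes> (s \<otimes> t \<otimes> s) \<otimes> s = t" by (simp add: m_assoc)
    ultimately show ?thesis by (auto simp: nat_pow_Suc)
  qed
  also have "x = s \<longleftrightarrow> x = ?p [^] (0::nat) \<otimes> s" by simp
  finally have "crosses (alt_list (2 * Suc n) s t) x \<longleftrightarrow>
      ((x = ?p [^] (0::nat) \<otimes> s) \<noteq> ((x = ?p [^] (1::nat) \<otimes> s) \<noteq>
        odd (\<Sum>j<2 * n. of_bool (x = ?p [^] (Suc (Suc j)) \<otimes> s) :: nat)))" .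
  moreover have "(\<Sum>j<2 * Suc n. f j) = f 0 + (f 1 + (\<Sum>j<2 * n. f (Suc (Suc j))))" for f :: "nat \<Rightarrow> nat"
    by (simp only: mult_Suc_right numeral_2_eq_2 add_Suc add_0 sum.lessThan_Suc_shift One_nat_def)
  moreover have "odd (of_bool p + (of_bool q + N) :: nat) \<longleftrightarrow> (p \<noteq> (q \<noteq> odd N))" for p q N
    by auto
  ultimately show ?case by (simp only:)
qed simp

lemma sum_doubling:
  fixes f :: "nat \<Rightarrow> nat" assumes "\<And>j. f (m + j) = f j" shows "(\<Sum>j<2 * m. f j) = 2 * (\<Sum>j<m. f j)"
proof -
  have "(\<Sum>j<m + k. f j) = (\<Sum>j<m. f j) + (\<Sum>j<k. f (m + j))" for k
    by (induction k) simp_all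
  from this[of m] show ?thesis by (simp add: assms mult_2)
qed

lemma ev_alternating: "s \<in> S \<Longrightarrow> t \<in> S \<Longrightarrow> ev (alt_list (2 * n) s t) = (s \<otimes> t) [^] n"
proof (induction n)
  case (Suc n)
  have "(s \<otimes> t) [^] Suc n = (s \<otimes> t) \<otimes> (s \<otimes> t) [^] n"
    using Suc.prems by (intro nat_pow_Suc2) auto
  thus ?case using Suc by (simp add: m_assoc del: nat_pow_Suc)
qed simp

lemma conj_S:
  assumes "s \<in> S" "x \<in> carrier W"
  shows "s \<otimes> (s \<otimes> x \<otimes> s) \<otimes> s = x" "s \<otimes> x \<otimes> s = s \<longleftrightarrow> x = s"
proof -
  show *: "s \<otimes> (s \<otimes> x \<otimes> s) \<otimes> s = x" using assms by (simp add: m_assoc)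
  show "s \<otimes> x \<otimes> s = s \<longleftrightarrow> x = s"
  proof
    assume "s \<otimes> x \<otimes> s = s"
    thus "x = s" using * assms by simp
  qed (use assms in simp)
qed

lemma crosses_pair: "s \<in> S \<Longrightarrow> x \<in> carrier W \<Longrightarrow> crosses (s # s # ss) x = crosses ss x"
  by (simp only: crosses.simps conj_S) blast

lemma crosses_relation:
  assumes "s \<in> S" "t \<in> S" "x \<in> carrier W"
  shows "\<not> crosses (alt_list (2 * ord (s \<otimes> t)) s t) x"
proof -
  define m where "m = ord (s \<otimes> t)"
  have "(s \<otimes> t) [^] (m + j) = (s \<otimes> t) [^] j" for j
    using assms by (simp add: m_def nat_pow_mult[symmetric])
  hence "(\<Sum>j<2 * m. of_bool (x = (s \<otimes> t) [^] j \<otimes> s) :: nat) = 2 * (\<Sum>j<m. of_bool (x = (s \<otimes> t) [^] j \<otimes> s))"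
    by (intro sum_doubling) simp
  thus ?thesis using crosses_alternating[OF assms, of m] by (simp add: m_def)
qed


lemma words_fst: "u \<in> words S \<Longrightarrow> set (map fst u) \<subseteq> S"
  by (auto simp: words_def)

text \<open>Both the value and the crossing parities are invariants of the word problem: in a relator
  \<open>(st)\<^sup>m\<close> every reflection \<open>(st)\<^sup>j s\<close> is met for the indices \<open>j\<close> and \<open>j + m\<close>.\<close>

lemma pres_equiv_invariants:
  assumes "pres_equiv S (coxeter_rels W S) u v"
  shows "ev (map fst u) = ev (map fst v) \<and>
    (\<forall>x\<in>carrier W. crosses (map fst u) x \<longleftrightarrow> crosses (map fst v) x)"
  using assms
proof (induction rule: pres_equiv.induct)
  case (rel u v a b)
  then obtain s t where st: "s \<in> S" "t \<in> S" "u = alternating (2 * ord (s \<otimes> t)) s t" "v = []"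
    by (auto simp: coxeter_rels_def)
  have sub: "set (map fst a) \<subseteq> S" "set (map fst b) \<subseteq> S" "set (map fst u) \<subseteq> S"
    using rel words_fst by blast+
  have u: "ev (map fst u) = \<one>" "\<And>x. x \<in> carrier W \<Longrightarrow> \<not> crosses (map fst u) x"
    using st crosses_relation by (simp_all add: map_fst_alternating ev_alternating)
  show ?case using sub u by (simp add: ev_append crosses_append st(4))
next
  case (cancel x a b e)
  hence "set (map fst a) \<subseteq> S" "set (map fst b) \<subseteq> S" using words_fst by blast+
  thus ?case using cancel(1) by (simp add: ev_append crosses_append crosses_pair del: crosses.simps)
qed auto

text \<open>Generators are involutions, so inverse letters may be read as letters.\<close>

lemma presentation_iso:
  obtains h where "h \<in> iso (presented_group S (coxeter_rels W S)) W"
    "\<And>u. u \<in> words S \<Longrightarrow> h (pres_class S (coxeter_rels W S) u) = ev (map fst u)"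
proof -
  let ?R = "coxeter_rels W S"
  let ?P = "presented_group S ?R"
  obtain h where h: "h \<in> iso ?P W" "\<And>s. s \<in> S \<Longrightarrow> h (pres_gen S ?R s) = s"
    using coxeter by (auto simp: coxeter_system_def)
  have hom: "h (pres_class S ?R (u @ v)) = h (pres_class S ?R u) \<otimes> h (pres_class S ?R v)"
    if "u \<in> words S" "v \<in> words S" for u v
    using hom_mult[OF iso_imp_homomorphism[OF h(1)], of "pres_class S ?R u" "pres_class S ?R v"] that
    by (simp add: pres_carrier pres_mult)
  have closed: "h (pres_class S ?R u) \<in> carrier W" if "u \<in> words S" for u
    using hom_in_carrier[OF iso_imp_homomorphism[OF h(1)], of "pres_class S ?R u"] that
    by (simp add: pres_carrier)
  have one: "h (pres_class S ?R []) = \<one>"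
    using hom[of "[]" "[]"] closed[of "[]"] by simp
  have letter: "h (pres_class S ?R [(s, e)]) = s" if s: "s \<in> S" for s e
  proof (cases e)
    case True thus ?thesis using h(2)[OF s] by (simp add: pres_gen_def)
  next
    case False
    have "pres_class S ?R ([(s, False)] @ [(s, True)]) = pres_class S ?R []"
      using pres_equiv.cancel[of s S "[]" "[]" ?R False] s by (subst pres_class_eq) simp_all
    hence "h (pres_class S ?R [(s, False)]) \<otimes> s = \<one>"
      using hom[of "[(s, False)]" "[(s, True)]"] s h(2)[OF s] one by (simp add: pres_gen_def)
    hence "h (pres_class S ?R [(s, False)]) = inv s"
      using closed[of "[(s, False)]"] s by (intro inv_equality[symmetric]) auto
    thus ?thesis using False s by simp
  qed
  have "h (pres_class S ?R u) = ev (map fst u)" if "u \<in> words S" for u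
    using that
  proof (induction u)
    case (Cons l u)
    then obtain s e where l: "l = (s, e)" "s \<in> S" "u \<in> words S" by (cases l) auto
    thus ?case using hom[of "[l]" u] letter Cons.IH by simp
  qed (simp add: one)
  thus ?thesis using that h(1) by blast
qed

lemma ev_surj: assumes "w \<in> carrier W" obtains ss where "set ss \<subseteq> S" "ev ss = w"
proof -
  obtain h where h: "h \<in> iso (presented_group S (coxeter_rels W S)) W"
    "\<And>u. u \<in> words S \<Longrightarrow> h (pres_class S (coxeter_rels W S) u) = ev (map fst u)"
    by (rule presentation_iso) auto
  then obtain u where "u \<in> words S" "ev (map fst u) = w"
    using assms by (auto simp: iso_iff pres_carrier image_iff set_eq_iff) (metis assms)
  thus ?thesis using that words_fst by blast
qed

text \<open>Words with the same value are equivalent in the presentation, hence have the same invariants.\<close>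

lemma crosses_cong:
  assumes "set us \<subseteq> S" "set vs \<subseteq> S" "ev us = ev vs" "x \<in> carrier W"
  shows "crosses us x \<longleftrightarrow> crosses vs x"
proof -
  let ?R = "coxeter_rels W S"
  let ?pos = "map (\<lambda>s. (s, True))"
  obtain h where h: "h \<in> iso (presented_group S ?R) W"
    "\<And>u. u \<in> words S \<Longrightarrow> h (pres_class S ?R u) = ev (map fst u)"
    by (rule presentation_iso) auto
  have w: "?pos us \<in> words S" "?pos vs \<in> words S" using assms by (auto simp: words_def)
  have "map fst (?pos ss) = ss" for ss :: "'a list" by (simp add: comp_def)
  hence "h (pres_class S ?R (?pos us)) = h (pres_class S ?R (?pos vs))"
    using h(2)[OF w(1)] h(2)[OF w(2)] assms(3) by simp
  hence "pres_class S ?R (?pos us) = pres_class S ?R (?pos vs)"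
    using h(1) w by (auto simp: iso_iff pres_carrier inj_on_def)
  hence "pres_equiv S ?R (?pos us) (?pos vs)" using w by (simp add: pres_class_eq)
  from pres_equiv_invariants[OF this] show ?thesis using assms(4) by (simp add: comp_def)
qed

subsection \<open>Length and the exchange condition\<close>

abbreviation len where "len \<equiv> cox_length W S"

lemma len_le: "set ss \<subseteq> S \<Longrightarrow> len (ev ss) \<le> length ss"
  unfolding cox_length_def by (rule Least_le) (auto simp: is_decomposition_def ev_def)

lemma reduced_word:
  assumes "w \<in> carrier W" obtains ss where "set ss \<subseteq> S" "ev ss = w" "length ss = len w"
proof -
  obtain ss where "set ss \<subseteq> S" "ev ss = w" by (rule ev_surj[OF assms])
  hence "\<exists>k ss. is_decomposition W S w ss \<and> length ss = k" by (auto simp: is_decomposition_def ev_def)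
  from LeastI_ex[OF this] show ?thesis
    using that by (auto simp: cox_length_def is_decomposition_def ev_def)
qed

lemma len_one [simp]: "len \<one> = 0"
  using len_le[of "[]"] by simp

lemma len_zeroD: "w \<in> carrier W \<Longrightarrow> len w = 0 \<Longrightarrow> w = \<one>"
  by (erule reduced_word) auto

lemma len_inv [simp]: assumes "w \<in> carrier W" shows "len (inv w) = len w"
proof -
  have le: "len (inv v) \<le> len v" if v: "v \<in> carrier W" for v
  proof -
    obtain ss where ss: "set ss \<subseteq> S" "ev ss = v" "length ss = len v" by (rule reduced_word[OF v])
    thus ?thesis using len_le[of "rev ss"] by (simp add: ev_rev)
  qed
  from le[OF assms] le[of "inv w"] assms show ?thesis by simp
qed

lemma len_mult_le: assumes "v \<in> carrier W" "w \<in> carrier W" shows "len (v \<otimes> w) \<le> len v + len w"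
proof -
  obtain vs where vs: "set vs \<subseteq> S" "ev vs = v" "length vs = len v" by (rule reduced_word[OF assms(1)])
  obtain ws where ws: "set ws \<subseteq> S" "ev ws = w" "length ws = len w" by (rule reduced_word[OF assms(2)])
  show ?thesis using len_le[of "vs @ ws"] vs ws by (simp add: ev_append)
qed

lemma len_S: assumes "s \<in> S" shows "len s = 1"
proof -
  have "len s \<le> 1" using len_le[of "[s]"] assms by simp
  moreover have "len s \<noteq> 0" using len_zeroD[of s] S_not_one[OF assms] assms by auto
  ultimately show ?thesis by simp
qed

definition reflections :: "'a set"
  where "reflections = {g \<otimes> s \<otimes> inv g | g s. g \<in> carrier W \<and> s \<in> S}"

lemma S_reflections: "s \<in> S \<Longrightarrow> s \<in> reflections"
  unfolding reflections_def by (intro CollectI exI[of _ \<one>] exI[of _ s]) auto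

lemma reflections_closed [simp]: "t \<in> reflections \<Longrightarrow> t \<in> carrier W"
  by (auto simp: reflections_def)

lemma reflection_square: "t \<in> reflections \<Longrightarrow> t \<otimes> t = \<one>"
  by (auto simp: reflections_def m_assoc simp del: reflections_closed)

lemma crosses_conj:
  assumes "set w \<subseteq> S" "x \<in> S" "crosses w (ev w)"
  shows "crosses (x # w @ [x]) (ev (x # w @ [x]))"
proof -
  let ?y = "ev w"
  have y: "?y \<in> carrier W" using assms by simp
  have "ev (x # w @ [x]) = x \<otimes> ?y \<otimes> x" using assms by (simp add: ev_append m_assoc)
  moreover have "crosses (w @ [x]) ?y \<longleftrightarrow> ?y \<noteq> x"
    using assms y by (simp add: crosses_append)
  ultimately show ?thesis by (simp only: crosses.simps conj_S[OF assms(2) y]) auto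
qed

text \<open>Along a palindromic word for \<open>t\<close> the crossings of the wall of \<open>t\<close> pair off, except the one in the
  middle.\<close>

lemma crosses_self:
  assumes "t \<in> reflections" "set ps \<subseteq> S" "ev ps = t" shows "crosses ps t"
proof -
  obtain g s where gs: "t = g \<otimes> s \<otimes> inv g" "g \<in> carrier W" "s \<in> S"
    using assms(1) unfolding reflections_def by blast
  obtain vs where vs: "set vs \<subseteq> S" "ev vs = g" by (rule ev_surj[OF gs(2)])
  have "crosses (vs @ s # rev vs) (ev (vs @ s # rev vs)) \<and> set (vs @ s # rev vs) \<subseteq> S"
    using vs(1)
  proof (induction vs)
    case (Cons x vs)
    thus ?case using crosses_conj[of "vs @ s # rev vs" x] by (simp del: crosses.simps ev_simps)
  qed (use gs in simp)
  moreover have "ev (vs @ s # rev vs) = t" using vs gs by (simp add: ev_append ev_rev m_assoc)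
  ultimately show ?thesis
    using crosses_cong[OF assms(2), of "vs @ s # rev vs" t] assms vs gs by simp
qed

lemma crosses_delete:
  assumes "set ss \<subseteq> S" "t \<in> carrier W" "crosses ss t"
  obtains us s vs where "ss = us @ s # vs" "t \<otimes> ev ss = ev (us @ vs)"
  using assms
proof (induction ss arbitrary: t thesis)
  case (Cons s ss)
  show ?case
  proof (cases "t = s")
    case True
    thus ?thesis using Cons.prems(1)[of "[]" s ss] Cons.prems(2) by simp
  next
    case False
    hence "crosses ss (s \<otimes> t \<otimes> s)" using Cons.prems by simp
    then obtain us x vs where *: "ss = us @ x # vs" "(s \<otimes> t \<otimes> s) \<otimes> ev ss = ev (us @ vs)"
      using Cons.IH[of "s \<otimes> t \<otimes> s"] Cons.prems by auto
    have "t \<otimes> ev (s # ss) = s \<otimes> ((s \<otimes> t \<otimes> s) \<otimes> ev ss)" using Cons.prems by (simp add: m_assoc)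
    thus ?thesis using Cons.prems(1)[of "s # us" x vs] * by simp
  qed
qed simp

text \<open>The source of the strong exchange condition. If \<open>t\<close> is crossed, deleting a letter of a reduced
  word gives a word for the product with \<open>t\<close>. If not, then \<open>t\<close> is crossed on the way to that product,
  as \<open>t\<close> crosses its own wall, and the roles are exchanged.\<close>

lemma crosses_iff_shorter:
  assumes "t \<in> reflections" "set ss \<subseteq> S"
  shows "crosses ss t \<longleftrightarrow> len (t \<otimes> ev ss) < len (ev ss)" and "len (t \<otimes> ev ss) \<noteq> len (ev ss)"
proof -
  have shorter: "len (t \<otimes> ev us) < len (ev us)" if us: "set us \<subseteq> S" "crosses us t" for us
  proof -
    obtain rs where rs: "set rs \<subseteq> S" "ev rs = ev us" "length rs = len (ev us)"
      using reduced_word[of "ev us"] us by auto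
    hence "crosses rs t" using crosses_cong[of us rs t] us assms by simp
    then obtain xs x ys where "rs = xs @ x # ys" "t \<otimes> ev rs = ev (xs @ ys)"
      using crosses_delete[of rs t] rs assms by auto
    thus ?thesis using len_le[of "xs @ ys"] rs by simp
  qed
  obtain ps where ps: "set ps \<subseteq> S" "ev ps = t" using ev_surj[of t] assms by auto
  have "crosses (ps @ ss) t \<longleftrightarrow> \<not> crosses ss t"
    using crosses_self[OF assms(1) ps] ps assms by (simp add: crosses_append)
  hence longer: "len (ev ss) < len (t \<otimes> ev ss)" if "\<not> crosses ss t"
    using shorter[of "ps @ ss"] that ps assms reflection_square[OF assms(1)]
    by (simp add: ev_append flip: m_assoc)
  show "crosses ss t \<longleftrightarrow> len (t \<otimes> ev ss) < len (ev ss)" "len (t \<otimes> ev ss) \<noteq> len (ev ss)"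
    using shorter[OF assms(2)] longer by fastforce+
qed

lemma exchange:
  assumes "t \<in> reflections" "set ss \<subseteq> S" "len (t \<otimes> ev ss) < len (ev ss)"
  obtains us s vs where "ss = us @ s # vs" "t \<otimes> ev ss = ev (us @ vs)"
  using crosses_delete[of ss t] crosses_iff_shorter(1)[OF assms(1,2)] assms by auto

lemma exchange_right:
  assumes "t \<in> reflections" "set ss \<subseteq> S" "len (ev ss \<otimes> t) < len (ev ss)"
  obtains us s vs where "ss = us @ s # vs" "ev ss \<otimes> t = ev (us @ vs)"
proof -
  have t: "inv t = t" using reflection_square[OF assms(1)] assms(1) by (intro inv_equality) auto
  have e: "t \<otimes> ev (rev ss) = inv (ev ss \<otimes> t)" using assms t by (simp add: ev_rev inv_mult_group)
  have "len (t \<otimes> ev (rev ss)) < len (ev (rev ss))"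
    using assms unfolding e by (simp add: ev_rev)
  then obtain us s vs where *: "rev ss = us @ s # vs" "t \<otimes> ev (rev ss) = ev (us @ vs)"
    using exchange[OF assms(1), of "rev ss"] assms by auto
  have ss: "ss = rev vs @ s # rev us" using arg_cong[OF *(1), of rev] by simp
  have "inv (ev ss \<otimes> t) = ev (us @ vs)" using * e by simp
  hence "ev ss \<otimes> t = inv (ev (us @ vs))" using assms by (metis ev_closed inv_inv m_closed reflections_closed)
  also have "\<dots> = ev (rev vs @ rev us)" using assms(2) ss by (simp flip: ev_rev)
  finally show ?thesis using that ss by blast
qed

lemma len_refl_neq:
  assumes "t \<in> reflections" "w \<in> carrier W" shows "len (t \<otimes> w) \<noteq> len w" "len (w \<otimes> t) \<noteq> len w"
proof -
  have l: "len (t \<otimes> v) \<noteq> len v" if "v \<in> carrier W" for v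
    using crosses_iff_shorter(2)[OF assms(1)] ev_surj[OF that] by metis
  have t: "inv t = t" using reflection_square[OF assms(1)] assms(1) by (intro inv_equality) auto
  show "len (t \<otimes> w) \<noteq> len w" by (rule l) fact
  have "len (inv (w \<otimes> t)) \<noteq> len (inv w)" using l[of "inv w"] assms t by (simp add: inv_mult_group)
  thus "len (w \<otimes> t) \<noteq> len w" using assms by simp
qed

lemma len_S_mult:
  assumes "s \<in> S" "w \<in> carrier W"
  shows "len (s \<otimes> w) = Suc (len w) \<or> len w = Suc (len (s \<otimes> w))"
    and "len (w \<otimes> s) = Suc (len w) \<or> len w = Suc (len (w \<otimes> s))"
proof -
  have "len (s \<otimes> w) \<le> Suc (len w)" "len (w \<otimes> s) \<le> Suc (len w)"
    using len_mult_le[of s w] len_mult_le[of w s] assms len_S[of s] by simp_all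
  moreover have "len w \<le> Suc (len (s \<otimes> w))" "len w \<le> Suc (len (w \<otimes> s))"
    using len_mult_le[of s "s \<otimes> w"] len_mult_le[of "w \<otimes> s" s] assms len_S[of s] by (simp_all add: m_assoc)
  moreover note len_refl_neq[OF S_reflections[OF assms(1)] assms(2)]
  ultimately show "len (s \<otimes> w) = Suc (len w) \<or> len w = Suc (len (s \<otimes> w))"
    "len (w \<otimes> s) = Suc (len w) \<or> len w = Suc (len (w \<otimes> s))" by linarith+
qed

end

section \<open>Matsumoto's theorem\<close>

lemma alt_list_snoc:
  "alt_list (2 * n) s t @ [s] = alt_list (Suc (2 * n)) s t"
  "alt_list (Suc (2 * n)) s t @ [t] = alt_list (2 * Suc n) s t"
proof -
  have "alt_list m s t @ [if even m then s else t] = alt_list (Suc m) s t" for m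
    by (induction m s t rule: alt_list.induct) auto
  from this[of "2 * n"] this[of "Suc (2 * n)"]
  show "alt_list (2 * n) s t @ [s] = alt_list (Suc (2 * n)) s t"
    "alt_list (Suc (2 * n)) s t @ [t] = alt_list (2 * Suc n) s t" by simp_all
qed

lemma alt_list_append_rev: "alt_list m s t @ rev (alt_list m t s) = alt_list (2 * m) s t"
proof (induction m arbitrary: s t)
  case (Suc m)
  have "alt_list (Suc m) s t @ rev (alt_list (Suc m) t s) = s # (alt_list m t s @ rev (alt_list m s t)) @ [t]"
    by simp
  also have "\<dots> = s # (alt_list (2 * m) t s @ [t])" by (simp only: Suc.IH append_assoc)
  also have "\<dots> = s # alt_list (Suc (2 * m)) t s" by (simp only: alt_list_snoc)
  finally show ?case by simp
qed simp

lemma alt_list_palindrome: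
  "alt_list k s t = us @ x # vs \<Longrightarrow> us @ x # rev us = alt_list (Suc (2 * length us)) s t"
proof (induction us arbitrary: k s t)
  case Nil thus ?case by (cases k) auto
next
  case (Cons y us)
  then obtain k' where k: "k = Suc k'" "y = s" "alt_list k' t s = us @ x # vs" by (cases k) auto
  have "s # (us @ x # rev us) @ [s] = s # (alt_list (Suc (2 * length us)) t s @ [s])"
    by (simp only: Cons.IH[OF k(3)])
  also have "\<dots> = s # alt_list (2 * Suc (length us)) t s" by (simp only: alt_list_snoc)
  finally show ?case using k by simp
qed

lemma append_eq_split:
  assumes "xs @ ys = us @ x # vs"
  shows "(\<exists>vs'. xs = us @ x # vs' \<and> vs = vs' @ ys) \<or> (\<exists>us'. us = xs @ us' \<and> ys = us' @ x # vs)"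
  using assms by (auto simp: append_eq_append_conv2 Cons_eq_append_conv append_eq_Cons_conv)

context coxeter begin

definition reduced :: "'a list \<Rightarrow> bool"
  where "reduced ss \<longleftrightarrow> set ss \<subseteq> S \<and> length ss = len (ev ss)"

lemma reduced_Cons: assumes "reduced (s # ss)" shows "reduced ss"
proof -
  have "length ss \<le> len (ev ss)"
    using assms len_mult_le[of s "ev ss"] len_S[of s] by (simp add: reduced_def)
  thus ?thesis using assms len_le[of ss] by (simp add: reduced_def)
qed

lemma ev_alt_list_braid:
  assumes "s \<in> S" "t \<in> S" "m = ord (s \<otimes> t)" shows "ev (alt_list m s t) = ev (alt_list m t s)"
proof -
  have sub: "set (alt_list m s t) \<subseteq> S" "set (alt_list m t s) \<subseteq> S"
    using set_alt_list[of m s t] set_alt_list[of m t s] assms by auto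
  have "ev (alt_list m s t) \<otimes> inv (ev (alt_list m t s)) = ev (alt_list (2 * m) s t)"
    using sub by (simp add: ev_append ev_rev flip: alt_list_append_rev)
  also have "\<dots> = \<one>" using assms by (simp add: ev_alternating)
  finally have "inv (ev (alt_list m s t)) = inv (ev (alt_list m t s))"
    using sub by (intro inv_equality) (simp_all add: inv_comm)
  thus ?thesis using sub by (metis ev_closed inv_inv)
qed

text \<open>If both \<open>s\<close> and \<open>t\<close> shorten \<open>w\<close>, repeated exchange pulls longer and longer alternating
  words to the front of \<open>w\<close>; an exchange inside the alternating prefix would be a relation in the
  dihedral group that is too short.\<close>

lemma alternating_prefix:
  assumes "s \<in> S" "t \<in> S" "w \<in> carrier W" "len (s \<otimes> w) < len w" "len (t \<otimes> w) < len w"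
    and "ord (s \<otimes> t) = 0 \<or> k \<le> ord (s \<otimes> t)"
  shows "\<exists>r. reduced (alt_list k s t @ r) \<and> ev (alt_list k s t @ r) = w"
  using assms
proof (induction k arbitrary: s t)
  case 0
  thus ?case using reduced_word[of w] unfolding reduced_def by (metis alt_list.simps(1) append_Nil)
next
  case (Suc k)
  let ?a = "alt_list k t s"
  have "t \<otimes> s = inv (s \<otimes> t)" using Suc.prems by (simp add: inv_mult_group)
  hence "ord (t \<otimes> s) = ord (s \<otimes> t)" using Suc.prems by simp
  then obtain r where r: "reduced (?a @ r)" "ev (?a @ r) = w"
    using Suc.IH[of t s] Suc.prems by auto
  have a: "set ?a \<subseteq> S" and r_sub: "set r \<subseteq> S" using r by (auto simp: reduced_def)
  have ar: "set (?a @ r) \<subseteq> S" "len (s \<otimes> ev (?a @ r)) < len (ev (?a @ r))"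
    using a r_sub r(2) Suc.prems(4) by simp_all
  obtain us x vs where del: "?a @ r = us @ x # vs" "s \<otimes> ev (?a @ r) = ev (us @ vs)"
    by (rule exchange[OF S_reflections[OF Suc.prems(1)] ar])
  note del(2)[unfolded r(2)]
  note del = del(1) this
  have sub: "set us \<subseteq> S" "x \<in> S" "set vs \<subseteq> S" using a r_sub arg_cong[OF del(1), of set] by auto
  show ?case
  proof (cases "\<exists>vs'. ?a = us @ x # vs' \<and> vs = vs' @ r")
    case False
    then obtain us' where us: "us = ?a @ us'" "r = us' @ x # vs"
      using append_eq_split[OF del(1)] by blast
    have sub': "set (alt_list (Suc k) s t @ us' @ vs) \<subseteq> S" using us sub a Suc.prems by auto
    have "ev (alt_list (Suc k) s t @ us' @ vs) = s \<otimes> (s \<otimes> w)" using del us by simp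
    hence e: "ev (alt_list (Suc k) s t @ us' @ vs) = w" using Suc.prems by simp
    have "length (alt_list (Suc k) s t @ us' @ vs) = length (?a @ r)" using us by simp
    hence "reduced (alt_list (Suc k) s t @ us' @ vs)"
      using e sub' r unfolding reduced_def by simp
    thus ?thesis using e by blast
  next
    case True
    then obtain vs' where vs: "?a = us @ x # vs'" "vs = vs' @ r"
      by blast
    have sub': "set vs' \<subseteq> S" using vs sub by auto
    have "s \<otimes> (ev us \<otimes> (x \<otimes> (ev vs' \<otimes> ev r))) = ev us \<otimes> (ev vs' \<otimes> ev r)"
      using del(2) vs r(2) sub sub' r_sub by (simp add: ev_append m_assoc)
    hence "s \<otimes> (ev us \<otimes> x) = ev us"
      using sub sub' r_sub Suc.prems(1) by (simp flip: m_assoc)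
    hence "s \<otimes> (ev us \<otimes> x) \<otimes> inv (ev us) = \<one>" using sub by simp
    hence "ev (s # (us @ x # rev us)) = \<one>"
      using sub Suc.prems(1) by (simp add: ev_append ev_rev m_assoc)
    also have "s # (us @ x # rev us) = alt_list (2 * Suc (length us)) s t"
      unfolding alt_list_palindrome[OF vs(1)] by simp
    finally have "(s \<otimes> t) [^] Suc (length us) = \<one>"
      using ev_alternating[of s t "Suc (length us)"] Suc.prems(1,2) by simp
    hence "ord (s \<otimes> t) dvd Suc (length us)" using Suc.prems(1,2) pow_eq_id by blast
    hence "ord (s \<otimes> t) \<le> Suc (length us)" "ord (s \<otimes> t) \<noteq> 0"
      by (auto dest: dvd_imp_le) (metis dvd_0_left_iff nat.distinct(1) neq0_conv)
    moreover have "length us < k" using arg_cong[OF vs(1), of length] by simp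
    ultimately show ?thesis using Suc.prems(6) by simp
  qed
qed

definition braided :: "('a \<Rightarrow> 'r::monoid_mult) \<Rightarrow> bool"
  where "braided f \<longleftrightarrow> (\<forall>s\<in>S. \<forall>t\<in>S.
    prod_list (map f (alt_list (ord (s \<otimes> t)) s t)) = prod_list (map f (alt_list (ord (s \<otimes> t)) t s)))"

text \<open>Reduced words with different first letters \<open>s, t\<close> are compared with two words for the same element
  that begin with the two sides of the braid relation of \<open>s, t\<close>; the rest follows by induction from
  the case of equal first letters.\<close>

theorem matsumoto:
  assumes "braided f" "reduced us" "reduced vs" "ev us = ev vs"
  shows "prod_list (map f us) = prod_list (map f vs)"
  using assms(2-4)
proof (induction "length us" arbitrary: us vs)
  case 0
  hence "length vs = length us" unfolding reduced_def by metis
  thus ?case using 0 by simp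
next
  case (Suc n)
  let ?p = "\<lambda>ss. prod_list (map f ss)"
  have same_head: "?p (s # us') = ?p (s # vs')"
    if "reduced (s # us')" "reduced (s # vs')" "ev (s # us') = ev (s # vs')" "length us' = n" for s us' vs'
  proof -
    have "ev us' = ev vs'" using that by (auto simp: reduced_def)
    thus ?thesis using Suc.hyps(1)[of us' vs'] that reduced_Cons by auto
  qed
  have "length vs = length us" using Suc.prems by (simp add: reduced_def)
  then obtain s us' t vs' where us: "us = s # us'" "length us' = n" and vs: "vs = t # vs'" "length vs' = n"
    using Suc.hyps(2) by (metis Suc_length_conv)
  have st: "s \<in> S" "t \<in> S" "set us' \<subseteq> S" "set vs' \<subseteq> S" using Suc.prems us vs by (auto simp: reduced_def)
  show ?case
  proof (cases "s = t")
    case True thus ?thesis using same_head Suc.prems us vs by blast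
  next
    case False
    let ?w = "ev us"
    let ?m = "ord (s \<otimes> t)"
    have w: "?w \<in> carrier W" using Suc.prems by (simp add: reduced_def)
    have "s \<otimes> ev us = ev us'" "t \<otimes> ev vs = ev vs'" using us vs st by simp_all
    hence "s \<otimes> ?w = ev us'" "t \<otimes> ?w = ev vs'" using Suc.prems(3) by simp_all
    moreover have "len ?w = Suc n" using Suc.prems(1) us unfolding reduced_def by simp
    moreover have "len (ev us') \<le> n" "len (ev vs') \<le> n"
      using len_le[of us'] len_le[of vs'] st us vs by simp_all
    ultimately have desc: "len (s \<otimes> ?w) < len ?w" "len (t \<otimes> ?w) < len ?w" by simp_all
    have m0: "?m \<noteq> 0"
    proof
      assume "?m = 0"
      then obtain r where "reduced (alt_list (Suc (len ?w)) s t @ r)" "ev (alt_list (Suc (len ?w)) s t @ r) = ?w"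
        using alternating_prefix[OF st(1,2) w desc, of "Suc (len ?w)"] by auto
      hence "length (alt_list (Suc (len ?w)) s t @ r) = len ?w" unfolding reduced_def by simp
      thus False by simp
    qed
    obtain r where r: "reduced (alt_list ?m s t @ r)" "ev (alt_list ?m s t @ r) = ?w"
      using alternating_prefix[OF st(1,2) w desc, of ?m] by auto
    have sub: "set (alt_list ?m s t) \<subseteq> S" "set (alt_list ?m t s) \<subseteq> S" "set r \<subseteq> S"
      using set_alt_list[of ?m s t] set_alt_list[of ?m t s] st r by (auto simp: reduced_def)
    have r': "ev (alt_list ?m t s @ r) = ?w"
      using r(2) ev_alt_list_braid[OF st(1,2) HOL.refl] sub by (simp add: ev_append)
    hence "reduced (alt_list ?m t s @ r)" using r sub by (simp add: reduced_def)
    moreover obtain k where k: "?m = Suc k" using m0 not0_implies_Suc by blast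
    ultimately have "?p us = ?p (alt_list ?m s t @ r)" "?p vs = ?p (alt_list ?m t s @ r)"
      using same_head[of s us' "alt_list k t s @ r"] same_head[of t vs' "alt_list k s t @ r"]
        Suc.prems us vs r r' by auto
    moreover have "?p (alt_list ?m s t) = ?p (alt_list ?m t s)" using assms(1) st unfolding braided_def by blast
    ultimately show ?thesis by simp
  qed
qed

text \<open>The same choice of a reduced word as in \<open>canonical_section\<close>, so that an action of the braid group
  carries the one to the other literally.\<close>

definition tau :: "('a \<Rightarrow> 'r::monoid_mult) \<Rightarrow> 'a \<Rightarrow> 'r"
  where "tau f w = prod_list (map f (SOME ss. is_reduced_decomposition W S w ss))"

lemma is_reduced_decomposition_iff: "is_reduced_decomposition W S w ss \<longleftrightarrow> reduced ss \<and> ev ss = w"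
  by (auto simp: is_reduced_decomposition_def is_decomposition_def reduced_def ev_def)

lemma tau_reduced:
  assumes "braided f" "reduced ss" "ev ss = w" shows "tau f w = prod_list (map f ss)"
proof -
  let ?rs = "SOME ss. is_reduced_decomposition W S w ss"
  have "is_reduced_decomposition W S w ?rs"
    by (rule someI[of _ ss]) (use assms in \<open>simp add: is_reduced_decomposition_iff\<close>)
  hence "reduced ?rs" "ev ?rs = ev ss" using assms(3) unfolding is_reduced_decomposition_iff by simp_all
  from matsumoto[OF assms(1) this(1) assms(2) this(2)] show ?thesis unfolding tau_def .
qed

lemma reduced_word': assumes "w \<in> carrier W" obtains ss where "reduced ss" "ev ss = w"
  by (rule reduced_word[OF assms]) (use that in \<open>auto simp: reduced_def\<close>)

lemma tau_mult:
  assumes "braided f" "v \<in> carrier W" "w \<in> carrier W" "len (v \<otimes> w) = len v + len w"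
  shows "tau f (v \<otimes> w) = tau f v * tau f w"
proof -
  obtain vs where vs: "reduced vs" "ev vs = v" by (rule reduced_word'[OF assms(2)])
  obtain ws where ws: "reduced ws" "ev ws = w" by (rule reduced_word'[OF assms(3)])
  have "ev (vs @ ws) = v \<otimes> w" using vs ws by (simp add: reduced_def ev_append)
  moreover from this have "reduced (vs @ ws)" using vs ws assms(4) by (simp add: reduced_def)
  ultimately show ?thesis using tau_reduced[OF assms(1)] vs ws by (metis map_append prod_list.append)
qed

lemma tau_one: "braided f \<Longrightarrow> tau f \<one> = 1"
  using tau_reduced[of f "[]" \<one>] by (simp add: reduced_def)

lemma tau_S: "braided f \<Longrightarrow> s \<in> S \<Longrightarrow> tau f s = f s"
  using tau_reduced[of f "[s]" s] by (simp add: reduced_def len_S)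

section \<open>Parabolic subgroups\<close>

definition par :: "'a set \<Rightarrow> 'a set" where "par J = ev ` {ss. set ss \<subseteq> J}"

lemma par_I: "set ss \<subseteq> J \<Longrightarrow> ev ss \<in> par J"
  by (auto simp: par_def)

lemma par_one [simp]: "\<one> \<in> par J" using par_I[of "[]"] by simp

lemma par_mono: "J \<subseteq> I \<Longrightarrow> par J \<subseteq> par I"
  by (auto simp: par_def)

lemma par_S: "par S = carrier W"
  using ev_surj by (auto simp: par_def image_iff)

context
  fixes J assumes J: "J \<subseteq> S"
begin

lemma par_closed: "w \<in> par J \<Longrightarrow> w \<in> carrier W"
  using par_mono[OF J] par_S by blast

lemma par_gen: "s \<in> J \<Longrightarrow> s \<in> par J"
  using par_I[of "[s]" J] J by auto

lemma par_mult: "v \<in> par J \<Longrightarrow> w \<in> par J \<Longrightarrow> v \<otimes> w \<in> par J"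
  unfolding par_def
proof (elim imageE CollectE)
  fix us vs assume "set us \<subseteq> J" "set vs \<subseteq> J" "v = ev us" "w = ev vs"
  thus "v \<otimes> w \<in> ev ` {ss. set ss \<subseteq> J}"
    using J by (intro image_eqI[of _ _ "us @ vs"]) (auto simp: ev_append)
qed

lemma par_inv: "w \<in> par J \<Longrightarrow> inv w \<in> par J"
  unfolding par_def
proof (elim imageE CollectE)
  fix us assume "set us \<subseteq> J" "w = ev us"
  thus "inv w \<in> ev ` {ss. set ss \<subseteq> J}"
    using J by (intro image_eqI[of _ _ "rev us"]) (auto simp: ev_rev)
qed

text \<open>Letters are only deleted by exchanges, so the reduced word stays in \<open>J\<close>.\<close>

lemma par_reduced: assumes "w \<in> par J" obtains ss where "set ss \<subseteq> J" "reduced ss" "ev ss = w"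
proof -
  have "\<exists>rs. set rs \<subseteq> J \<and> reduced rs \<and> ev rs = ev ss" if "set ss \<subseteq> J" for ss
    using that
  proof (induction ss)
    case Nil
    show ?case by (rule exI[of _ "[]"]) (simp add: reduced_def)
  next
    case (Cons s ss)
    then obtain rs where rs: "set rs \<subseteq> J" "reduced rs" "ev rs = ev ss" by auto
    have s: "s \<in> S" and e: "ev rs \<in> carrier W" using Cons.prems J rs by auto
    from len_S_mult(1)[OF s e] show ?case
    proof
      assume "len (s \<otimes> ev rs) = Suc (len (ev rs))"
      thus ?case using rs Cons.prems J by (intro exI[of _ "s # rs"]) (auto simp: reduced_def)
    next
      assume l: "len (ev rs) = Suc (len (s \<otimes> ev rs))"
      have pre: "set rs \<subseteq> S" "len (s \<otimes> ev rs) < len (ev rs)" using rs J l by auto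
      obtain us x vs where *: "rs = us @ x # vs" "s \<otimes> ev rs = ev (us @ vs)"
        by (rule exchange[OF S_reflections[OF s] pre])
      have "reduced (us @ vs)" using * l rs by (auto simp: reduced_def)
      thus ?case using * rs by (intro exI[of _ "us @ vs"]) auto
    qed
  qed
  thus ?thesis using assms that by (auto simp: par_def)
qed

lemma par_snoc:
  assumes "u \<in> par J" "u \<noteq> \<one>"
  obtains u' s where "u' \<in> par J" "s \<in> J" "u = u' \<otimes> s" "len u = Suc (len u')"
proof -
  obtain ss where ss: "set ss \<subseteq> J" "reduced ss" "ev ss = u" by (rule par_reduced[OF assms(1)])
  with assms(2) have "ss \<noteq> []" by auto
  then obtain us s where us: "ss = us @ [s]" by (metis rev_exhaust)
  have sub: "s \<in> S" "set us \<subseteq> S" using ss us J by auto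
  have e: "u = ev us \<otimes> s" using ss us sub by (simp add: ev_append)
  have "len (ev us) \<le> length us" "length us + 1 = len u" using len_le sub ss us by (auto simp: reduced_def)
  moreover have "len u \<le> Suc (len (ev us))" using len_mult_le[of "ev us" s] len_S sub e by simp
  ultimately show ?thesis using that[of "ev us" s] par_I ss us e by auto
qed

lemma par_induct [consumes 1, case_names one snoc]:
  assumes "u \<in> par J" "P \<one>"
    and "\<And>u s. u \<in> par J \<Longrightarrow> s \<in> J \<Longrightarrow> len (u \<otimes> s) = Suc (len u) \<Longrightarrow> P u \<Longrightarrow> P (u \<otimes> s)"
  shows "P u"
  using assms(1)
proof (induction "len u" arbitrary: u)
  case 0
  thus ?case using len_zeroD par_closed assms(2) by metis
next
  case (Suc n)
  hence "u \<noteq> \<one>" by auto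
  then obtain u' s where *: "u' \<in> par J" "s \<in> J" "u = u' \<otimes> s" "len u = Suc (len u')"
    by (rule par_snoc[OF Suc.prems])
  thus ?case using assms(3)[of u' s] Suc.hyps by simp
qed

text \<open>Multiplying an element that is shortest in its coset by \<open>W\<^sub>J\<close> adds lengths: an exchange
  could delete a letter of the coset representative only by producing a shorter one.\<close>

lemma len_min_coset:
  assumes "g \<in> carrier W" "\<And>u. u \<in> par J \<Longrightarrow> len g \<le> len (g \<otimes> u)" "u \<in> par J"
  shows "len (g \<otimes> u) = len g + len u"
  using assms(3)
proof (induction u rule: par_induct)
  case (snoc u s)
  have c: "u \<in> carrier W" "s \<in> carrier W" "s \<in> S" using snoc par_closed J by auto
  from len_S_mult(2)[OF c(3), of "g \<otimes> u"] assms(1) c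
  consider "len (g \<otimes> (u \<otimes> s)) = Suc (len (g \<otimes> u))" | "len (g \<otimes> u) = Suc (len (g \<otimes> (u \<otimes> s)))"
    by (auto simp: m_assoc)
  thus ?case
  proof cases
    case 2
    obtain gs where gs: "reduced gs" "ev gs = g" by (rule reduced_word'[OF assms(1)])
    obtain ss where ss: "set ss \<subseteq> J" "reduced ss" "ev ss = u" by (rule par_reduced[OF snoc(1)])
    have sub: "set gs \<subseteq> S" "set ss \<subseteq> S" using gs ss by (auto simp: reduced_def)
    have e: "ev (gs @ ss) = g \<otimes> u" using gs ss sub by (simp add: ev_append)
    have pre: "set (gs @ ss) \<subseteq> S" "len (ev (gs @ ss) \<otimes> s) < len (ev (gs @ ss))"
      using sub 2 assms(1) c by (simp_all add: e m_assoc)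
    obtain xs x ys where del: "gs @ ss = xs @ x # ys" "ev (gs @ ss) \<otimes> s = ev (xs @ ys)"
      by (rule exchange_right[OF S_reflections[OF c(3)] pre])
    note del(2)[unfolded e]
    note del = del(1) this
    have sub': "set xs \<subseteq> S" "x \<in> S" "set ys \<subseteq> S" using sub arg_cong[OF del(1), of set] by auto
    show ?thesis
    proof (cases "\<exists>ys'. gs = xs @ x # ys' \<and> ys = ys' @ ss")
      case True
      then obtain ys' where ys: "gs = xs @ x # ys'" "ys = ys' @ ss"
        by blast
      have sub'': "set ys' \<subseteq> S" using ys sub by auto
      have "ev (xs @ ys') = ev (xs @ ys) \<otimes> inv u"
        using ys ss sub' sub'' c by (simp add: ev_append m_assoc)
      also have "\<dots> = g \<otimes> (u \<otimes> s \<otimes> inv u)" using del(2) assms(1) c by (simp add: m_assoc flip: del(2))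
      finally have "len g \<le> len (ev (xs @ ys'))"
        using assms(2)[of "u \<otimes> s \<otimes> inv u"] snoc par_mult par_inv par_gen by simp
      also have "\<dots> \<le> length (xs @ ys')" using len_le[of "xs @ ys'"] sub' sub'' by simp
      finally show ?thesis using gs ys by (simp add: reduced_def)
    next
      case False
      then obtain xs' where xs: "xs = gs @ xs'" "ss = xs' @ x # ys"
        using append_eq_split[OF del(1)] by blast
      have "set xs' \<subseteq> S" using xs sub' by auto
      hence "g \<otimes> (u \<otimes> s) = g \<otimes> ev (xs' @ ys)"
        using del(2) xs gs sub' sub c assms(1) by (simp add: ev_append m_assoc)
      hence "u \<otimes> s = ev (xs' @ ys)" using assms(1) c \<open>set xs' \<subseteq> S\<close> sub' by simp
      hence "len (u \<otimes> s) \<le> length (xs' @ ys)" using len_le[of "xs' @ ys"] \<open>set xs' \<subseteq> S\<close> sub' by simp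
      also have "\<dots> < len u" using xs ss by (simp add: reduced_def)
      finally show ?thesis using snoc by simp
    qed
  qed (use snoc in simp)
qed (use assms in simp)

end

definition min_coset :: "'a set \<Rightarrow> 'a set \<Rightarrow> 'a set"
  where "min_coset I J = {g \<in> par I. \<forall>u\<in>par J. len g \<le> len (g \<otimes> u)}"

lemma len_min_coset':
  "J \<subseteq> I \<Longrightarrow> I \<subseteq> S \<Longrightarrow> g \<in> min_coset I J \<Longrightarrow> u \<in> par J \<Longrightarrow> len (g \<otimes> u) = len g + len u"
  by (rule len_min_coset) (auto simp: min_coset_def dest: par_closed)

lemma min_coset_decompose:
  assumes "J \<subseteq> I" "I \<subseteq> S" "w \<in> par I"
  obtains g u where "g \<in> min_coset I J" "u \<in> par J" "w = g \<otimes> u"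
proof -
  have JS: "J \<subseteq> S" using assms by blast
  obtain v where v: "v \<in> par J" "\<And>u. u \<in> par J \<Longrightarrow> len (w \<otimes> v) \<le> len (w \<otimes> u)"
    using ex_has_least_nat[of "\<lambda>v. v \<in> par J" \<one> "\<lambda>v. len (w \<otimes> v)"] by auto
  have c: "v \<in> carrier W" "w \<in> carrier W" using par_closed[OF JS v(1)] par_closed[OF assms(2,3)] by auto
  have "w \<otimes> v \<in> min_coset I J"
    using v assms par_mult[OF assms(2)] par_mono[OF assms(1)] par_mult[OF JS] par_closed[OF JS] c
    by (auto simp: min_coset_def m_assoc)
  moreover have "w = w \<otimes> v \<otimes> inv v" using c by (simp add: m_assoc)
  ultimately show ?thesis using that par_inv[OF JS v(1)] by blast
qed

lemma bij_betw_min_coset: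
  assumes "J \<subseteq> I" "I \<subseteq> S"
  shows "bij_betw (\<lambda>(g, u). g \<otimes> u) (min_coset I J \<times> par J) (par I)"
  unfolding bij_betw_def
proof
  have JS: "J \<subseteq> S" using assms by blast
  have "g = g' \<and> u = u'"
    if "g \<in> min_coset I J" "g' \<in> min_coset I J" "u \<in> par J" "u' \<in> par J" "g \<otimes> u = g' \<otimes> u'" for g g' u u'
  proof -
    have c: "g \<in> carrier W" "g' \<in> carrier W" "u \<in> carrier W" "u' \<in> carrier W"
      using that par_closed[OF JS] par_closed[OF assms(2)] by (auto simp: min_coset_def)
    let ?v = "u \<otimes> inv u'"
    have v: "?v \<in> par J" using that par_mult[OF JS] par_inv[OF JS] by blast
    have g': "g' = g \<otimes> ?v" using c that(5) by (metis inv_closed inv_solve_right m_assoc m_closed)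
    have "len g' \<le> len (g' \<otimes> inv ?v)" using that(2) par_inv[OF JS v] by (auto simp: min_coset_def)
    also have "g' \<otimes> inv ?v = g" unfolding g' using c by (simp add: m_assoc)
    finally have "len ?v = 0" using len_min_coset'[OF assms that(1) v] g' by simp
    hence "?v = \<one>" using len_zeroD v par_closed[OF JS] by blast
    hence "g = g'" using g' c by simp
    thus ?thesis using c that(5) by simp
  qed
  thus "inj_on (\<lambda>(g, u). g \<otimes> u) (min_coset I J \<times> par J)" by (auto simp: inj_on_def)
  show "(\<lambda>(g, u). g \<otimes> u) ` (min_coset I J \<times> par J) = par I"
  proof
    show "(\<lambda>(g, u). g \<otimes> u) ` (min_coset I J \<times> par J) \<subseteq> par I"
      using par_mult[OF assms(2)] par_mono[OF assms(1)] by (auto simp: min_coset_def)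
    show "par I \<subseteq> (\<lambda>(g, u). g \<otimes> u) ` (min_coset I J \<times> par J)"
    proof
      fix w assume "w \<in> par I"
      then obtain g u where "g \<in> min_coset I J" "u \<in> par J" "w = g \<otimes> u"
        by (rule min_coset_decompose[OF assms])
      thus "w \<in> (\<lambda>(g, u). g \<otimes> u) ` (min_coset I J \<times> par J)" by force
    qed
  qed
qed

text \<open>If \<open>g\<close> is not shortest in its coset, it is \<open>h u\<close> with \<open>h\<close> shortest and \<open>u \<noteq> 1\<close>, and the last letter
  of a reduced word for \<open>u\<close> shortens \<open>g\<close>.\<close>

lemma min_coset_iff:
  assumes "J \<subseteq> I" "I \<subseteq> S" "g \<in> par I"
  shows "g \<in> min_coset I J \<longleftrightarrow> (\<forall>s\<in>J. len g < len (g \<otimes> s))"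
proof
  have JS: "J \<subseteq> S" using assms by blast
  assume g: "g \<in> min_coset I J"
  show "\<forall>s\<in>J. len g < len (g \<otimes> s)"
    using len_min_coset'[OF assms(1,2) g] par_gen[OF JS] len_S JS by fastforce
next
  have JS: "J \<subseteq> S" using assms by blast
  assume asc: "\<forall>s\<in>J. len g < len (g \<otimes> s)"
  obtain h u where hu: "h \<in> min_coset I J" "u \<in> par J" "g = h \<otimes> u"
    by (rule min_coset_decompose[OF assms])
  have "u = \<one>"
  proof (rule ccontr)
    assume "u \<noteq> \<one>"
    then obtain u' s where *: "u' \<in> par J" "s \<in> J" "u = u' \<otimes> s" "len u = Suc (len u')"
      by (rule par_snoc[OF JS hu(2)])
    have c: "h \<in> carrier W" "u' \<in> carrier W" "s \<in> S"
      using hu * JS par_closed[OF JS] par_closed[OF assms(2)] by (auto simp: min_coset_def)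
    have "g \<otimes> s = h \<otimes> u'" using c * hu by (simp add: m_assoc)
    hence "len (g \<otimes> s) < len g" using len_min_coset'[OF assms(1,2) hu(1)] * hu by simp
    thus False using asc * by force
  qed
  thus "g \<in> min_coset I J" using hu par_closed[OF assms(2)] by (auto simp: min_coset_def)
qed

section \<open>The longest element\<close>

definition longest :: "'a set \<Rightarrow> 'a \<Rightarrow> bool"
  where "longest I w \<longleftrightarrow> w \<in> par I \<and> (\<forall>u\<in>par I. len u \<le> len w)"

lemma longest_ex: assumes "finite (par I)" obtains w where "longest I w"
proof -
  have "par I \<noteq> {}" using par_one by blast
  hence "Max (len ` par I) \<in> len ` par I" using assms by (intro Max_in) auto
  then obtain w where "w \<in> par I" "len w = Max (len ` par I)" by auto
  moreover from this have "len u \<le> len w" if "u \<in> par I" for u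
    using Max_ge[of "len ` par I" "len u"] that assms by simp
  ultimately show ?thesis using that unfolding longest_def by blast
qed

context
  fixes I w0 assumes I: "I \<subseteq> S" and w0: "longest I w0"
begin

lemma w0_par: "w0 \<in> par I" and w0_closed: "w0 \<in> carrier W"
  using w0 par_closed[OF I] by (auto simp: longest_def)

text \<open>Every reflection of \<open>W\<^sub>I\<close> shortens the longest element, so the exchange condition applies to
  all of them and strips any reduced word off the right end of \<open>w\<^sub>0\<close>.\<close>

lemma len_longest_mult: assumes "x \<in> par I" shows "len (w0 \<otimes> x) + len x = len w0"
  using assms
proof (induction x rule: par_induct[OF I, consumes 1, case_names one snoc])
  case (snoc x s)
  have c: "x \<in> carrier W" "s \<in> S" "w0 \<in> carrier W" using snoc par_closed[OF I] I w0_closed by auto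
  let ?y = "w0 \<otimes> x"
  have y: "?y \<in> carrier W" using c by simp
  from len_S_mult(2)[OF c(2) y]
  consider "len (?y \<otimes> s) = Suc (len ?y)" | "len ?y = Suc (len (?y \<otimes> s))" by blast
  thus ?case
  proof cases
    case 1
    obtain ys where ys: "reduced ys" "ev ys = ?y" by (rule reduced_word'[OF y])
    obtain xs where xs: "set xs \<subseteq> I" "reduced xs" "ev xs = x" by (rule par_reduced[OF I snoc(1)])
    have sub: "set ys \<subseteq> S" "set xs \<subseteq> S" using ys xs by (auto simp: reduced_def)
    let ?t = "x \<otimes> s \<otimes> inv x"
    have t: "?t \<in> reflections" using c unfolding reflections_def by blast
    have e: "ev (ys @ rev xs) = w0" using ys xs sub c by (simp add: ev_append ev_rev m_assoc)
    have "w0 \<otimes> ?t \<in> par I" using snoc par_mult[OF I] par_inv[OF I] par_gen[OF I] w0_par by simp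
    hence "len (w0 \<otimes> ?t) < len w0"
      using w0 len_refl_neq(2)[OF t c(3)] by (auto simp: longest_def order_less_le)
    hence pre: "set (ys @ rev xs) \<subseteq> S" "len (ev (ys @ rev xs) \<otimes> ?t) < len (ev (ys @ rev xs))"
      unfolding e using sub by simp_all
    obtain us z vs where del: "ys @ rev xs = us @ z # vs" "ev (ys @ rev xs) \<otimes> ?t = ev (us @ vs)"
      by (rule exchange_right[OF t pre])
    note del(2)[unfolded e]
    note del = del(1) this
    have sub': "set us \<subseteq> S" "set vs \<subseteq> S" using sub arg_cong[OF del(1), of set] by auto
    have wt: "w0 \<otimes> ?t = ?y \<otimes> s \<otimes> inv x" using c by (simp add: m_assoc)
    show ?thesis
    proof (cases "\<exists>vs'. ys = us @ z # vs' \<and> vs = vs' @ rev xs")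
      case True
      then obtain vs' where vs: "ys = us @ z # vs'" "vs = vs' @ rev xs"
        by blast
      have sub'': "set vs' \<subseteq> S" using vs sub by auto
      have "?y \<otimes> s \<otimes> inv x = ev (us @ vs') \<otimes> inv x"
        using del(2) vs xs sub sub' sub'' c(1) by (simp add: wt ev_append ev_rev m_assoc)
      hence "?y \<otimes> s = ev (us @ vs')" using c y sub' sub'' by simp
      hence "len (?y \<otimes> s) \<le> length (us @ vs')" using len_le[of "us @ vs'"] sub' sub'' by simp
      thus ?thesis using 1 vs ys by (simp add: reduced_def)
    next
      case False
      then obtain us' where us: "us = ys @ us'" "rev xs = us' @ z # vs"
        using append_eq_split[OF del(1)] by blast
      have sub'': "set us' \<subseteq> S" using us sub' by auto
      have "?y \<otimes> (s \<otimes> inv x) = ?y \<otimes> ev (us' @ vs)"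
        using del(2) us ys sub sub' sub'' c y by (simp add: wt ev_append m_assoc)
      hence "s \<otimes> inv x = ev (us' @ vs)" using c y sub' sub'' by simp
      moreover have "s \<otimes> inv x = inv (x \<otimes> s)" using c by (simp add: inv_mult_group)
      ultimately have "len (x \<otimes> s) = len (ev (us' @ vs))" using c by (metis S_closed len_inv m_closed)
      also have "\<dots> \<le> length (us' @ vs)" using len_le[of "us' @ vs"] sub' sub'' by simp
      also have "\<dots> < length (rev xs)" using us by simp
      finally show ?thesis using snoc xs by (simp add: reduced_def)
    qed
  next
    case 2 thus ?thesis using snoc c by (simp add: m_assoc)
  qed
qed (use w0_closed in simp)

lemma longest_unique: assumes "longest I w" shows "w = w0"
proof -
  have w: "w \<in> par I" "len w = len w0" using assms w0 by (auto simp: longest_def intro: antisym)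
  have c: "w \<in> carrier W" using w par_closed[OF I] by blast
  have "len (w0 \<otimes> inv w) = 0" using len_longest_mult[OF par_inv[OF I w(1)]] w c by simp
  hence "w0 \<otimes> inv w = \<one>" using len_zeroD c w0_closed by simp
  thus ?thesis using c w0_closed by (metis inv_closed inv_equality inv_inv)
qed

lemma longest_square: "w0 \<otimes> w0 = \<one>"
proof -
  have "longest I (inv w0)" using w0 w0_closed par_inv[OF I] by (auto simp: longest_def)
  hence "inv w0 = w0" by (rule longest_unique)
  thus ?thesis using w0_closed by (metis r_inv)
qed

lemma longest_descent: assumes "s \<in> I" shows "len w0 = Suc (len (w0 \<otimes> s))" "len w0 = Suc (len (s \<otimes> w0))"
proof -
  have s: "s \<in> S" using assms I by blast
  show *: "len w0 = Suc (len (w0 \<otimes> s))" using len_longest_mult[OF par_gen[OF I assms]] len_S[OF s] by simp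
  have "inv w0 = w0" using longest_square w0_closed by (simp add: inv_equality)
  hence "inv (w0 \<otimes> s) = s \<otimes> w0" using s w0_closed by (simp add: inv_mult_group)
  thus "len w0 = Suc (len (s \<otimes> w0))" using * s w0_closed by (metis S_closed len_inv m_closed)
qed

text \<open>Write \<open>w = w\<^sub>0 v\<close>. The length of \<open>w\<^sub>0 v\<close> decreases as that of \<open>v\<close> grows, so the last letter of a
  reduced word for \<open>v \<noteq> 1\<close> would lengthen \<open>w\<close>.\<close>

lemma all_descents_imp_longest:
  assumes "w \<in> par I" "\<And>s. s \<in> I \<Longrightarrow> len (w \<otimes> s) < len w" shows "w = w0"
proof -
  have c: "w \<in> carrier W" using assms par_closed[OF I] by blast
  let ?v = "w0 \<otimes> w"
  have v: "?v \<in> par I" by (rule par_mult[OF I w0_par assms(1)])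
  have w: "w0 \<otimes> ?v = w"
    using m_assoc[OF w0_closed w0_closed c] longest_square c by simp
  have "?v = \<one>"
  proof (rule ccontr)
    assume "?v \<noteq> \<one>"
    then obtain u s where *: "u \<in> par I" "s \<in> I" "?v = u \<otimes> s" "len ?v = Suc (len u)"
      by (rule par_snoc[OF I v])
    have c': "u \<in> carrier W" "s \<in> S" using * I par_closed[OF I] by auto
    have "w \<otimes> s = w0 \<otimes> (?v \<otimes> s)"
      using m_assoc[OF w0_closed par_closed[OF I v] S_closed[OF c'(2)]] unfolding w .
    also have "?v \<otimes> s = u" unfolding *(3) using c' by (simp add: m_assoc)
    finally have "len (w \<otimes> s) + len u = len w0" using len_longest_mult[OF *(1)] by simp
    moreover have "len w + len ?v = len w0" using len_longest_mult[OF v] w by simp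
    ultimately show False using assms(2)[OF *(2)] *(4) by simp
  qed
  thus ?thesis using w w0_closed by simp
qed

text \<open>Conjugation by \<open>w\<^sub>0\<close> permutes the generators in \<open>I\<close>, and \<open>\<tau>(w\<^sub>0)\<close> lifts this involution.\<close>

lemma tau_longest_square_commute:
  assumes "braided f" "s \<in> I"
  shows "(tau f w0 * tau f w0) * f s = f s * (tau f w0 * tau f w0)"
proof -
  have inv: "inv w0 = w0" using longest_square w0_closed by (simp add: inv_equality)
  have conj: "tau f w0 * f s = f (w0 \<otimes> s \<otimes> w0) * tau f w0 \<and> w0 \<otimes> s \<otimes> w0 \<in> I" if s: "s \<in> I" for s
  proof -
    let ?s' = "w0 \<otimes> s \<otimes> w0"
    have c: "s \<in> S" "w0 \<in> carrier W" using s I w0_closed by auto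
    have p: "s \<otimes> w0 \<in> par I" by (intro par_mult[OF I] par_gen[OF I] s w0_par)
    have "len (w0 \<otimes> (s \<otimes> w0)) + len (s \<otimes> w0) = len w0" by (rule len_longest_mult[OF p])
    hence l: "len ?s' = 1" using longest_descent(2)[OF s] c by (simp add: m_assoc)
    have "?s' \<in> par I" using par_mult[OF I w0_par p] c by (simp add: m_assoc)
    then obtain ss where ss: "set ss \<subseteq> I" "reduced ss" "ev ss = ?s'" by (rule par_reduced[OF I])
    with l obtain x where x: "ss = [x]" by (auto simp: reduced_def length_Suc_conv)
    have "x \<in> I" "x = ?s'" using ss I unfolding x by auto
    hence s'I: "?s' \<in> I" by simp
    hence s': "?s' \<in> S" using I by blast
    have e1: "(w0 \<otimes> s) \<otimes> s = w0" using c by (simp add: m_assoc)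
    have e2: "?s' \<otimes> (w0 \<otimes> s) = w0"
    proof -
      have "?s' \<otimes> (w0 \<otimes> s) = w0 \<otimes> s \<otimes> (w0 \<otimes> w0) \<otimes> s" using c by (simp add: m_assoc)
      thus ?thesis using c by (simp only: longest_square) (simp add: m_assoc)
    qed
    have t1: "tau f w0 = tau f (w0 \<otimes> s) * f s"
      using tau_mult[OF assms(1), of "w0 \<otimes> s" s] longest_descent(1)[OF s] len_S c tau_S[OF assms(1)]
      by (simp add: e1)
    have t2: "tau f w0 = f ?s' * tau f (w0 \<otimes> s)"
      using tau_mult[OF assms(1), of ?s' "w0 \<otimes> s"] longest_descent(1)[OF s] len_S[OF s'] c s' tau_S[OF assms(1) s']
      by (simp add: e2)
    have "tau f w0 * f s = f ?s' * (tau f (w0 \<otimes> s) * f s)" by (simp only: t2 mult.assoc)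
    thus ?thesis using s'I by (simp only: t1[symmetric])
  qed
  let ?s' = "w0 \<otimes> s \<otimes> w0"
  have c: "s \<in> carrier W" using I assms(2) by blast
  have "w0 \<otimes> ?s' \<otimes> w0 = (w0 \<otimes> w0) \<otimes> s \<otimes> (w0 \<otimes> w0)"
    using w0_closed c by (simp add: m_assoc)
  also have "\<dots> = s" using longest_square c by simp
  finally have "tau f w0 * f ?s' = f s * tau f w0" using conj[of ?s'] conj[OF assms(2)] by simp
  hence "tau f w0 * (tau f w0 * f s) = f s * tau f w0 * tau f w0"
    using conj[OF assms(2)] by (simp flip: mult.assoc)
  thus ?thesis by (simp only: mult.assoc)
qed

end

end

context coxeter begin

section \<open>Solomon's identity\<close>

text \<open>The coefficient of \<open>g\<close> is an alternating sum over all sets \<open>J\<close> of right ascents of \<open>g\<close>. It vanishes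
  unless \<open>g\<close> has no right ascent, that is, unless \<open>g\<close> is the longest element.\<close>

lemma solomon_coefficients:
  assumes "I \<subseteq> S" "finite I" "longest I w0" "g \<in> par I"
  shows "(\<Sum>J\<in>Pow I. (- 1) ^ card J * of_bool (g \<in> min_coset I J)) = (of_bool (g = w0) :: 'r::comm_ring_1)"
proof -
  let ?A = "{s \<in> I. len g < len (g \<otimes> s)}"
  have A: "finite ?A" using assms by simp
  have "(\<Sum>J\<in>Pow I. (- 1) ^ card J * of_bool (g \<in> min_coset I J)) = (\<Sum>J\<in>Pow ?A. (- 1) ^ card J :: 'r)"
  proof (rule sum.mono_neutral_cong_right)
    show "\<forall>J\<in>Pow I - Pow ?A. (- 1) ^ card J * of_bool (g \<in> min_coset I J) = (0 :: 'r)"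
      using min_coset_iff[OF _ assms(1,4)] by auto
    fix J assume "J \<in> Pow ?A"
    hence "g \<in> min_coset I J" using min_coset_iff[OF _ assms(1,4), of J] by auto
    thus "(- 1) ^ card J * of_bool (g \<in> min_coset I J) = ((- 1) ^ card J :: 'r)" by simp
  qed (use assms in auto)
  also have "\<dots> = (\<Prod>s\<in>?A. 1 - 1)" by (subst prod_diff_conv_sum[OF A]) simp
  also have "\<dots> = of_bool (?A = {})"
  proof (cases "?A = {}")
    case True thus ?thesis by (simp only: prod.empty of_bool_eq simp_thms)
  next
    case False
    hence "card ?A \<noteq> 0" using A by simp
    thus ?thesis unfolding of_bool_eq_0_iff[THEN iffD2, OF False] by (simp add: power_0_left)
  qed
  also have "?A = {} \<longleftrightarrow> g = w0"
  proof
    assume "?A = {}"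
    hence "\<not> len g < len (g \<otimes> s)" if "s \<in> I" for s using that by blast
    moreover have "len (g \<otimes> s) \<noteq> len g" if "s \<in> I" for s
      using len_refl_neq(2)[OF S_reflections] that assms par_closed[OF assms(1)] by blast
    ultimately show "g = w0"
      by (intro all_descents_imp_longest[OF assms(1,3,4)]) (meson linorder_neqE_nat)
  next
    assume "g = w0"
    thus "?A = {}" using longest_descent(1)[OF assms(1,3)] by fastforce
  qed
  finally show ?thesis .
qed

lemma min_coset_self: assumes "I \<subseteq> S" shows "min_coset I I = {\<one>}"
proof
  show "min_coset I I \<subseteq> {\<one>}"
  proof
    fix g assume g: "g \<in> min_coset I I"
    hence "g \<in> par I" by (simp add: min_coset_def)
    hence c: "g \<in> carrier W" and "inv g \<in> par I" using par_closed par_inv assms by blast+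
    hence "len g \<le> len (g \<otimes> inv g)" using g by (auto simp: min_coset_def)
    thus "g \<in> {\<one>}" using c len_zeroD by simp
  qed
qed (simp add: min_coset_def)

section \<open>Finiteness in type A\<close>

text \<open>The products of elements of \<open>W\<^sub>J\<close> and \<open>R\<close> contain \<open>1\<close> and are stable under the generators.\<close>

lemma finite_par_step:
  assumes "J \<subseteq> S" "I \<subseteq> S" "finite (par J)" "finite R" "R \<subseteq> carrier W" "\<one> \<in> R"
    and "\<And>r s. r \<in> R \<Longrightarrow> s \<in> I \<Longrightarrow> \<exists>u\<in>par J. \<exists>r'\<in>R. r \<otimes> s = u \<otimes> r'"
  shows "finite (par I)"
proof (rule finite_subset)
  show "par I \<subseteq> (\<lambda>(u, r). u \<otimes> r) ` (par J \<times> R)"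
  proof
    fix w assume "w \<in> par I"
    thus "w \<in> (\<lambda>(u, r). u \<otimes> r) ` (par J \<times> R)"
    proof (induction w rule: par_induct[OF assms(2), consumes 1, case_names one snoc])
      case one
      show ?case using assms(6) by (intro image_eqI[of _ _ "(\<one>, \<one>)"]) auto
    next
      case (snoc w s)
      then obtain u r where ur: "u \<in> par J" "r \<in> R" "w = u \<otimes> r" by auto
      obtain u' r' where ur': "u' \<in> par J" "r' \<in> R" "r \<otimes> s = u' \<otimes> r'" using assms(7) ur snoc by blast
      have c: "u \<in> carrier W" "r \<in> carrier W" "s \<in> carrier W" "u' \<in> carrier W" "r' \<in> carrier W"
        using ur ur' assms par_closed[OF assms(1)] snoc by auto
      have "w \<otimes> s = u \<otimes> (r \<otimes> s)" using c ur by (simp add: m_assoc)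
      also have "\<dots> = (u \<otimes> u') \<otimes> r'" using c by (simp add: ur'(3) m_assoc)
      finally show ?case using par_mult[OF assms(1) ur(1) ur'(1)] ur' by force
    qed
  qed
qed (use assms in simp)

text \<open>In type \<open>A\<^sub>m\<close> the elements \<open>d j m = s\<^sub>m s\<^sub>m\<^sub>-\<^sub>1 \<cdots> s\<^sub>j\<^sub>+\<^sub>1\<close> represent the cosets of the
  parabolic subgroup of type \<open>A\<^sub>m\<^sub>-\<^sub>1\<close>.\<close>

lemma finite_par_type_A:
  fixes g :: "nat \<Rightarrow> 'a"
  assumes gS: "\<And>i. i \<in> {1..n} \<Longrightarrow> g i \<in> S"
    and braid: "\<And>i. i \<in> {1..<n} \<Longrightarrow> g i \<otimes> (g (Suc i) \<otimes> g i) = g (Suc i) \<otimes> (g i \<otimes> g (Suc i))"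
    and comm: "\<And>i j. i \<in> {1..n} \<Longrightarrow> j \<in> {1..n} \<Longrightarrow> Suc i < j \<Longrightarrow> g i \<otimes> g j = g j \<otimes> g i"
  shows "finite (par (g ` {1..n}))"
proof -
  define d where "d = (\<lambda>j m. ev (map g (rev [Suc j..<Suc m])))"
  have gc: "g i \<in> carrier W" if "i \<in> {1..n}" for i using gS[OF that] by blast
  have d_refl: "d j j = \<one>" for j by (simp add: d_def)
  have d_Suc: "d j (Suc m) = g (Suc m) \<otimes> d j m" if "j \<le> m" for j m
    using that by (simp add: d_def)
  have d_closed: "d j m \<in> carrier W" if "m \<le> n" for j m
    unfolding d_def using that gS by (intro ev_closed) auto
  have d_first: "d j m = d (Suc j) m \<otimes> g (Suc j)" if "j < m" "m \<le> n" for j m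
  proof -
    have "map g (rev [Suc j..<Suc m]) = map g (rev [Suc (Suc j)..<Suc m]) @ [g (Suc j)]"
      using that by (subst upt_conv_Cons) auto
    moreover have "set (map g (rev [Suc (Suc j)..<Suc m])) \<subseteq> S" "g (Suc j) \<in> S" using that gS by auto
    ultimately show ?thesis by (simp only: d_def) (simp add: ev_append del: upt_Suc)
  qed
  have d_comm: "x \<otimes> d j m = d j m \<otimes> x"
    if "x \<in> carrier W" "m \<le> n" "j \<le> m" "\<And>i. i \<in> {Suc j..m} \<Longrightarrow> x \<otimes> g i = g i \<otimes> x" for x j m
    using that(3,2,4)
  proof (induction m rule: dec_induct)
    case (step m)
    have c: "g (Suc m) \<in> carrier W" "d j m \<in> carrier W" using step gc d_closed by auto
    have "x \<otimes> d j (Suc m) = (x \<otimes> g (Suc m)) \<otimes> d j m"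
      using c that(1) by (simp add: d_Suc[OF step(1)] m_assoc)
    also have "x \<otimes> g (Suc m) = g (Suc m) \<otimes> x" using step by auto
    also have "g (Suc m) \<otimes> x \<otimes> d j m = g (Suc m) \<otimes> (x \<otimes> d j m)" using c that(1) by (simp add: m_assoc)
    also have "x \<otimes> d j m = d j m \<otimes> x" using step by auto
    finally show ?case using c that(1) step by (simp add: d_Suc m_assoc)
  qed (simp add: d_refl that)
  have shift: "d j m \<otimes> g i = g (i - 1) \<otimes> d j m" if ij: "Suc j < i" "i \<le> m" and "m \<le> n" for i j m
    using that(2,3)
  proof (induction m rule: dec_induct)
    case base
    obtain h where i: "i = Suc (Suc h)" "j \<le> h" using ij(1) by (cases i; cases "i - 1") auto
    have c: "g i \<in> carrier W" "g (Suc h) \<in> carrier W" "d j h \<in> carrier W" using base i gc d_closed by auto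
    have e: "d j i = g i \<otimes> (g (Suc h) \<otimes> d j h)" using i by (simp add: d_Suc)
    have "g i \<otimes> d j h = d j h \<otimes> g i"
    proof (rule d_comm)
      fix k assume "k \<in> {Suc j..h}"
      thus "g i \<otimes> g k = g k \<otimes> g i" using comm[of k i] i base by simp
    qed (use c i base in auto)
    hence "d j i \<otimes> g i = (g i \<otimes> (g (Suc h) \<otimes> g i)) \<otimes> d j h" using c by (simp add: e m_assoc)
    also have "\<dots> = (g (Suc h) \<otimes> (g i \<otimes> g (Suc h))) \<otimes> d j h" using braid[of "Suc h"] i base by simp
    finally show ?case using c i e by (simp add: m_assoc)
  next
    case (step m)
    have i1: "i - 1 \<in> {1..n}" using step(1,4) ij by (cases i) simp_all
    have c: "g i \<in> carrier W" "g (i - 1) \<in> carrier W" "g (Suc m) \<in> carrier W" "d j m \<in> carrier W"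
      using step ij gc[OF i1] gc[of i] gc[of "Suc m"] d_closed[of m j] by auto
    have "d j (Suc m) \<otimes> g i = g (Suc m) \<otimes> (d j m \<otimes> g i)" using c step ij by (simp add: d_Suc m_assoc)
    also have "d j m \<otimes> g i = g (i - 1) \<otimes> d j m" using step by simp
    also have "g (Suc m) \<otimes> (g (i - 1) \<otimes> d j m) = (g (i - 1) \<otimes> g (Suc m)) \<otimes> d j m"
      using c comm[OF i1, of "Suc m"] step ij by (simp flip: m_assoc)
    finally show ?case using c step ij by (simp add: d_Suc m_assoc)
  qed
  have "finite (par (g ` {1..m}))" if "m \<le> n" for m
    using that
  proof (induction m)
    case 0 show ?case by (simp add: par_def)
  next
    case (Suc m)
    let ?m = "Suc m"
    have sub: "g ` {1..m} \<subseteq> S" "g ` {1..?m} \<subseteq> S" using gS Suc.prems by auto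
    show ?case
    proof (rule finite_par_step[of "g ` {1..m}" _ "(\<lambda>j. d j ?m) ` {..?m}"])
      show "\<one> \<in> (\<lambda>j. d j ?m) ` {..?m}" using d_refl[of ?m] by (intro image_eqI[of _ _ ?m]) auto
      show "(\<lambda>j. d j ?m) ` {..?m} \<subseteq> carrier W" using d_closed Suc.prems by auto
      fix r s assume "r \<in> (\<lambda>j. d j ?m) ` {..?m}" "s \<in> g ` {1..?m}"
      then obtain j i where ji: "r = d j ?m" "s = g i" "j \<le> ?m" "i \<in> {1..?m}" by auto
      have c: "d k ?m \<in> carrier W" for k using d_closed Suc.prems by simp
      have i: "i \<in> {1..n}" using ji Suc.prems by simp
      consider "i = j" | "i = Suc j" | "i < j" | "Suc j < i" by linarith
      thus "\<exists>u\<in>par (g ` {1..m}). \<exists>r'\<in>(\<lambda>j. d j ?m) ` {..?m}. r \<otimes> s = u \<otimes> r'"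
      proof cases
        case 1
        then obtain k where k: "j = Suc k" using i by (cases j) auto
        have "r \<otimes> s = d k ?m" using d_first[of k ?m] ji k 1 Suc.prems by simp
        hence "r \<otimes> s = \<one> \<otimes> d k ?m" by (simp only: l_one[OF c])
        thus ?thesis using k ji par_one by (intro bexI[of _ \<one>] bexI[of _ "d k ?m"]) auto
      next
        case 2
        have "r \<otimes> s = d (Suc j) ?m \<otimes> g i \<otimes> g i" using d_first[of j ?m] ji 2 Suc.prems by simp
        also have "\<dots> = \<one> \<otimes> d (Suc j) ?m" using c gS[OF i] by (simp add: m_assoc)
        finally show ?thesis using ji 2 par_one by (intro bexI[of _ \<one>] bexI[of _ "d (Suc j) ?m"]) auto
      next
        case 3
        have "g i \<otimes> d j ?m = d j ?m \<otimes> g i"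
          using ji 3 i Suc.prems comm[of i] by (intro d_comm gc) auto
        hence "r \<otimes> s = g i \<otimes> d j ?m" using ji by simp
        moreover have "g i \<in> par (g ` {1..m})" using ji 3 by (intro par_gen[OF sub(1)]) auto
        ultimately show ?thesis using ji by blast
      next
        case 4
        have "r \<otimes> s = g (i - 1) \<otimes> d j ?m" using shift[OF 4, of ?m] ji Suc.prems by simp
        moreover have "g (i - 1) \<in> par (g ` {1..m})" 
        proof (intro par_gen[OF sub(1)] imageI)
          show "i - 1 \<in> {1..m}" using ji(4) 4 by (cases i) simp_all
        qed
        ultimately show ?thesis using ji by blast
      qed
    qed (use sub Suc in auto)
  qed
  thus ?thesis by blast
qed

end

lemma type_A_finite:
  fixes n :: nat
  assumes "coxeter_system W S" and g: "bij_betw g {1..n} S"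
    and ord: "\<forall>i\<in>{1..n}. \<forall>j\<in>{1..n}. i < j \<longrightarrow> group.ord W (g i \<otimes>\<^bsub>W\<^esub> g j) = (if j = i + 1 then 3 else 2)"
  shows "finite (carrier W)"
proof -
  interpret coxeter W S
    using assms by (simp add: coxeter_system_def coxeter_def coxeter_axioms_def)
  have gS: "g i \<in> S" if "i \<in> {1..n}" for i using g that by (auto simp: bij_betw_def)
  have "finite (par (g ` {1..n}))"
  proof (rule finite_par_type_A)
    fix i assume i: "i \<in> {1..<n}"
    hence "ord (g i \<otimes>\<^bsub>W\<^esub> g (Suc i)) = 3" using ord by simp
    with ev_alt_list_braid[OF gS gS HOL.refl, of i "Suc i"] i gS[of i] gS[of "Suc i"]
    show "g i \<otimes>\<^bsub>W\<^esub> (g (Suc i) \<otimes>\<^bsub>W\<^esub> g i) = g (Suc i) \<otimes>\<^bsub>W\<^esub> (g i \<otimes>\<^bsub>W\<^esub> g (Suc i))"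
      by (simp add: numeral_3_eq_3)
  next
    fix i j assume ij: "i \<in> {1..n}" "j \<in> {1..n}" "Suc i < j"
    hence "ord (g i \<otimes>\<^bsub>W\<^esub> g j) = 2" using ord by simp
    with ev_alt_list_braid[OF gS gS HOL.refl, of i j] ij gS[of i] gS[of j]
    show "g i \<otimes>\<^bsub>W\<^esub> g j = g j \<otimes>\<^bsub>W\<^esub> g i" by (simp add: numeral_2_eq_2)
  qed (rule gS)
  moreover have "g ` {1..n} = S" using g by (simp add: bij_betw_def)
  ultimately show ?thesis using par_S by simp
qed

section \<open>The ring of additive endomorphisms\<close>

text \<open>For the trivial group \<open>V = 0\<close> this ring has \<open>0 = 1\<close>, so it is not an instance of \<open>ring_1\<close>.\<close>

typedef (overloaded) 'v aend = "{f :: 'v::ab_group_add \<Rightarrow> 'v. \<forall>x y. f (x + y) = f x + f y}"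
  morphisms app Aend
  by (rule exI[of _ "\<lambda>x. x"]) simp

lemma app_add [simp]: "app f (x + y) = app f x + app f y"
  using app[of f] by simp

lemma app_0 [simp]: "app f 0 = 0"
  using app_add[of f 0 0] by simp

lemma app_neg [simp]: "app f (- x) = - app f x"
  using app_add[of f x "- x"] by (simp add: eq_neg_iff_add_eq_0 add.commute)

lemma app_diff [simp]: "app f (x - y) = app f x - app f y"
  using app_add[of f x "- y"] by simp

lemma app_sum: "app f (sum g A) = (\<Sum>a\<in>A. app f (g a))"
  by (induction A rule: infinite_finite_induct) simp_all

lemma app_Aend: "(\<And>x y. f (x + y) = f x + f y) \<Longrightarrow> app (Aend f) = f"
  by (simp add: Aend_inverse)

lemma aend_eqI: "(\<And>v. app f v = app g v) \<Longrightarrow> f = g"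
  by (simp add: app_inject[symmetric] fun_eq_iff)

instantiation aend :: (ab_group_add) "{ring, monoid_mult}"
begin

definition zero_aend :: "'a aend" where "0 = Aend (\<lambda>x. 0)"
definition one_aend :: "'a aend" where "1 = Aend (\<lambda>x. x)"
definition plus_aend :: "'a aend \<Rightarrow> 'a aend \<Rightarrow> 'a aend" where "f + g = Aend (\<lambda>x. app f x + app g x)"
definition minus_aend :: "'a aend \<Rightarrow> 'a aend \<Rightarrow> 'a aend" where "f - g = Aend (\<lambda>x. app f x - app g x)"
definition uminus_aend :: "'a aend \<Rightarrow> 'a aend" where "- f = Aend (\<lambda>x. - app f x)"
definition times_aend :: "'a aend \<Rightarrow> 'a aend \<Rightarrow> 'a aend" where "f * g = Aend (\<lambda>x. app f (app g x))"

lemma app_ops [simp]: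
  fixes f g :: "'a aend"
  shows "app (0 :: 'a aend) x = 0" "app (1 :: 'a aend) x = x" "app (f + g) x = app f x + app g x"
    "app (f - g) x = app f x - app g x" "app (- f) x = - app f x" "app (f * g) x = app f (app g x)"
  by (simp_all add: zero_aend_def one_aend_def plus_aend_def minus_aend_def uminus_aend_def
      times_aend_def app_Aend)

instance
  by standard (auto intro!: aend_eqI)

end

section \<open>The symmetrizer\<close>

locale braid_rep = coxeter W S for W (structure) and S +
  fixes scale :: "complex \<Rightarrow> 'v::ab_group_add \<Rightarrow> 'v" and \<sigma> :: "'a \<Rightarrow> 'v aend"
  assumes vector_space_scale: "vector_space scale"
    and \<sigma>_scale: "s \<in> S \<Longrightarrow> app (\<sigma> s) (scale c v) = scale c (app (\<sigma> s) v)"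
    and braided: "braided \<sigma>"
    and finite_W: "finite (carrier W)"
begin

interpretation V: vector_space scale by (rule vector_space_scale)

abbreviation T where "T \<equiv> tau \<sigma>"

text \<open>In \<open>K_par I\<close> the conditions of \<open>K_space\<close> are imposed for \<open>s \<in> I\<close> only. For \<open>I = S\<close> the
  symmetrizer maps \<open>x\<close> to the sum of all \<open>i\<^sub>y(x\<^sub>y)\<close>.\<close>

definition Vs :: "'a \<Rightarrow> 'v set" where "Vs s = range (app (\<sigma> s * \<sigma> s - 1))"

definition K_par :: "'a set \<Rightarrow> ('a \<Rightarrow> 'v) set"
  where "K_par I = {x. (\<forall>w. w \<notin> carrier W \<longrightarrow> x w = 0) \<and>
    (\<forall>s\<in>I. \<forall>w\<in>carrier W. x (s \<otimes> w) - app (\<sigma> s) (x w) \<in> Vs s)}"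

definition symmetrizer :: "'a set \<Rightarrow> ('a \<Rightarrow> 'v) \<Rightarrow> 'a \<Rightarrow> 'v"
  where "symmetrizer I x w = (if w \<in> carrier W then \<Sum>g\<in>par I. app (T g) (x (inv g \<otimes> w)) else 0)"

lemma T_scale: assumes "g \<in> carrier W" shows "app (T g) (scale c v) = scale c (app (T g) v)"
proof -
  obtain ss where ss: "reduced ss" "ev ss = g" by (rule reduced_word'[OF assms])
  have "app (prod_list (map \<sigma> ss)) (scale c v) = scale c (app (prod_list (map \<sigma> ss)) v)"
    if "set ss \<subseteq> S" for ss
    using that by (induction ss arbitrary: v) (simp_all add: \<sigma>_scale)
  thus ?thesis using tau_reduced[OF braided ss] ss by (simp add: reduced_def)
qed

lemma Vs_add: "u \<in> Vs s \<Longrightarrow> v \<in> Vs s \<Longrightarrow> u + v \<in> Vs s"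
proof -
  assume "u \<in> Vs s" "v \<in> Vs s"
  then obtain x y where "u = app (\<sigma> s * \<sigma> s - 1) x" "v = app (\<sigma> s * \<sigma> s - 1) y" by (auto simp: Vs_def)
  hence "u + v = app (\<sigma> s * \<sigma> s - 1) (x + y)" by (simp only: app_add)
  thus ?thesis unfolding Vs_def by blast
qed

lemma Vs_scale: assumes "s \<in> S" "v \<in> Vs s" shows "scale c v \<in> Vs s"
proof -
  obtain x where "v = app (\<sigma> s * \<sigma> s - 1) x" using assms(2) by (auto simp: Vs_def)
  hence "scale c v = app (\<sigma> s * \<sigma> s - 1) (scale c x)"
    using assms(1) by (simp add: \<sigma>_scale V.scale_right_diff_distrib)
  thus ?thesis unfolding Vs_def by blast
qed

lemma Vs_0: "0 \<in> Vs s"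
  using app_0[of "\<sigma> s * \<sigma> s - 1"] unfolding Vs_def by (metis rangeI)

lemma Vs_sum: "(\<And>a. a \<in> A \<Longrightarrow> f a \<in> Vs s) \<Longrightarrow> sum f A \<in> Vs s"
  by (induction A rule: infinite_finite_induct) (simp_all add: Vs_0 Vs_add)

lemma K_par_add: assumes "x \<in> K_par I" "y \<in> K_par I" shows "(\<lambda>w. x w + y w) \<in> K_par I"
proof -
  have "x (s \<otimes> w) + y (s \<otimes> w) - app (\<sigma> s) (x w + y w) \<in> Vs s" if "s \<in> I" "w \<in> carrier W" for s w
  proof -
    have "(x (s \<otimes> w) - app (\<sigma> s) (x w)) + (y (s \<otimes> w) - app (\<sigma> s) (y w)) \<in> Vs s"
      using assms that by (intro Vs_add) (auto simp: K_par_def)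
    thus ?thesis by (simp add: algebra_simps)
  qed
  thus ?thesis using assms by (simp add: K_par_def)
qed

lemma K_par_scale: assumes "I \<subseteq> S" "x \<in> K_par I" shows "(\<lambda>w. scale c (x w)) \<in> K_par I"
proof -
  have "scale c (x (s \<otimes> w)) - app (\<sigma> s) (scale c (x w)) \<in> Vs s" if "s \<in> I" "w \<in> carrier W" for s w
  proof -
    have "scale c (x (s \<otimes> w) - app (\<sigma> s) (x w)) \<in> Vs s"
      using assms that by (intro Vs_scale) (auto simp: K_par_def)
    thus ?thesis using assms(1) that by (simp add: V.scale_right_diff_distrib \<sigma>_scale subset_iff)
  qed
  thus ?thesis using assms by (simp add: K_par_def)
qed

lemma symmetrizer_add: "symmetrizer I (\<lambda>w. x w + y w) w = symmetrizer I x w + symmetrizer I y w"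
  by (simp add: symmetrizer_def sum.distrib)

lemma symmetrizer_scale: assumes "I \<subseteq> S" shows "symmetrizer I (\<lambda>w. scale c (x w)) w = scale c (symmetrizer I x w)"
proof -
  have "app (T g) (scale c v) = scale c (app (T g) v)" if "g \<in> par I" for g v
    using T_scale par_closed[OF assms that] .
  thus ?thesis by (simp add: symmetrizer_def V.scale_sum_right)
qed

lemma symmetrizer_sum: assumes "I \<subseteq> S"
  shows "symmetrizer I (\<lambda>w. \<Sum>a\<in>A. scale (c a) (x a w)) w = (\<Sum>a\<in>A. scale (c a) (symmetrizer I (x a) w))"
proof (induction A rule: infinite_finite_induct)
  case (insert a A)
  thus ?case using symmetrizer_scale[OF assms] by (simp add: symmetrizer_add)
qed (simp_all add: symmetrizer_def)

lemma finite_par: "I \<subseteq> S \<Longrightarrow> finite (par I)"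
  using finite_subset[OF _ finite_W] par_closed by blast

lemma tau_left:
  assumes "s \<in> S" "g \<in> carrier W"
  shows "len (s \<otimes> g) = Suc (len g) \<Longrightarrow> T (s \<otimes> g) = \<sigma> s * T g"
    and "len g = Suc (len (s \<otimes> g)) \<Longrightarrow> T g = \<sigma> s * T (s \<otimes> g)"
  using tau_mult[OF braided, of s g] tau_mult[OF braided, of s "s \<otimes> g"] assms len_S[of s] tau_S[OF braided]
  by simp_all

text \<open>The summands for \<open>g\<close> and \<open>s g\<close> are compared: either \<open>\<tau>(s g) = s \<tau>(g)\<close>, or \<open>\<tau>(g) = s \<tau>(s g)\<close> and
  the two differ by a multiple of \<open>s\<^sup>2 - 1\<close>.\<close>

lemma symmetrizer_K_par: assumes I: "I \<subseteq> S" shows "symmetrizer I x \<in> K_par I"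
proof -
  have "symmetrizer I x (s \<otimes> w) - app (\<sigma> s) (symmetrizer I x w) \<in> Vs s" if s: "s \<in> I" and w: "w \<in> carrier W" for s w
  proof -
    have sS: "s \<in> S" using s I by blast
    have c: "g \<in> carrier W" if "g \<in> par I" for g using par_closed[OF I that] .
    have bij: "bij_betw ((\<otimes>) s) (par I) (par I)"
      by (rule bij_betw_byWitness[where f' = "(\<otimes>) s"])
        (use sS c s par_mult[OF I par_gen[OF I]] in auto)
    have "symmetrizer I x (s \<otimes> w) = (\<Sum>g\<in>par I. app (T g) (x (inv g \<otimes> (s \<otimes> w))))"
      using sS w by (simp add: symmetrizer_def)
    also have "\<dots> = (\<Sum>g\<in>par I. app (T (s \<otimes> g)) (x (inv (s \<otimes> g) \<otimes> (s \<otimes> w))))"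
      by (rule sum.reindex_bij_betw[OF bij, symmetric])
    also have "\<dots> = (\<Sum>g\<in>par I. app (T (s \<otimes> g)) (x (inv g \<otimes> w)))"
      using sS w c by (intro sum.cong HOL.refl) (simp add: inv_mult_group m_assoc)
    finally have "symmetrizer I x (s \<otimes> w) - app (\<sigma> s) (symmetrizer I x w)
        = (\<Sum>g\<in>par I. app (T (s \<otimes> g)) (x (inv g \<otimes> w)) - app (\<sigma> s) (app (T g) (x (inv g \<otimes> w))))"
      using w by (simp add: symmetrizer_def app_sum sum_subtractf)
    also have "\<dots> \<in> Vs s"
    proof (rule Vs_sum)
      fix g assume g: "g \<in> par I"
      let ?v = "x (inv g \<otimes> w)"
      from len_S_mult(1)[OF sS c[OF g]]
      show "app (T (s \<otimes> g)) ?v - app (\<sigma> s) (app (T g) ?v) \<in> Vs s"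
      proof
        assume "len (s \<otimes> g) = Suc (len g)"
        thus ?thesis using tau_left(1)[OF sS c[OF g]] Vs_0 by simp
      next
        assume "len g = Suc (len (s \<otimes> g))"
        hence "app (T (s \<otimes> g)) ?v - app (\<sigma> s) (app (T g) ?v) = app (\<sigma> s * \<sigma> s - 1) (- app (T (s \<otimes> g)) ?v)"
          using tau_left(2)[OF sS c[OF g]] by simp
        thus ?thesis unfolding Vs_def by (metis rangeI)
      qed
    qed
    finally show ?thesis .
  qed
  thus ?thesis by (simp add: K_par_def symmetrizer_def)
qed

lemma symmetrizer_decompose:
  assumes "J \<subseteq> I" "I \<subseteq> S" "w \<in> carrier W"
  shows "(\<Sum>g\<in>min_coset I J. app (T g) (symmetrizer J x (inv g \<otimes> w))) = symmetrizer I x w"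
proof -
  have JS: "J \<subseteq> S" using assms by blast
  have c: "g \<in> carrier W" if "g \<in> min_coset I J" for g
    using that par_closed[OF assms(2)] by (auto simp: min_coset_def)
  have "(\<Sum>g\<in>min_coset I J. app (T g) (symmetrizer J x (inv g \<otimes> w)))
      = (\<Sum>g\<in>min_coset I J. \<Sum>u\<in>par J. app (T (g \<otimes> u)) (x (inv (g \<otimes> u) \<otimes> w)))"
  proof (rule sum.cong[OF HOL.refl])
    fix g assume g: "g \<in> min_coset I J"
    have "app (T g) (app (T u) (x (inv u \<otimes> (inv g \<otimes> w)))) = app (T (g \<otimes> u)) (x (inv (g \<otimes> u) \<otimes> w))"
      if u: "u \<in> par J" for u
      using tau_mult[OF braided c[OF g] par_closed[OF JS u] len_min_coset'[OF assms(1,2) g u]]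
        c[OF g] par_closed[OF JS u] assms(3)
      by (simp add: inv_mult_group m_assoc)
    thus "app (T g) (symmetrizer J x (inv g \<otimes> w)) = (\<Sum>u\<in>par J. app (T (g \<otimes> u)) (x (inv (g \<otimes> u) \<otimes> w)))"
      using c[OF g] assms(3) by (simp add: symmetrizer_def app_sum)
  qed
  also have "\<dots> = (\<Sum>(g, u)\<in>min_coset I J \<times> par J. app (T (g \<otimes> u)) (x (inv (g \<otimes> u) \<otimes> w)))"
    by (rule sum.cartesian_product)
  also have "\<dots> = (\<Sum>g\<in>par I. app (T g) (x (inv g \<otimes> w)))"
    using sum.reindex_bij_betw[OF bij_betw_min_coset[OF assms(1,2)], of "\<lambda>g. app (T g) (x (inv g \<otimes> w))"]
    by (simp add: case_prod_beta')
  finally show ?thesis using assms(3) by (simp add: symmetrizer_def)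
qed

text \<open>Solomon's alternating sum over the parabolic subgroups collapses to the longest element.
  Each proper summand lies in the image of the symmetrizer, because \<open>x\<close> is a symmetrization for
  the smaller parabolic subgroup.\<close>

lemma longest_step:
  assumes I: "I \<subseteq> S" "finite I" and w0: "longest I w0" and x: "x \<in> K_par I"
    and IH: "\<And>J. J \<subset> I \<Longrightarrow> K_par J \<subseteq> range (symmetrizer J)"
  shows "\<exists>y. \<forall>w\<in>carrier W. app (T w0) (x (inv w0 \<otimes> w)) = scale ((- 1) ^ card I) (x w) + symmetrizer I y w"
proof -
  have "\<exists>y. x = symmetrizer J y" if "J \<in> Pow I - {I}" for J
  proof -
    have "x \<in> K_par J" using x that by (auto simp: K_par_def)
    thus ?thesis using IH[of J] that by blast
  qed
  then obtain y where y: "\<And>J. J \<in> Pow I - {I} \<Longrightarrow> x = symmetrizer J (y J)" by metis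
  define Y where "Y = (\<lambda>v. \<Sum>J\<in>Pow I - {I}. scale ((- 1) ^ card J) (y J v))"
  have "app (T w0) (x (inv w0 \<otimes> w)) = scale ((- 1) ^ card I) (x w) + symmetrizer I Y w" if w: "w \<in> carrier W" for w
  proof -
    define F where "F = (\<lambda>g. app (T g) (x (inv g \<otimes> w)))"
    have fin: "finite (par I)" by (rule finite_par[OF I(1)])
    have sub: "min_coset I J \<subseteq> par I" for J by (auto simp: min_coset_def)
    have "F w0 = (\<Sum>g\<in>par I. if g = w0 then F g else 0)"
      using fin w0_par[OF I(1) w0] by simp
    also have "\<dots> = (\<Sum>g\<in>par I. scale (of_bool (g = w0)) (F g))" by (intro sum.cong) auto
    also have "\<dots> = (\<Sum>g\<in>par I. scale (\<Sum>J\<in>Pow I. (- 1) ^ card J * of_bool (g \<in> min_coset I J)) (F g))"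
    proof (rule sum.cong[OF HOL.refl])
      fix g assume g: "g \<in> par I"
      show "scale (of_bool (g = w0)) (F g)
          = scale (\<Sum>J\<in>Pow I. (- 1) ^ card J * of_bool (g \<in> min_coset I J)) (F g)"
        by (simp only: solomon_coefficients[OF I w0 g])
    qed
    also have "\<dots> = (\<Sum>g\<in>par I. \<Sum>J\<in>Pow I. scale ((- 1) ^ card J * of_bool (g \<in> min_coset I J)) (F g))"
      by (simp only: V.scale_sum_left)
    also have "\<dots> = (\<Sum>J\<in>Pow I. \<Sum>g\<in>par I. scale ((- 1) ^ card J * of_bool (g \<in> min_coset I J)) (F g))"
      by (rule sum.swap)
    also have "\<dots> = (\<Sum>J\<in>Pow I. scale ((- 1) ^ card J) (\<Sum>g\<in>min_coset I J. F g))"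
    proof (rule sum.cong[OF HOL.refl])
      fix J
      have "(\<Sum>g\<in>par I. scale ((- 1) ^ card J * of_bool (g \<in> min_coset I J)) (F g))
          = (\<Sum>g\<in>min_coset I J. scale ((- 1) ^ card J) (F g))"
        using fin sub by (intro sum.mono_neutral_cong_right) auto
      thus "(\<Sum>g\<in>par I. scale ((- 1) ^ card J * of_bool (g \<in> min_coset I J)) (F g))
          = scale ((- 1) ^ card J) (\<Sum>g\<in>min_coset I J. F g)" by (simp only: V.scale_sum_right)
    qed
    also have "\<dots> = scale ((- 1) ^ card I) (\<Sum>g\<in>min_coset I I. F g)
        + (\<Sum>J\<in>Pow I - {I}. scale ((- 1) ^ card J) (\<Sum>g\<in>min_coset I J. F g))"
      by (rule sum.remove) (use I(2) in auto)
    also have "(\<Sum>g\<in>min_coset I I. F g) = x w"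
      using w by (simp add: min_coset_self[OF I(1)] F_def tau_one[OF braided])
    also have "(\<Sum>J\<in>Pow I - {I}. scale ((- 1) ^ card J) (\<Sum>g\<in>min_coset I J. F g)) = symmetrizer I Y w"
    proof -
      have "(\<Sum>g\<in>min_coset I J. F g) = symmetrizer I (y J) w" if J: "J \<in> Pow I - {I}" for J
      proof -
        have "(\<Sum>g\<in>min_coset I J. F g) = (\<Sum>g\<in>min_coset I J. app (T g) (symmetrizer J (y J) (inv g \<otimes> w)))"
          unfolding F_def using y[OF J] by simp
        also have "\<dots> = symmetrizer I (y J) w" by (rule symmetrizer_decompose) (use J I w in auto)
        finally show ?thesis .
      qed
      thus ?thesis unfolding Y_def symmetrizer_sum[OF I(1)] by (intro sum.cong) simp_all
    qed
    finally show ?thesis by (simp add: F_def)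
  qed
  thus ?thesis by blast
qed

text \<open>Applying the previous step twice replaces the longest element by its square, the central
  full twist; the sign disappears.\<close>

lemma full_twist_step:
  assumes I: "I \<subseteq> S" "finite I" and w0: "longest I w0" and x: "x \<in> K_par I"
    and IH: "\<And>J. J \<subset> I \<Longrightarrow> K_par J \<subseteq> range (symmetrizer J)"
  shows "\<exists>y. \<forall>w\<in>carrier W. app (T w0 * T w0) (x w) = x w + symmetrizer I y w"
proof -
  let ?e = "(- 1) ^ card I :: complex"
  obtain y where y: "\<And>w. w \<in> carrier W \<Longrightarrow> app (T w0) (x (inv w0 \<otimes> w)) = scale ?e (x w) + symmetrizer I y w"
    using longest_step[OF assms] by blast
  define x' where "x' = (\<lambda>w. scale ?e (x w) + symmetrizer I y w)"
  have "x' \<in> K_par I" unfolding x'_def by (intro K_par_add K_par_scale symmetrizer_K_par I x)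
  then obtain y' where y': "\<And>w. w \<in> carrier W \<Longrightarrow> app (T w0) (x' (inv w0 \<otimes> w)) = scale ?e (x' w) + symmetrizer I y' w"
    using longest_step[OF I w0 _ IH] by blast
  have c: "w0 \<in> carrier W" and w0w0: "w0 \<otimes> w0 = \<one>"
    using w0_closed[OF I(1) w0] longest_square[OF I(1) w0] by auto
  hence inv: "inv w0 = w0" by (simp add: inv_equality)
  have "app (T w0 * T w0) (x w) = x w + symmetrizer I (\<lambda>w. scale ?e (y w) + y' w) w" if w: "w \<in> carrier W" for w
  proof -
    have w': "w0 \<otimes> w \<in> carrier W" "w0 \<otimes> (w0 \<otimes> w) = w"
      using c w w0w0 by (simp_all flip: m_assoc)
    have "app (T w0 * T w0) (x w) = app (T w0) (x' (inv w0 \<otimes> w))"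
      using y[OF w'(1)] w' by (simp add: inv x'_def)
    also have "\<dots> = scale (?e * ?e) (x w) + scale ?e (symmetrizer I y w) + symmetrizer I y' w"
      using y'[OF w] by (simp add: x'_def V.scale_right_distrib)
    also have "?e * ?e = 1" by (simp flip: power_mult_distrib)
    finally show ?thesis by (simp add: symmetrizer_add symmetrizer_scale[OF I(1)] add.assoc)
  qed
  thus ?thesis by blast
qed

text \<open>In a flat family all summands of the symmetrizer agree, so symmetrizing multiplies it by the order
  of \<open>W\<^sub>I\<close>.\<close>

lemma flat_in_range:
  assumes I: "I \<subseteq> S" and supp: "\<And>w. w \<notin> carrier W \<Longrightarrow> x w = 0"
    and flat: "\<And>s w. s \<in> I \<Longrightarrow> w \<in> carrier W \<Longrightarrow> x (s \<otimes> w) = app (\<sigma> s) (x w)"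
  shows "x \<in> range (symmetrizer I)"
proof -
  have T: "x (g \<otimes> w) = app (T g) (x w)" if "g \<in> par I" "w \<in> carrier W" for g w
    using that
  proof (induction g arbitrary: w rule: par_induct[OF I, consumes 1, case_names one snoc])
    case one thus ?case by (simp add: tau_one[OF braided])
  next
    case (snoc u s)
    have c: "u \<in> carrier W" "s \<in> S" using snoc par_closed[OF I] I by auto
    have "T (u \<otimes> s) = T u * \<sigma> s"
      using tau_mult[OF braided, of u s] c snoc len_S[of s] tau_S[OF braided] by simp
    moreover have "x (u \<otimes> s \<otimes> w) = app (T u) (x (s \<otimes> w))"
      using snoc.IH[of "s \<otimes> w"] c snoc by (simp add: m_assoc)
    ultimately show ?case using flat[OF snoc(2)] snoc by simp
  qed
  let ?n = "of_nat (card (par I)) :: complex"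
  have "par I \<noteq> {}" using par_one[of I] by blast
  hence n: "?n \<noteq> 0" using finite_par[OF I] by simp
  have "x w = symmetrizer I (\<lambda>w. scale (inverse ?n) (x w)) w" for w
  proof (cases "w \<in> carrier W")
    case True
    have "app (T g) (x (inv g \<otimes> w)) = x w" if "g \<in> par I" for g
      using T[OF that, of "inv g \<otimes> w"] True par_closed[OF I that] by simp
    hence "symmetrizer I x w = (\<Sum>g\<in>par I. x w)" using True by (simp add: symmetrizer_def)
    also have "\<dots> = scale ?n (x w)" using V.scale_sum_left[of "\<lambda>_. 1" "par I" "x w"] by simp
    finally show ?thesis using n by (simp add: symmetrizer_scale[OF I])
  qed (simp add: symmetrizer_def supp)
  thus ?thesis by (intro range_eqI ext)
qed

text \<open>The hypothesis says that \<open>c + (z - 1) h\<close> annihilates \<open>s\<^sup>2 - 1\<close>, hence makes \<open>x\<close> flat. As \<open>h x\<close>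
  still lies in \<open>K\<^sub>I\<close>, where \<open>z - 1\<close> maps into the image of the symmetrizer, so does \<open>c x\<close>.\<close>

theorem K_par_eq_range_symmetrizer:
  assumes inv: "\<And>I w0. I \<subseteq> S \<Longrightarrow> longest I w0 \<Longrightarrow> \<exists>c h. c \<noteq> 0 \<and>
      (\<forall>s\<in>I. \<sigma> s * h = h * \<sigma> s \<and>
        (\<forall>v. scale c (app (\<sigma> s * \<sigma> s - 1) v) + app ((T w0 * T w0 - 1) * h * (\<sigma> s * \<sigma> s - 1)) v = 0))"
    and "finite I" "I \<subseteq> S"
  shows "K_par I = range (symmetrizer I)"
  using assms(2,3)
proof (induction I rule: finite_psubset_induct)
  case (psubset I)
  note I = psubset.prems psubset.hyps(1)
  obtain w0 where w0: "longest I w0" by (rule longest_ex[OF finite_par[OF I(1)]])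
  let ?z = "T w0 * T w0"
  obtain c h where c: "c \<noteq> 0" and comm: "\<And>s. s \<in> I \<Longrightarrow> \<sigma> s * h = h * \<sigma> s"
    and ann: "\<And>s v. s \<in> I \<Longrightarrow> scale c (app (\<sigma> s * \<sigma> s - 1) v) + app ((?z - 1) * h * (\<sigma> s * \<sigma> s - 1)) v = 0"
    using inv[OF I(1) w0] by blast
  have z_comm: "?z * \<sigma> s = \<sigma> s * ?z" if "s \<in> I" for s
    by (rule tau_longest_square_commute[OF I(1) w0 braided that])
  show ?case
  proof
    show "range (symmetrizer I) \<subseteq> K_par I" using symmetrizer_K_par[OF I(1)] by blast
    show "K_par I \<subseteq> range (symmetrizer I)"
    proof
      fix x assume x: "x \<in> K_par I"
      define y where "y = (\<lambda>w. scale c (x w) + app ((?z - 1) * h) (x w))"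
      have "y \<in> range (symmetrizer I)"
      proof (rule flat_in_range[OF I(1)])
        show "y w = 0" if "w \<notin> carrier W" for w using x that by (simp add: y_def K_par_def)
        fix s w assume s: "s \<in> I" and w: "w \<in> carrier W"
        obtain v where v: "x (s \<otimes> w) - app (\<sigma> s) (x w) = app (\<sigma> s * \<sigma> s - 1) v"
          using x s w unfolding K_par_def Vs_def by blast
        have "((?z - 1) * h) * \<sigma> s = \<sigma> s * ((?z - 1) * h)"
        proof -
          have "((?z - 1) * h) * \<sigma> s = (?z - 1) * \<sigma> s * h" by (simp only: mult.assoc comm[OF s])
          also have "(?z - 1) * \<sigma> s = \<sigma> s * (?z - 1)"
            by (simp only: left_diff_distrib right_diff_distrib z_comm[OF s] mult_1_left mult_1_right)
          finally show ?thesis by (simp only: mult.assoc)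
        qed
        hence "app (\<sigma> s) (app ((?z - 1) * h) u) = app ((?z - 1) * h) (app (\<sigma> s) u)" for u
          by (simp only: app_ops(6)[symmetric])
        hence "y (s \<otimes> w) - app (\<sigma> s) (y w)
            = scale c (x (s \<otimes> w) - app (\<sigma> s) (x w)) + app ((?z - 1) * h) (x (s \<otimes> w) - app (\<sigma> s) (x w))"
          using \<sigma>_scale[of s] s I(1) unfolding y_def
          by (simp only: app_add app_diff V.scale_right_diff_distrib subset_iff) (simp add: algebra_simps)
        also have "\<dots> = 0" using ann[OF s, of v] unfolding v by (simp only: app_ops(6))
        finally show "y (s \<otimes> w) = app (\<sigma> s) (y w)" by simp
      qed
      then obtain y1 where y1: "y = symmetrizer I y1" by blast
      define x' where "x' = (\<lambda>w. app h (x w))"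
      have "x' \<in> K_par I"
      proof -
        have "x' (s \<otimes> w) - app (\<sigma> s) (x' w) \<in> Vs s" if s: "s \<in> I" and w: "w \<in> carrier W" for s w
        proof -
          obtain v where v: "x (s \<otimes> w) - app (\<sigma> s) (x w) = app (\<sigma> s * \<sigma> s - 1) v"
            using x s w unfolding K_par_def Vs_def by blast
          have hs: "app (\<sigma> s) (app h u) = app h (app (\<sigma> s) u)" for u
            using comm[OF s] by (simp only: app_ops(6)[symmetric])
          have "x' (s \<otimes> w) - app (\<sigma> s) (x' w) = app h (x (s \<otimes> w) - app (\<sigma> s) (x w))"
            by (simp add: x'_def hs)
          also have "\<dots> = app (\<sigma> s * \<sigma> s - 1) (app h v)" unfolding v by (simp add: hs)
          finally show ?thesis unfolding Vs_def by (metis rangeI)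
        qed
        thus ?thesis using x by (simp add: K_par_def x'_def)
      qed
      moreover have "K_par J \<subseteq> range (symmetrizer J)" if "J \<subset> I" for J
        using psubset.IH[OF that] that I(1) by auto
      ultimately obtain y2 where y2: "\<And>w. w \<in> carrier W \<Longrightarrow> app ?z (x' w) = x' w + symmetrizer I y2 w"
        using full_twist_step[OF I w0, of x'] by blast
      have "x w = symmetrizer I (\<lambda>w. scale (inverse c) (y1 w + scale (- 1) (y2 w))) w" for w
      proof (cases "w \<in> carrier W")
        case True
        have "symmetrizer I y1 w = scale c (x w) + (app ?z (x' w) - x' w)"
          unfolding y1[symmetric] by (simp add: y_def x'_def)
        also have "\<dots> = scale c (x w) + symmetrizer I y2 w" using y2[OF True] by simp
        finally have "symmetrizer I y1 w - symmetrizer I y2 w = scale c (x w)" by simp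
        moreover have "symmetrizer I (\<lambda>w. y1 w + scale (- 1) (y2 w)) w = symmetrizer I y1 w - symmetrizer I y2 w"
          unfolding symmetrizer_add symmetrizer_scale[OF I(1)] by simp
        ultimately show ?thesis unfolding symmetrizer_scale[OF I(1)] using c by simp
      next
        case False
        thus ?thesis using x by (simp add: symmetrizer_def K_par_def)
      qed
      thus "x \<in> range (symmetrizer I)" by (intro range_eqI ext)
    qed
  qed
qed

end

section \<open>The group algebra\<close>

text \<open>The linear extension of \<open>u\<close> to the group algebra. Elements are determined by these values, and
  the convolution becomes an iterated application, which makes the ring axioms immediate.\<close>

definition lin_ext :: "('g \<Rightarrow> complex) \<Rightarrow> ('g \<Rightarrow> complex) \<Rightarrow> complex"
  where "lin_ext f u = (\<Sum>a | f a \<noteq> 0. f a * u a)"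

lemma lin_ext_superset:
  assumes "finite T" "{a. f a \<noteq> 0} \<subseteq> T" shows "lin_ext f u = (\<Sum>a\<in>T. f a * u a)"
  unfolding lin_ext_def using assms by (intro sum.mono_neutral_left) auto

lemma lin_ext_cong: "(\<And>a. f a \<noteq> 0 \<Longrightarrow> u a = v a) \<Longrightarrow> lin_ext f u = lin_ext f v"
  unfolding lin_ext_def by (intro sum.cong) auto

lemma lin_ext_delta:
  assumes "finite {a. f a \<noteq> 0}" shows "lin_ext f (\<lambda>a. if a = g then 1 else 0) = f g"
proof -
  let ?T = "insert g {a. f a \<noteq> 0}"
  have "lin_ext f (\<lambda>a. if a = g then 1 else 0) = (\<Sum>a\<in>?T. f a * (if a = g then 1 else 0))"
    by (rule lin_ext_superset) (use assms in auto)
  also have "\<dots> = (\<Sum>a\<in>?T. if a = g then f a else 0)" by (intro sum.cong) auto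
  also have "\<dots> = f g" using assms by (subst sum.delta) auto
  finally show ?thesis .
qed

lemma lin_ext_eqI:
  assumes "finite {a. f a \<noteq> 0}" "finite {a. h a \<noteq> 0}" "\<And>u. lin_ext f u = lin_ext h u" shows "f = h"
  using lin_ext_delta[OF assms(1)] lin_ext_delta[OF assms(2)] assms(3) by (intro ext) metis

lemma lin_ext_add:
  assumes "finite {a. f a \<noteq> 0}" "finite {a. h a \<noteq> 0}"
  shows "lin_ext (\<lambda>g. f g + h g) u = lin_ext f u + lin_ext h u"
proof -
  let ?T = "{a. f a \<noteq> 0} \<union> {a. h a \<noteq> 0}"
  have "finite ?T" "{a. f a + h a \<noteq> 0} \<subseteq> ?T" using assms by auto
  thus ?thesis by (simp add: lin_ext_superset[of ?T] distrib_right sum.distrib)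
qed

lemma lin_ext_add_right: "lin_ext f (\<lambda>a. u a + v a) = lin_ext f u + lin_ext f v"
  by (simp add: lin_ext_def distrib_left sum.distrib)

lemma lin_ext_single [simp]: "lin_ext (single a c) u = c * u a"
  by (subst lin_ext_superset[of "{a}"]) (auto simp: single_def)

lemma (in Group.monoid) group_algebra_mult:
  assumes "finite {a. f a \<noteq> 0}" "finite {a. h a \<noteq> 0}"
  shows "finite {a. (f \<otimes>\<^bsub>group_algebra G\<^esub> h) a \<noteq> 0}"
    and "{a. (f \<otimes>\<^bsub>group_algebra G\<^esub> h) a \<noteq> 0} \<subseteq> (\<lambda>(a, b). a \<otimes> b) ` ({a. f a \<noteq> 0} \<times> {a. h a \<noteq> 0})"
    and "lin_ext (f \<otimes>\<^bsub>group_algebra G\<^esub> h) u = lin_ext f (\<lambda>a. lin_ext h (\<lambda>b. u (a \<otimes> b)))"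
proof -
  let ?F = "{a. f a \<noteq> 0}" and ?H = "{a. h a \<noteq> 0}"
  let ?P = "(\<lambda>(a, b). a \<otimes> b) ` (?F \<times> ?H)"
  let ?m = "f \<otimes>\<^bsub>group_algebra G\<^esub> h"
  have m: "?m x = (\<Sum>a\<in>?F. \<Sum>b\<in>?H. if a \<otimes> b = x then f a * h b else 0)" for x
    by (simp add: group_algebra_def)
  show sub: "{x. ?m x \<noteq> 0} \<subseteq> ?P"
  proof
    fix x assume "x \<in> {x. ?m x \<noteq> 0}"
    hence "(\<Sum>a\<in>?F. \<Sum>b\<in>?H. if a \<otimes> b = x then f a * h b else 0) \<noteq> 0" by (simp add: m)
    then obtain a where a: "a \<in> ?F" "(\<Sum>b\<in>?H. if a \<otimes> b = x then f a * h b else 0) \<noteq> 0"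
      by (rule sum.not_neutral_contains_not_neutral)
    from a(2) obtain b where b: "b \<in> ?H" "(if a \<otimes> b = x then f a * h b else 0) \<noteq> 0"
      by (rule sum.not_neutral_contains_not_neutral)
    from b(2) have "x = a \<otimes> b" by (cases "a \<otimes> b = x") simp_all
    thus "x \<in> ?P" using a(1) b(1) by blast
  qed
  have P: "finite ?P" using assms by simp
  show "finite {x. ?m x \<noteq> 0}" by (rule finite_subset[OF sub P])
  have "lin_ext ?m u = (\<Sum>x\<in>?P. (\<Sum>a\<in>?F. \<Sum>b\<in>?H. if a \<otimes> b = x then f a * h b else 0) * u x)"
    unfolding lin_ext_superset[OF P sub] m ..
  also have "\<dots> = (\<Sum>x\<in>?P. \<Sum>a\<in>?F. \<Sum>b\<in>?H. if a \<otimes> b = x then f a * h b * u (a \<otimes> b) else 0)"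
    unfolding sum_distrib_right by (intro sum.cong HOL.refl) simp
  also have "\<dots> = (\<Sum>a\<in>?F. \<Sum>x\<in>?P. \<Sum>b\<in>?H. if a \<otimes> b = x then f a * h b * u (a \<otimes> b) else 0)"
    by (rule sum.swap)
  also have "\<dots> = (\<Sum>a\<in>?F. \<Sum>b\<in>?H. \<Sum>x\<in>?P. if a \<otimes> b = x then f a * h b * u (a \<otimes> b) else 0)"
    by (rule sum.cong[OF HOL.refl], rule sum.swap)
  also have "\<dots> = (\<Sum>a\<in>?F. \<Sum>b\<in>?H. f a * h b * u (a \<otimes> b))"
  proof (intro sum.cong HOL.refl)
    fix a b assume "a \<in> ?F" "b \<in> ?H"
    hence "a \<otimes> b \<in> ?P" by blast
    thus "(\<Sum>x\<in>?P. if a \<otimes> b = x then f a * h b * u (a \<otimes> b) else 0) = f a * h b * u (a \<otimes> b)"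
      by (subst sum.delta'[OF P]) simp
  qed
  finally show "lin_ext ?m u = lin_ext f (\<lambda>a. lin_ext h (\<lambda>b. u (a \<otimes> b)))"
    unfolding lin_ext_def sum_distrib_left mult.assoc .
qed

lemma group_algebra_simps:
  "carrier (group_algebra G) = {f. finite {g. f g \<noteq> 0} \<and> {g. f g \<noteq> 0} \<subseteq> carrier G}"
  "\<one>\<^bsub>group_algebra G\<^esub> = single \<one>\<^bsub>G\<^esub> 1" "\<zero>\<^bsub>group_algebra G\<^esub> = (\<lambda>g. 0)"
  "f \<oplus>\<^bsub>group_algebra G\<^esub> h = (\<lambda>g. f g + h g)"
  by (simp_all add: group_algebra_def single_def)

lemma single_carrier: "a \<in> carrier G \<Longrightarrow> single a c \<in> carrier (group_algebra G)"
  by (auto simp: group_algebra_simps single_def)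

lemma group_algebra_eqI:
  "f \<in> carrier (group_algebra G) \<Longrightarrow> h \<in> carrier (group_algebra G) \<Longrightarrow> (\<And>u. lin_ext f u = lin_ext h u) \<Longrightarrow> f = h"
  by (rule lin_ext_eqI) (auto simp: group_algebra_simps)

context Group.monoid
begin

abbreviation CG where "CG \<equiv> group_algebra G"

lemma group_algebra_add_closed: "f \<in> carrier CG \<Longrightarrow> h \<in> carrier CG \<Longrightarrow> f \<oplus>\<^bsub>CG\<^esub> h \<in> carrier CG"
proof -
  assume fh: "f \<in> carrier CG" "h \<in> carrier CG"
  have sub: "{g. f g + h g \<noteq> 0} \<subseteq> {g. f g \<noteq> 0} \<union> {g. h g \<noteq> 0}" by auto
  have "finite {g. f g + h g \<noteq> 0}"
    by (rule finite_subset[OF sub]) (use fh in \<open>simp add: group_algebra_simps\<close>)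
  moreover have "{g. f g + h g \<noteq> 0} \<subseteq> carrier G"
    by (rule subset_trans[OF sub]) (use fh in \<open>simp add: group_algebra_simps\<close>)
  ultimately show ?thesis by (simp add: group_algebra_simps)
qed

lemma group_algebra_mult_closed:
  assumes "f \<in> carrier CG" "h \<in> carrier CG" shows "f \<otimes>\<^bsub>CG\<^esub> h \<in> carrier CG"
proof -
  have fin: "finite {g. f g \<noteq> 0}" "finite {g. h g \<noteq> 0}"
    and car: "{g. f g \<noteq> 0} \<subseteq> carrier G" "{g. h g \<noteq> 0} \<subseteq> carrier G"
    using assms by (simp_all add: group_algebra_simps)
  have "(\<lambda>(a, b). a \<otimes> b) ` ({g. f g \<noteq> 0} \<times> {g. h g \<noteq> 0}) \<subseteq> carrier G" using car by auto
  with group_algebra_mult(2)[OF fin] have "{a. (f \<otimes>\<^bsub>CG\<^esub> h) a \<noteq> 0} \<subseteq> carrier G" by (rule subset_trans)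
  thus ?thesis using group_algebra_mult(1)[OF fin] unfolding group_algebra_simps by blast
qed

lemma lin_ext_mult:
  "f \<in> carrier CG \<Longrightarrow> h \<in> carrier CG \<Longrightarrow> lin_ext (f \<otimes>\<^bsub>CG\<^esub> h) u = lin_ext f (\<lambda>a. lin_ext h (\<lambda>b. u (a \<otimes> b)))"
  by (rule group_algebra_mult) (auto simp: group_algebra_simps)

lemma lin_ext_plus:
  "f \<in> carrier CG \<Longrightarrow> h \<in> carrier CG \<Longrightarrow> lin_ext (f \<oplus>\<^bsub>CG\<^esub> h) u = lin_ext f u + lin_ext h u"
  unfolding group_algebra_simps by (rule lin_ext_add) auto

lemma support_carrier: "f \<in> carrier CG \<Longrightarrow> f a \<noteq> 0 \<Longrightarrow> a \<in> carrier G"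
  by (auto simp: group_algebra_simps)

lemma ring_group_algebra: "ring CG"
proof (rule ringI)
  show "abelian_group CG"
  proof (rule abelian_groupI)
    fix f h assume fh: "f \<in> carrier CG" "h \<in> carrier CG"
    thus "f \<oplus>\<^bsub>CG\<^esub> h \<in> carrier CG" by (rule group_algebra_add_closed)
    show "f \<oplus>\<^bsub>CG\<^esub> h = h \<oplus>\<^bsub>CG\<^esub> f" by (simp add: group_algebra_simps add.commute)
  next
    fix f assume "f \<in> carrier CG"
    thus "\<exists>h\<in>carrier CG. h \<oplus>\<^bsub>CG\<^esub> f = \<zero>\<^bsub>CG\<^esub>"
      by (intro bexI[of _ "\<lambda>g. - f g"]) (auto simp: group_algebra_simps)
  qed (auto simp: group_algebra_simps add.assoc)
  show "Group.monoid CG"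
  proof (rule monoidI)
    fix f g h assume fgh: "f \<in> carrier CG" "g \<in> carrier CG" "h \<in> carrier CG"
    show "f \<otimes>\<^bsub>CG\<^esub> g \<otimes>\<^bsub>CG\<^esub> h = f \<otimes>\<^bsub>CG\<^esub> (g \<otimes>\<^bsub>CG\<^esub> h)"
    proof (rule group_algebra_eqI[where G = G])
      fix u
      have "lin_ext (f \<otimes>\<^bsub>CG\<^esub> g \<otimes>\<^bsub>CG\<^esub> h) u = lin_ext f (\<lambda>a. lin_ext g (\<lambda>b. lin_ext h (\<lambda>c. u (a \<otimes> b \<otimes> c))))"
        using fgh by (simp add: lin_ext_mult group_algebra_mult_closed)
      also have "\<dots> = lin_ext f (\<lambda>a. lin_ext g (\<lambda>b. lin_ext h (\<lambda>c. u (a \<otimes> (b \<otimes> c)))))"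
        using fgh by (intro lin_ext_cong) (simp add: m_assoc support_carrier)
      finally show "lin_ext (f \<otimes>\<^bsub>CG\<^esub> g \<otimes>\<^bsub>CG\<^esub> h) u = lin_ext (f \<otimes>\<^bsub>CG\<^esub> (g \<otimes>\<^bsub>CG\<^esub> h)) u"
        using fgh by (simp add: lin_ext_mult group_algebra_mult_closed)
    qed (use fgh in \<open>simp_all add: group_algebra_mult_closed\<close>)
  next
    fix f assume f: "f \<in> carrier CG"
    have one: "\<one>\<^bsub>CG\<^esub> \<in> carrier CG" by (simp add: group_algebra_simps(2) single_carrier)
    show "\<one>\<^bsub>CG\<^esub> \<otimes>\<^bsub>CG\<^esub> f = f"
    proof (rule group_algebra_eqI[where G = G])
      fix u
      have "lin_ext (\<one>\<^bsub>CG\<^esub> \<otimes>\<^bsub>CG\<^esub> f) u = lin_ext f (\<lambda>b. u (\<one> \<otimes> b))"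
        using f one by (simp add: lin_ext_mult) (simp add: group_algebra_simps(2))
      also have "\<dots> = lin_ext f u" using f by (intro lin_ext_cong) (simp add: support_carrier)
      finally show "lin_ext (\<one>\<^bsub>CG\<^esub> \<otimes>\<^bsub>CG\<^esub> f) u = lin_ext f u" .
    qed (use f one in \<open>simp_all add: group_algebra_mult_closed\<close>)
    show "f \<otimes>\<^bsub>CG\<^esub> \<one>\<^bsub>CG\<^esub> = f"
    proof (rule group_algebra_eqI[where G = G])
      fix u
      have "lin_ext (f \<otimes>\<^bsub>CG\<^esub> \<one>\<^bsub>CG\<^esub>) u = lin_ext f (\<lambda>a. u (a \<otimes> \<one>))"
        using f one by (simp add: lin_ext_mult) (simp add: group_algebra_simps(2))
      also have "\<dots> = lin_ext f u" using f by (intro lin_ext_cong) (simp add: support_carrier)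
      finally show "lin_ext (f \<otimes>\<^bsub>CG\<^esub> \<one>\<^bsub>CG\<^esub>) u = lin_ext f u" .
    qed (use f one in \<open>simp_all add: group_algebra_mult_closed\<close>)
  qed (simp_all add: group_algebra_mult_closed group_algebra_simps(2) single_carrier)
next
  fix f g h assume fgh: "f \<in> carrier CG" "g \<in> carrier CG" "h \<in> carrier CG"
  note c = fgh group_algebra_mult_closed group_algebra_add_closed
  show "(f \<oplus>\<^bsub>CG\<^esub> g) \<otimes>\<^bsub>CG\<^esub> h = f \<otimes>\<^bsub>CG\<^esub> h \<oplus>\<^bsub>CG\<^esub> g \<otimes>\<^bsub>CG\<^esub> h"
    by (rule group_algebra_eqI[where G = G]) (simp_all add: c lin_ext_mult lin_ext_plus)
  show "h \<otimes>\<^bsub>CG\<^esub> (f \<oplus>\<^bsub>CG\<^esub> g) = h \<otimes>\<^bsub>CG\<^esub> f \<oplus>\<^bsub>CG\<^esub> h \<otimes>\<^bsub>CG\<^esub> g"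
    by (rule group_algebra_eqI[where G = G]) (simp_all add: c lin_ext_mult lin_ext_plus lin_ext_add_right)
qed

lemma single_mult:
  assumes "a \<in> carrier G" "b \<in> carrier G"
  shows "single a c \<otimes>\<^bsub>CG\<^esub> single b d = single (a \<otimes> b) (c * d)"
  using assms by (intro group_algebra_eqI[where G = G])
    (simp_all add: single_carrier group_algebra_mult_closed lin_ext_mult mult.assoc)

end

section \<open>Representations of the cubic Hecke algebra\<close>

text \<open>The structure of the quotient ring is only used through the composite
  \<open>\<complex>[B] \<rightarrow> H \<rightarrow> End V\<close>, which is a ring homomorphism that kills the cubic relators.\<close>

lemma cubic_hecke_hom:
  fixes W :: "('w, 'm) monoid_scheme" and scale :: "complex \<Rightarrow> 'v::ab_group_add \<Rightarrow> 'v"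
  assumes rep: "cubic_hecke_rep W S q scale \<phi>"
  defines "A \<equiv> group_algebra (braid_group W S)"
  defines "\<Psi> \<equiv> (\<lambda>f. \<phi> (hecke_class W S q f))"
  shows "\<Psi> \<in> Ring.ring_hom A (End_ring scale)" and "s \<in> S \<Longrightarrow> \<Psi> (cubic_relator W S q s) = (\<lambda>v. 0)"
proof -
  let ?B = "braid_group W S"
  let ?I = "cubic_ideal W S q"
  interpret B: Group.monoid ?B unfolding braid_group_def by (rule monoid_presented_group)
  interpret A: ring A unfolding A_def by (rule B.ring_group_algebra)
  have gen: "braid_gen W S s \<in> carrier ?B" if "s \<in> S" for s
    using that by (auto simp: braid_group_def braid_gen_def pres_gen_def pres_carrier)
  have rel: "cubic_relator W S q s \<in> carrier A" if "s \<in> S" for s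
    using single_carrier[OF gen[OF that]] single_carrier[OF B.one_closed]
    unfolding cubic_relator_def Let_def A_def[symmetric] by simp
  have I: "?I = Idl\<^bsub>A\<^esub> (cubic_relator W S q ` S)" by (simp add: cubic_ideal_def A_def)
  interpret I: ideal ?I A unfolding I by (rule A.genideal_ideal) (use rel in auto)
  have cls: "hecke_class W S q = (+>\<^bsub>A\<^esub>) ?I" by (rule ext) (simp add: hecke_class_def A_def)
  have H: "cubic_hecke W S q = A Quot ?I" by (simp add: cubic_hecke_def A_def)
  have "\<phi> \<in> Ring.ring_hom (A Quot ?I) (End_ring scale)" using rep by (simp add: cubic_hecke_rep_def H)
  from ring_hom_trans[OF I.rcos_ring_hom this]
  show hom: "\<Psi> \<in> Ring.ring_hom A (End_ring scale)" by (simp add: \<Psi>_def cls comp_def)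
  have zero: "\<Psi> \<zero>\<^bsub>A\<^esub> v = 0" for v
  proof -
    have "\<Psi> (\<zero>\<^bsub>A\<^esub> \<oplus>\<^bsub>A\<^esub> \<zero>\<^bsub>A\<^esub>) = (\<lambda>v. \<Psi> \<zero>\<^bsub>A\<^esub> v + \<Psi> \<zero>\<^bsub>A\<^esub> v)"
      using ring_hom_add[OF hom A.zero_closed A.zero_closed] by (simp add: End_ring_def)
    hence "\<Psi> \<zero>\<^bsub>A\<^esub> v = \<Psi> \<zero>\<^bsub>A\<^esub> v + \<Psi> \<zero>\<^bsub>A\<^esub> v" by (simp add: fun_eq_iff)
    thus ?thesis by simp
  qed
  show "\<Psi> (cubic_relator W S q s) = (\<lambda>v. 0)" if "s \<in> S"
  proof -
    have "cubic_relator W S q s \<in> ?I" unfolding I using A.genideal_self[of "cubic_relator W S q ` S"] rel that by blast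
    hence "hecke_class W S q (cubic_relator W S q s) = ?I" unfolding cls by (rule I.a_rcos_const)
    moreover have "hecke_class W S q \<zero>\<^bsub>A\<^esub> = ?I"
      unfolding cls by (rule I.a_rcos_const) (rule additive_subgroup.zero_closed[OF I.is_additive_subgroup])
    ultimately show ?thesis using zero by (simp add: \<Psi>_def fun_eq_iff)
  qed
qed

text \<open>What the theorem needs from a representation of the cubic Hecke algebra: an action of the
  braid group by linear maps in which the generators satisfy the cubic equation.\<close>

lemma braid_action_properties:
  fixes W :: "('w, 'm) monoid_scheme" and scale :: "complex \<Rightarrow> 'v::ab_group_add \<Rightarrow> 'v"
  assumes rep: "cubic_hecke_rep W S q scale \<phi>"
  defines "\<rho> \<equiv> braid_action W S q \<phi>"
  shows "x \<in> carrier (braid_group W S) \<Longrightarrow> Vector_Spaces.linear scale scale (\<rho> x)"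
    and "x \<in> carrier (braid_group W S) \<Longrightarrow> y \<in> carrier (braid_group W S)
      \<Longrightarrow> \<rho> (x \<otimes>\<^bsub>braid_group W S\<^esub> y) = \<rho> x \<circ> \<rho> y"
    and "\<rho> \<one>\<^bsub>braid_group W S\<^esub> = id"
    and "s \<in> S \<Longrightarrow> \<rho> (braid_gen W S s) (\<rho> (braid_gen W S s) (\<rho> (braid_gen W S s) v))
      = scale q (\<rho> (braid_gen W S s) (\<rho> (braid_gen W S s) v)) + \<rho> (braid_gen W S s) v - scale q v"
proof -
  let ?B = "braid_group W S"
  let ?A = "group_algebra ?B"
  let ?\<Psi> = "\<lambda>f. \<phi> (hecke_class W S q f)"
  interpret B: Group.monoid ?B unfolding braid_group_def by (rule monoid_presented_group)
  interpret A: ring ?A by (rule B.ring_group_algebra)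
  note hom = cubic_hecke_hom(1)[OF rep]
  have \<rho>: "\<rho> b = ?\<Psi> (single b 1)" for b by (simp add: \<rho>_def braid_action_def)
  show lin: "Vector_Spaces.linear scale scale (\<rho> x)" if "x \<in> carrier ?B" for x
    using ring_hom_closed[OF hom single_carrier[OF that, of 1]] by (simp add: \<rho> End_ring_def)
  show mult: "\<rho> (x \<otimes>\<^bsub>?B\<^esub> y) = \<rho> x \<circ> \<rho> y" if "x \<in> carrier ?B" "y \<in> carrier ?B" for x y
    using ring_hom_mult[OF hom single_carrier[OF that(1)] single_carrier[OF that(2)], of 1 1] that
    by (simp add: \<rho> B.single_mult) (simp add: End_ring_def)
  show "\<rho> \<one>\<^bsub>?B\<^esub> = id"
    using ring_hom_one[OF hom] by (simp add: \<rho> group_algebra_simps) (simp add: End_ring_def)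
  assume s: "s \<in> S"
  let ?g = "braid_gen W S s"
  have g: "?g \<in> carrier ?B" using s by (auto simp: braid_group_def braid_gen_def pres_gen_def pres_carrier)
  have minus: "?\<Psi> (f \<ominus>\<^bsub>?A\<^esub> h) w = ?\<Psi> f w - ?\<Psi> h w" if "f \<in> carrier ?A" "h \<in> carrier ?A" for f h w
  proof -
    have "f \<ominus>\<^bsub>?A\<^esub> h \<oplus>\<^bsub>?A\<^esub> h = f"
      using that by (simp add: A.minus_eq A.a_assoc A.l_neg)
    hence "?\<Psi> f = ?\<Psi> (f \<ominus>\<^bsub>?A\<^esub> h \<oplus>\<^bsub>?A\<^esub> h)" by simp
    also have "\<dots> = (\<lambda>v. ?\<Psi> (f \<ominus>\<^bsub>?A\<^esub> h) v + ?\<Psi> h v)"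
      using ring_hom_add[OF hom A.minus_closed[OF that] that(2)] by (simp add: End_ring_def)
    finally show ?thesis by simp
  qed
  let ?T = "single ?g 1" and ?Q = "single \<one>\<^bsub>?B\<^esub> q"
  note c = single_carrier[OF g, of 1] single_carrier[OF B.one_closed, of q]
  have one: "?\<Psi> \<one>\<^bsub>?A\<^esub> = id" using ring_hom_one[OF hom] by (simp add: End_ring_def)
  have Q: "?\<Psi> ?Q = scale q" using rep by (simp add: cubic_hecke_rep_def)
  let ?w = "?\<Psi> (?T \<otimes>\<^bsub>?A\<^esub> ?T \<ominus>\<^bsub>?A\<^esub> \<one>\<^bsub>?A\<^esub>) v"
  have w: "?w = \<rho> ?g (\<rho> ?g v) - v"
    using c ring_hom_mult[OF hom c(1) c(1)]
    by (simp add: minus one \<rho>) (simp add: End_ring_def)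
  have "0 = ?\<Psi> (cubic_relator W S q s) v" using cubic_hecke_hom(2)[OF rep s] by (simp add: fun_eq_iff)
  also have "\<dots> = ?\<Psi> (?T \<ominus>\<^bsub>?A\<^esub> ?Q) ?w"
    using ring_hom_mult[OF hom, of "?T \<ominus>\<^bsub>?A\<^esub> ?Q" "?T \<otimes>\<^bsub>?A\<^esub> ?T \<ominus>\<^bsub>?A\<^esub> \<one>\<^bsub>?A\<^esub>"] c
    by (simp add: cubic_relator_def Let_def) (simp add: End_ring_def)
  also have "\<dots> = \<rho> ?g ?w - scale q ?w" using c by (simp add: minus Q \<rho>)
  finally have eq: "\<rho> ?g (\<rho> ?g (\<rho> ?g v) - v) = scale q (\<rho> ?g (\<rho> ?g v) - v)" by (simp add: w)
  interpret g: Vector_Spaces.linear scale scale "\<rho> ?g" by (rule lin[OF g])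
  show "\<rho> ?g (\<rho> ?g (\<rho> ?g v)) = scale q (\<rho> ?g (\<rho> ?g v)) + \<rho> ?g v - scale q v"
    using eq by (simp add: g.diff g.vs1.scale_right_diff_distrib algebra_simps)
qed

section \<open>From representations of the Hecke algebra to good representations\<close>

lemma sum_fun_apply: "(\<Sum>a\<in>A. f a) x = (\<Sum>a\<in>A. f a x)"
  by (induction A rule: infinite_finite_induct) (simp_all add: zero_fun_def plus_fun_def)

locale hecke_rep = coxeter W S for W (structure) and S +
  fixes q :: complex and scale :: "complex \<Rightarrow> 'v::ab_group_add \<Rightarrow> 'v" and \<phi>
  assumes rep: "cubic_hecke_rep W S q scale \<phi>"
begin

interpretation V: vector_space scale
  using rep by (simp add: cubic_hecke_rep_def)

abbreviation \<rho> where "\<rho> \<equiv> braid_action W S q \<phi>"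
abbreviation B where "B \<equiv> braid_group W S"
abbreviation gen where "gen \<equiv> braid_gen W S"

definition \<sigma> :: "'a \<Rightarrow> 'v aend" where "\<sigma> s = Aend (\<rho> (gen s))"

definition k :: "complex \<Rightarrow> 'v aend" where "k c = Aend (scale c)"

interpretation B: Group.monoid B
  unfolding braid_group_def by (rule monoid_presented_group)

lemma gen_closed: "s \<in> S \<Longrightarrow> gen s \<in> carrier B"
  by (auto simp: braid_group_def braid_gen_def pres_gen_def pres_carrier)

lemma app_rho: assumes "x \<in> carrier B"
  shows "app (Aend (\<rho> x)) = \<rho> x" "\<rho> x (scale c v) = scale c (\<rho> x v)"
proof -
  interpret x: Vector_Spaces.linear scale scale "\<rho> x" by (rule braid_action_properties(1)[OF rep assms])
  show "app (Aend (\<rho> x)) = \<rho> x" by (rule app_Aend) (rule x.add)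
  show "\<rho> x (scale c v) = scale c (\<rho> x v)" by (rule x.scale)
qed

lemma app_\<sigma>: "s \<in> S \<Longrightarrow> app (\<sigma> s) = \<rho> (gen s)"
  unfolding \<sigma>_def by (rule app_rho[OF gen_closed])

lemma app_k: "app (k c) = scale c"
  unfolding k_def by (rule app_Aend) (rule V.scale_right_distrib)

sublocale complex_ring k
proof
  show "k (x + y) = k x + k y" "k (x * y) = k x * k y" for x y
    by (rule aend_eqI; simp add: app_k V.scale_left_distrib)+
  show "k 1 = 1" by (rule aend_eqI) (simp add: app_k)
qed

lemma \<sigma>_lin: "s \<in> S \<Longrightarrow> \<sigma> s \<in> lin"
  unfolding lin_def by (auto intro!: aend_eqI simp: app_k app_\<sigma> app_rho(2)[OF gen_closed])

lemma \<sigma>_cubic: "s \<in> S \<Longrightarrow> \<sigma> s * \<sigma> s * \<sigma> s = k q * (\<sigma> s * \<sigma> s) + \<sigma> s - k q"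
  by (rule aend_eqI) (simp add: app_k app_\<sigma> braid_action_properties(4)[OF rep])

lemma foldr_gen:
  assumes "set ss \<subseteq> S"
  shows "foldr (\<otimes>\<^bsub>B\<^esub>) (map gen ss) \<one>\<^bsub>B\<^esub> = pres_class S (braid_rels W S) (map (\<lambda>s. (s, True)) ss)"
    and "foldr (\<otimes>\<^bsub>B\<^esub>) (map gen ss) \<one>\<^bsub>B\<^esub> \<in> carrier B"
    and "\<rho> (foldr (\<otimes>\<^bsub>B\<^esub>) (map gen ss) \<one>\<^bsub>B\<^esub>) = app (prod_list (map \<sigma> ss))"
proof -
  have "foldr (\<otimes>\<^bsub>B\<^esub>) (map gen ss) \<one>\<^bsub>B\<^esub> = pres_class S (braid_rels W S) (map (\<lambda>s. (s, True)) ss) \<and>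
    foldr (\<otimes>\<^bsub>B\<^esub>) (map gen ss) \<one>\<^bsub>B\<^esub> \<in> carrier B \<and>
    \<rho> (foldr (\<otimes>\<^bsub>B\<^esub>) (map gen ss) \<one>\<^bsub>B\<^esub>) = app (prod_list (map \<sigma> ss))"
    using assms
  proof (induction ss)
    case Nil
    show ?case using braid_action_properties(3)[OF rep]
      by (simp add: fun_eq_iff) (simp add: braid_group_def pres_one)
  next
    case (Cons s ss)
    let ?w = "foldr (\<otimes>\<^bsub>B\<^esub>) (map gen ss) \<one>\<^bsub>B\<^esub>"
    have s: "s \<in> S" and IH: "?w = pres_class S (braid_rels W S) (map (\<lambda>s. (s, True)) ss)"
      "?w \<in> carrier B" "\<rho> ?w = app (prod_list (map \<sigma> ss))" using Cons by auto
    have "map (\<lambda>s. (s, True)) ss \<in> words S" using Cons.prems by (auto simp: words_def)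
    hence "gen s \<otimes>\<^bsub>B\<^esub> ?w = pres_class S (braid_rels W S) (map (\<lambda>s. (s, True)) (s # ss))"
      unfolding IH(1) using s pres_mult[of "[(s, True)]" S "map (\<lambda>s. (s, True)) ss"]
      by (simp add: braid_group_def braid_gen_def pres_gen_def)
    moreover have "\<rho> (gen s \<otimes>\<^bsub>B\<^esub> ?w) = app (prod_list (map \<sigma> (s # ss)))"
      using braid_action_properties(2)[OF rep gen_closed[OF s] IH(2)] IH(3) app_\<sigma>[OF s]
      by (simp add: fun_eq_iff)
    ultimately show ?case using B.m_closed[OF gen_closed[OF s] IH(2)] by simp
  qed
  thus "foldr (\<otimes>\<^bsub>B\<^esub>) (map gen ss) \<one>\<^bsub>B\<^esub> = pres_class S (braid_rels W S) (map (\<lambda>s. (s, True)) ss)"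
    "foldr (\<otimes>\<^bsub>B\<^esub>) (map gen ss) \<one>\<^bsub>B\<^esub> \<in> carrier B"
    "\<rho> (foldr (\<otimes>\<^bsub>B\<^esub>) (map gen ss) \<one>\<^bsub>B\<^esub>) = app (prod_list (map \<sigma> ss))" by blast+
qed

lemma braided_\<sigma>: "braided \<sigma>"
  unfolding braided_def
proof (intro ballI)
  fix s t assume st: "s \<in> S" "t \<in> S"
  let ?m = "ord (s \<otimes> t)"
  have pos: "map (\<lambda>s. (s, True)) (alt_list m a b) = alternating m a b" for m and a b :: 'a
    by (induction m a b rule: alt_list.induct) auto
  have sub: "set (alt_list ?m s t) \<subseteq> S" "set (alt_list ?m t s) \<subseteq> S"
    using set_alt_list[of ?m s t] set_alt_list[of ?m t s] st by auto
  have words: "alternating ?m s t \<in> words S" "alternating ?m t s \<in> words S"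
    unfolding pos[symmetric] using sub by (auto simp: words_def)
  have "(alternating ?m s t, alternating ?m t s) \<in> braid_rels W S" using st by (auto simp: braid_rels_def)
  from pres_equiv.rel[OF this words, of "[]" "[]"]
  have "pres_class S (braid_rels W S) (alternating ?m s t) = pres_class S (braid_rels W S) (alternating ?m t s)"
    using words by (simp add: pres_class_eq)
  hence "app (prod_list (map \<sigma> (alt_list ?m s t))) = app (prod_list (map \<sigma> (alt_list ?m t s)))"
    using foldr_gen(1,3)[OF sub(1)] foldr_gen(1,3)[OF sub(2)] unfolding pos by metis
  thus "prod_list (map \<sigma> (alt_list ?m s t)) = prod_list (map \<sigma> (alt_list ?m t s))"
    by (simp add: app_inject)
qed

lemma \<sigma>_inverse:
  assumes "s \<in> S" obtains s' where "s' \<in> lin" "\<sigma> s * s' = 1" "s' * \<sigma> s = 1"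
proof -
  let ?R = "braid_rels W S"
  let ?i = "pres_class S ?R [(s, False)]"
  have g: "gen s = pres_class S ?R [(s, True)]" by (simp add: braid_gen_def pres_gen_def)
  have i: "?i \<in> carrier B" using assms by (auto simp: braid_group_def pres_carrier)
  have "pres_class S ?R [(s, e), (s, \<not> e)] = pres_class S ?R []" for e
    using pres_equiv.cancel[of s S "[]" "[]" ?R e] assms by (subst pres_class_eq) simp_all
  from this[of True] this[of False]
  have "gen s \<otimes>\<^bsub>B\<^esub> ?i = \<one>\<^bsub>B\<^esub>" "?i \<otimes>\<^bsub>B\<^esub> gen s = \<one>\<^bsub>B\<^esub>"
    using assms by (simp_all add: g braid_group_def pres_mult pres_one)
  hence "\<rho> (gen s) \<circ> \<rho> ?i = id" "\<rho> ?i \<circ> \<rho> (gen s) = id"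
    using braid_action_properties(2)[OF rep gen_closed[OF assms] i]
      braid_action_properties(2)[OF rep i gen_closed[OF assms]] braid_action_properties(3)[OF rep] by simp_all
  hence "\<sigma> s * Aend (\<rho> ?i) = 1" "Aend (\<rho> ?i) * \<sigma> s = 1"
    by (auto intro!: aend_eqI simp: app_\<sigma>[OF assms] app_rho(1)[OF i] fun_eq_iff)
  moreover have "Aend (\<rho> ?i) \<in> lin"
    unfolding lin_def by (auto intro!: aend_eqI simp: app_k app_rho[OF i])
  ultimately show ?thesis using that by blast
qed

lemma \<sigma>_quadratic:
  assumes "s \<in> S" "s' \<in> lin" "\<sigma> s * s' = 1"
  shows "\<sigma> s * \<sigma> s = k q * \<sigma> s + k 1 + k (- q) * s'"
proof -
  have "\<sigma> s * \<sigma> s = \<sigma> s * \<sigma> s * \<sigma> s * s'" using assms(3) by (simp add: mult.assoc)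
  also have "\<dots> = (k q * (\<sigma> s * \<sigma> s) + \<sigma> s - k q) * s'" by (simp only: \<sigma>_cubic[OF assms(1)])
  also have "\<dots> = k q * \<sigma> s + k 1 + k (- q) * s'"
    using assms(3) by (simp add: left_diff_distrib distrib_right mult.assoc k_one k_uminus)
  finally show ?thesis .
qed

text \<open>In types \<open>A\<^sub>1\<close> and \<open>A\<^sub>2\<close> the relations of \<open>B\<^sub>4\<close> hold after repeating a generator.\<close>

lemma finite_dimensional:
  fixes n :: nat
  assumes "q \<noteq> 0" "n \<le> 3" and g: "bij_betw g {1..n} S"
    and ord: "\<forall>i\<in>{1..n}. \<forall>j\<in>{1..n}. i < j \<longrightarrow> ord (g i \<otimes> g j) = (if j = i + 1 then 3 else 2)"
  shows "\<exists>F H. finite F \<and> vs.subspace H \<and> H \<subseteq> vs.span F \<and> H \<subseteq> lin \<and> 1 \<in> H \<and> (\<forall>x\<in>H. \<forall>s\<in>S. x * \<sigma> s \<in> H)"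
proof (cases "n = 0")
  case True
  hence "S = {}" using g by (simp add: bij_betw_def)
  have "vs.span {1} \<subseteq> lin" by (rule span_subset_lin) simp
  thus ?thesis using \<open>S = {}\<close> vs.span_base[of 1 "{1}"]
    by (intro exI[of _ "{1}"] exI[of _ "vs.span {1}"]) simp
next
  case False
  have gS: "g i \<in> S" if "i \<in> {1..n}" for i using g that by (auto simp: bij_betw_def)
  have braid: "\<sigma> (g i) * \<sigma> (g j) * \<sigma> (g i) = \<sigma> (g j) * \<sigma> (g i) * \<sigma> (g j)"
    if "i \<in> {1..n}" "j \<in> {1..n}" "j = i + 1" for i j
  proof -
    have "ord (g i \<otimes> g j) = Suc (Suc (Suc 0))" using ord that by simp
    moreover have "prod_list (map \<sigma> (alt_list (ord (g i \<otimes> g j)) (g i) (g j)))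
        = prod_list (map \<sigma> (alt_list (ord (g i \<otimes> g j)) (g j) (g i)))"
      using braided_\<sigma> gS[OF that(1)] gS[OF that(2)] unfolding braided_def by blast
    ultimately show ?thesis
      by (simp only: alt_list.simps list.map prod_list.Cons prod_list.Nil mult_1_right mult.assoc)
  qed
  have comm: "\<sigma> (g i) * \<sigma> (g j) = \<sigma> (g j) * \<sigma> (g i)"
    if "i \<in> {1..n}" "j \<in> {1..n}" "i + 1 < j" for i j
  proof -
    have "ord (g i \<otimes> g j) = Suc (Suc 0)" using ord that by simp
    moreover have "prod_list (map \<sigma> (alt_list (ord (g i \<otimes> g j)) (g i) (g j)))
        = prod_list (map \<sigma> (alt_list (ord (g i \<otimes> g j)) (g j) (g i)))"
      using braided_\<sigma> gS[OF that(1)] gS[OF that(2)] unfolding braided_def by blast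
    ultimately show ?thesis
      by (simp only: alt_list.simps list.map prod_list.Cons prod_list.Nil mult_1_right)
  qed
  define i2 i3 :: nat where "i2 = (if n = 1 then 1 else 2)" and "i3 = (if n = 3 then 3 else 1)"
  let ?a = "g 1" and ?b = "g i2" and ?c = "g i3"
  have S: "?a \<in> S" "?b \<in> S" "?c \<in> S" using gS False assms(2) by (simp_all add: i2_def i3_def)
  have gen: "S \<subseteq> {?a, ?b, ?c}"
  proof
    fix s assume "s \<in> S"
    then obtain i where i: "s = g i" "1 \<le> i" "i \<le> n" using g by (auto simp: bij_betw_def)
    hence "i = 1 \<or> i = i2 \<or> i = i3" using assms(2) False by (auto simp: i2_def i3_def)
    thus "s \<in> {?a, ?b, ?c}" using i by auto
  qed
  have ab: "\<sigma> ?a * \<sigma> ?b * \<sigma> ?a = \<sigma> ?b * \<sigma> ?a * \<sigma> ?b"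
  proof (cases "n = 1")
    case True
    hence i2: "i2 = 1" by (simp add: i2_def)
    show ?thesis unfolding i2 ..
  next
    case False
    hence i2: "i2 = 2" by (simp add: i2_def)
    show ?thesis unfolding i2 by (rule braid) (use False \<open>n \<noteq> 0\<close> in auto)
  qed
  have bc: "\<sigma> ?b * \<sigma> ?c * \<sigma> ?b = \<sigma> ?c * \<sigma> ?b * \<sigma> ?c"
  proof (cases "n = 3")
    case True
    hence i: "i2 = 2" "i3 = 3" by (simp_all add: i2_def i3_def)
    show ?thesis unfolding i by (rule braid) (use True in auto)
  next
    case False
    hence i3: "i3 = 1" by (simp add: i3_def)
    show ?thesis unfolding i3 by (rule ab[symmetric])
  qed
  have ac: "\<sigma> ?a * \<sigma> ?c = \<sigma> ?c * \<sigma> ?a"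
  proof (cases "n = 3")
    case True
    hence i3: "i3 = 3" by (simp add: i3_def)
    show ?thesis unfolding i3 by (rule comm) (use True in auto)
  next
    case False
    hence i3: "i3 = 1" by (simp add: i3_def)
    show ?thesis unfolding i3 ..
  qed
  obtain a' where a': "a' \<in> lin" "\<sigma> ?a * a' = 1" "a' * \<sigma> ?a = 1" by (rule \<sigma>_inverse[OF S(1)])
  obtain b' where b': "b' \<in> lin" "\<sigma> ?b * b' = 1" "b' * \<sigma> ?b = 1" by (rule \<sigma>_inverse[OF S(2)])
  obtain c' where c': "c' \<in> lin" "\<sigma> ?c * c' = 1" "c' * \<sigma> ?c = 1" by (rule \<sigma>_inverse[OF S(3)])
  have nz: "- q \<noteq> 0" using assms(1) by simp
  interpret b4: braid4 k "\<sigma> ?a" "\<sigma> ?b" "\<sigma> ?c" a' b' c' q 1 "- q"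
    by unfold_locales
      (rule \<sigma>_lin[OF S(1)] \<sigma>_lin[OF S(2)] \<sigma>_lin[OF S(3)] a' b' c' ab bc ac nz
        \<sigma>_quadratic[OF S(1) a'(1,2)] \<sigma>_quadratic[OF S(2) b'(1,2)] \<sigma>_quadratic[OF S(3) c'(1,2)])+
  obtain F H where FH: "finite F" "vs.subspace H" "H \<subseteq> vs.span F" "H \<subseteq> lin" "1 \<in> H"
      "\<And>x y. x \<in> H \<Longrightarrow> y \<in> {\<sigma> ?a, \<sigma> ?b, \<sigma> ?c} \<Longrightarrow> x * y \<in> H"
    using b4.finite_span by metis
  have "x * \<sigma> s \<in> H" if "x \<in> H" "s \<in> S" for x s using FH(6)[OF that(1), of "\<sigma> s"] gen that(2) by blast
  thus ?thesis using FH by blast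
qed

text \<open>Exchanging \<open>s \<in> I\<close> in the word writes \<open>s\<close> as a product of letters of the word, and a generator in a
  parabolic subgroup is one of its generators.\<close>

lemma letters_of_longest:
  assumes "I \<subseteq> S" "longest I w0" "reduced ws" "ev ws = w0" shows "I \<subseteq> set ws"
proof
  fix s assume s: "s \<in> I"
  have ws: "set ws \<subseteq> S" using assms(3) by (simp add: reduced_def)
  have sS: "s \<in> S" using s assms(1) by blast
  have "len (s \<otimes> ev ws) < len (ev ws)"
    unfolding assms(4) longest_descent(2)[OF assms(1,2) s] by (rule lessI)
  then obtain us x vs where *: "ws = us @ x # vs" "s \<otimes> ev ws = ev (us @ vs)"
    by (rule exchange[OF S_reflections[OF sS] ws])
  have "s \<otimes> ev ws \<otimes> inv (ev ws) = s" using sS ws by (simp add: m_assoc)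
  moreover have "ev (us @ vs) \<in> par (set ws)" by (rule par_I) (auto simp: *(1))
  moreover have "inv (ev ws) \<in> par (set ws)" by (rule par_inv[OF ws par_I[OF order_refl]])
  ultimately have "s \<in> par (set ws)" using par_mult[OF ws] *(2) by metis
  then obtain ss where ss: "set ss \<subseteq> set ws" "reduced ss" "ev ss = s" by (rule par_reduced[OF ws])
  hence "length ss = 1" using len_S[OF sS] by (simp add: reduced_def)
  then obtain y where y: "ss = [y]" by (auto simp: length_Suc_conv)
  have "y \<in> set ws" "y \<in> S" using ss(1) ws unfolding y by auto
  moreover from this have "y = s" using ss(3) unfolding y by simp
  ultimately show "s \<in> set ws" by simp
qed

text \<open>For \<open>q = 0\<close> the cubic equation forces \<open>s\<^sup>2 = 1\<close>, as \<open>s\<close> is invertible, and there is nothing to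
  annihilate. Otherwise the image of the group algebra is finite-dimensional and determinants apply.\<close>

lemma full_twist_invertible:
  fixes n :: nat
  assumes q: "\<forall>m>0. q ^ m \<noteq> 1" and n: "n \<le> 3" "bij_betw g {1..n} S"
    "\<forall>i\<in>{1..n}. \<forall>j\<in>{1..n}. i < j \<longrightarrow> ord (g i \<otimes> g j) = (if j = i + 1 then 3 else 2)"
    and I: "I \<subseteq> S" and w0: "longest I w0"
  shows "\<exists>c h. c \<noteq> 0 \<and> (\<forall>s\<in>I. \<sigma> s * h = h * \<sigma> s \<and> (\<forall>v. scale c (app (\<sigma> s * \<sigma> s - 1) v) +
    app ((tau \<sigma> w0 * tau \<sigma> w0 - 1) * h * (\<sigma> s * \<sigma> s - 1)) v = 0))"
proof (cases "q = 0")
  case True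
  have E: "\<sigma> s * \<sigma> s - 1 = 0" if s: "s \<in> S" for s
  proof -
    obtain s' where s': "s' \<in> lin" "\<sigma> s * s' = 1" "s' * \<sigma> s = 1" by (rule \<sigma>_inverse[OF s])
    from \<sigma>_quadratic[OF s s'(1,2)] show ?thesis by (simp add: True k_one)
  qed
  show ?thesis
  proof (rule exI[of _ 1], rule exI[of _ 0], intro conjI ballI allI)
    fix s v assume "s \<in> I"
    hence s: "s \<in> S" using I by blast
    show "scale 1 (app (\<sigma> s * \<sigma> s - 1) v) + app ((tau \<sigma> w0 * tau \<sigma> w0 - 1) * 0 * (\<sigma> s * \<sigma> s - 1)) v = 0"
      unfolding E[OF s] by simp
  qed simp_all
next
  case False
  obtain F H where FH: "finite F" "vs.subspace H" "H \<subseteq> vs.span F" "H \<subseteq> lin" "1 \<in> H"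
      "\<And>x s. x \<in> H \<Longrightarrow> s \<in> S \<Longrightarrow> x * \<sigma> s \<in> H"
    using finite_dimensional[OF False n] by blast
  obtain ws where ws: "set ws \<subseteq> I" "reduced ws" "ev ws = w0"
    by (rule par_reduced[OF I w0_par[OF I w0]])
  let ?xs = "map \<sigma> (ws @ ws)"
  let ?z = "tau \<sigma> w0 * tau \<sigma> w0"
  have set_ws: "set ws = I" using letters_of_longest[OF I w0 ws(2,3)] ws(1) by blast
  have z: "?z = prod_list ?xs" using tau_reduced[OF braided_\<sigma> ws(2,3)] by simp
  have "\<exists>c h. c \<noteq> 0 \<and> h \<in> lin \<and> (\<forall>x\<in>set ?xs. x * h = h * x \<and> (k c + (?z - 1) * h) * (x * x - 1) = 0)"
  proof (rule invertible_modulo_minus_one[of q H F ?xs ?z])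
    show "q ^ m \<noteq> 1" if "m > 0" for m using q that by blast
    show "set ?xs \<subseteq> lin" using I by (auto simp: set_ws \<sigma>_lin)
    show "h * x \<in> H" if "h \<in> H" "x \<in> set ?xs" for h x using that FH(6) I by (auto simp: set_ws)
    show "x * x * x = k q * (x * x) + x - k q" if "x \<in> set ?xs" for x
    proof -
      obtain s where "s \<in> S" "x = \<sigma> s" using \<open>x \<in> set ?xs\<close> I by (auto simp: set_ws)
      thus ?thesis using \<sigma>_cubic by blast
    qed
    show "?z * x = x * ?z" if "x \<in> set ?xs" for x
    proof -
      obtain s where "s \<in> I" "x = \<sigma> s" using \<open>x \<in> set ?xs\<close> by (auto simp: set_ws)
      thus ?thesis using tau_longest_square_commute[OF I w0 braided_\<sigma>] by blast
    qed
    show "vs.subspace H" "H \<subseteq> vs.span F" "finite F" "H \<subseteq> lin" "1 \<in> H" by (rule FH)+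
    show "?z = prod_list ?xs" by (rule z)
  qed
  then obtain c h where c: "c \<noteq> 0"
    and ch: "\<And>x. x \<in> set ?xs \<Longrightarrow> x * h = h * x \<and> (k c + (?z - 1) * h) * (x * x - 1) = 0" by blast
  have "\<sigma> s * h = h * \<sigma> s \<and>
      (\<forall>v. scale c (app (\<sigma> s * \<sigma> s - 1) v) + app ((?z - 1) * h * (\<sigma> s * \<sigma> s - 1)) v = 0)" if s: "s \<in> I" for s
  proof (intro conjI allI)
    have "\<sigma> s \<in> set ?xs" using s by (simp add: set_ws)
    note ch = ch[OF this]
    show "\<sigma> s * h = h * \<sigma> s" by (rule ch[THEN conjunct1])
    fix v
    have "app ((k c + (?z - 1) * h) * (\<sigma> s * \<sigma> s - 1)) v = 0" unfolding ch[THEN conjunct2] by simp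
    thus "scale c (app (\<sigma> s * \<sigma> s - 1) v) + app ((?z - 1) * h * (\<sigma> s * \<sigma> s - 1)) v = 0"
      by (simp only: app_ops(3,6) app_k)
  qed
  thus ?thesis using c by blast
qed

theorem good_representation:
  fixes n :: nat
  assumes q: "\<forall>m>0. q ^ m \<noteq> 1" and n: "n \<le> 3" "bij_betw g {1..n} S"
    "\<forall>i\<in>{1..n}. \<forall>j\<in>{1..n}. i < j \<longrightarrow> ord (g i \<otimes> g j) = (if j = i + 1 then 3 else 2)"
  shows "good W S scale \<rho>"
proof -
  have finite_W: "finite (carrier W)" by (rule type_A_finite[OF coxeter n(2,3)])
  interpret R: braid_rep W S scale \<sigma>
    by unfold_locales
      (use V.vector_space_axioms app_\<sigma> app_rho(2)[OF gen_closed] braided_\<sigma> finite_W in auto)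
  have "finite S" using n(2) bij_betw_finite by blast
  have main: "R.K_par S = range (R.symmetrizer S)"
    by (rule R.K_par_eq_range_symmetrizer[OF full_twist_invertible[OF q n] \<open>finite S\<close> order_refl])
  have Vs: "V_sub W S \<rho> s = R.Vs s" if s: "s \<in> S" for s
  proof -
    have "(\<lambda>v. \<rho> (gen s \<otimes>\<^bsub>B\<^esub> gen s) v - v) = app (\<sigma> s * \<sigma> s - 1)"
      using braid_action_properties(2)[OF rep gen_closed[OF s] gen_closed[OF s]]
      by (intro ext) (simp add: app_\<sigma>[OF s])
    thus ?thesis unfolding V_sub_def R.Vs_def by (simp only:)
  qed
  have "x (s \<otimes> w) - \<rho> (gen s) (x w) \<in> V_sub W S \<rho> s \<longleftrightarrow> x (s \<otimes> w) - app (\<sigma> s) (x w) \<in> R.Vs s"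
    if "s \<in> S" for x s w
    unfolding Vs[OF that] app_\<sigma>[OF that] ..
  hence K: "K_space W S \<rho> = R.K_par S"
    unfolding K_space_def R.K_par_def by blast
  have section_T: "\<rho> (canonical_section W S w) = app (tau \<sigma> w)" if w: "w \<in> carrier W" for w
  proof -
    let ?ss = "SOME ss. is_reduced_decomposition W S w ss"
    obtain ss where "reduced ss" "ev ss = w" by (rule reduced_word'[OF w])
    hence "is_reduced_decomposition W S w ss" unfolding is_reduced_decomposition_iff by (rule conjI)
    hence "is_reduced_decomposition W S w ?ss" by (rule someI)
    hence "set ?ss \<subseteq> S" unfolding is_reduced_decomposition_iff reduced_def by blast
    from foldr_gen(3)[OF this] show ?thesis unfolding canonical_section_def tau_def .
  qed
  have emb: "i_emb W S \<rho> y v w = (if w \<in> carrier W then app (tau \<sigma> (w \<otimes> inv y)) v else 0)"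
    if "y \<in> carrier W" for y v w
    using that section_T by (simp add: i_emb_def)
  have sum_emb: "R.symmetrizer S x w = (\<Sum>y\<in>carrier W. i_emb W S \<rho> y (x y) w)" for x w
  proof (cases "w \<in> carrier W")
    case True
    have "bij_betw (\<lambda>y. w \<otimes> inv y) (carrier W) (carrier W)"
      by (rule bij_betw_byWitness[where f' = "\<lambda>g. inv g \<otimes> w"])
        (use True in \<open>auto simp: inv_mult_group m_assoc\<close>)
    from sum.reindex_bij_betw[OF this, of "\<lambda>g. app (tau \<sigma> g) (x (inv g \<otimes> w))"]
    have "R.symmetrizer S x w = (\<Sum>y\<in>carrier W. app (tau \<sigma> (w \<otimes> inv y)) (x (inv (w \<otimes> inv y) \<otimes> w)))"
      using True by (simp add: R.symmetrizer_def par_S)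
    also have "\<dots> = (\<Sum>y\<in>carrier W. i_emb W S \<rho> y (x y) w)"
      using True by (intro sum.cong HOL.refl) (simp add: emb inv_mult_group m_assoc)
    finally show ?thesis .
  qed (simp add: R.symmetrizer_def i_emb_def)
  let ?scale = "\<lambda>c (x :: 'a \<Rightarrow> 'v) w. scale c (x w)"
  interpret F: Modules.module ?scale
    by unfold_locales
      (simp_all add: fun_eq_iff plus_fun_def V.scale_right_distrib V.scale_left_distrib)
  have "R.K_par S = F.span (\<Union>y\<in>carrier W. range (i_emb W S \<rho> y))" (is "_ = F.span ?E")
  proof
    show "F.span ?E \<subseteq> R.K_par S"
    proof (rule F.span_minimal)
      show "F.subspace (R.K_par S)"
        unfolding F.subspace_def
      proof (intro conjI ballI allI)
        show "0 \<in> R.K_par S" by (simp add: R.K_par_def zero_fun_def R.Vs_0)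
        show "x + y \<in> R.K_par S" if "x \<in> R.K_par S" "y \<in> R.K_par S" for x y
          using R.K_par_add[OF that] by (simp add: plus_fun_def)
        show "?scale c x \<in> R.K_par S" if "x \<in> R.K_par S" for c x
          by (rule R.K_par_scale[OF order_refl that])
      qed
      show "?E \<subseteq> R.K_par S"
      proof safe
        fix y v assume y: "y \<in> carrier W"
        have "i_emb W S \<rho> z (if z = y then v else 0) w = (if z = y then i_emb W S \<rho> y v w else 0)"
          if "z \<in> carrier W" for z w
          using emb[OF that, of 0 w] by (cases "z = y") simp_all
        hence "R.symmetrizer S (\<lambda>z. if z = y then v else 0) w = i_emb W S \<rho> y v w" for w
          using y finite_W by (simp add: sum_emb)
        hence "R.symmetrizer S (\<lambda>z. if z = y then v else 0) = i_emb W S \<rho> y v" by (rule ext)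
        thus "i_emb W S \<rho> y v \<in> R.K_par S" using R.symmetrizer_K_par[OF order_refl] by metis
      qed
    qed
    show "R.K_par S \<subseteq> F.span ?E"
    proof
      fix x assume "x \<in> R.K_par S"
      then obtain u where "x = R.symmetrizer S u" using main by blast
      hence "x = (\<Sum>y\<in>carrier W. i_emb W S \<rho> y (u y))"
        by (simp add: fun_eq_iff sum_fun_apply sum_emb)
      also have "\<dots> \<in> F.span ?E" by (intro F.span_sum F.span_base) blast
      finally show "x \<in> F.span ?E" .
    qed
  qed
  thus ?thesis unfolding good_def K .
qed

end

theorem theorem11p6p1:
  fixes W :: "('w, 'm) monoid_scheme" and S :: "'w set" and n :: nat and q :: complex
    and scale :: "complex \<Rightarrow> 'v::ab_group_add \<Rightarrow> 'v"
    and \<phi> :: "('w word set \<Rightarrow> complex) set \<Rightarrow> 'v \<Rightarrow> 'v"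
  assumes "coxeter_type_A n W S"
    and "n \<le> 3"
    and "\<forall>k>0. q ^ k \<noteq> 1"
    and "cubic_hecke_rep W S q scale \<phi>"
  shows "good W S scale (braid_action W S q \<phi>)"
proof -
  obtain g where g: "bij_betw g {1..n} S"
    "\<forall>i\<in>{1..n}. \<forall>j\<in>{1..n}. i < j \<longrightarrow> group.ord W (g i \<otimes>\<^bsub>W\<^esub> g j) = (if j = i + 1 then 3 else 2)"
    using assms(1) unfolding coxeter_type_A_def by blast
  interpret hecke_rep W S q scale \<phi>
    using assms by (simp add: hecke_rep_def hecke_rep_axioms_def coxeter_type_A_def coxeter_system_def
        coxeter_def coxeter_axioms_def)
  show ?thesis by (rule good_representation[OF assms(3,2) g])
qed

end
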